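(* Let $K$ be a non-archimedean locally compact field, $d\ge1$, $X$ the Bruhat-Tits building of $\mathrm{PGL}_{d+1}/K$ and $R$ a commutative ring. For any non-empty subset $\mathcal{A}\subset\mathbb{P}(K^{d+1})$, possibly infinite, the cohomological coefficient systems $\widetilde{A}$ and $A$ on $X$ attached to $\mathcal{A}$ (with coefficient ring $R$) satisfy the condition $\mathcal{S}(k)$ for any $1\le k\le d$.
   Context: Notation. $\mathcal{O}_K$ is the ring of integers of $K$, $\pi\in\mathcal{O}_K$ a fixed prime element. A lattice is a free $\mathcal{O}_K$-submodule of $K^{d+1}$ of rank $d+1$; $[L]$ is the homothety class of $L$ (under $K^\times$). The building $X$ and its orientation. Vertices of $X$ are the homothety classes of lattices in $K^{d+1}$. For a lattice chain $\pi L_k\subsetneq L_0\subsetneq L_1\subsetneq\cdots\subsetneq L_k$ the tuple $([L_0],\ldots,[L_k])$ is declared to be a pointed $k$-simplex (with underlying $k$-simplex $\{[L_0],\ldots,[L_k]\}$); this defines the simplicial structure and an orientation (a cyclic ordering on the vertices of each simplex, pointed simplices being the enumerations compatible with it). $X^j$ is the set of $j$-simplices, identified with their vertex sets. The coefficient systems. View $\mathcal{A}$ as a set of lines in $K^{d+1}$; for $a\in K^{d+1}\setminus\{0\}$ let $e_a$ be the line spanned by $a$. $\widetilde{E}$ is the free exterior algebra over $R$ on the set $\mathcal{A}$, and $\delta:\widetilde{E}\to\widetilde{E}$ is the unique (graded) derivation, homogeneous of degree $-1$, with $\delta(e)=1$ for all $e\in\mathcal{A}$; so $\delta(e_0\wedge\cdots\wedge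 e_k)=\sum_{i=0}^k(-1)^ie_0\wedge\cdots\wedge\widehat{e_i}\wedge\cdots\wedge e_k$. Put $E=\operatorname{im}(\delta)=\ker(\delta)$, a subalgebra of $\widetilde{E}$. For a vertex $x$, an element $g\in\widetilde{E}$ is a standard generator of $I(x)$ if there are a lattice $L_x$ representing $x$ and elements $a_0,\ldots,a_m\in L_x\setminus\pi L_x$ with $e_{a_i}\in\mathcal{A}$, linearly dependent modulo $\pi L_x$ (i.e. in the vector space $L_x/\pi L_x$ over the residue field), such that $g=\delta(e_{a_0}\wedge\cdots\wedge e_{a_m})$. $I(x)\subset\widetilde{E}$ is the ideal generated by the standard generators of $I(x)$; for a simplex $\sigma$, $I(\sigma)=\sum_{x\in\sigma}I(x)$. Put $\widetilde{A}(\sigma)=\widetilde{E}/I(\sigma)$ and $A(\sigma)=E/(E\cap I(\sigma))$; with the natural projections as transition maps these form the ccs $\widetilde{A}$ and $A$ on $X$. Coefficient systems in general. A cohomological coefficient system (ccs) $\mathcal{F}$ on $X$ assigns to every simplex $\tau$ an abelian group $\mathcal{F}(\tau)$ and to every face inclusion $\tau\subset\sigma$ a homomorphism $r^\tau_\sigma:\mathcal{F}(\tau)\to\mathcal{F}(\sigma)$, transitively and with $r^\tau_\tau=\mathrm{id}$. $C^k(X,\mathcal{F})=\prod_{\tau\in X^k}\mathcal{F}(\tau)$, with $\partial^{k+1}:C^k\to C^{k+1}$, $(\partial c)_\tau=\sum_{\tau'\subset\tau}[\tau:\tau']r^{\tau'}_\tau(c_{\tau'})$ (sum over codimension one faces,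 $[\tau:\tau']=\pm1$ incidence numbers with respect to a fixed labelling of $X$ by vertex types). Stability. For a pointed simplex $(x_0,\ldots,x_k)$ let $\ell((x_0,\ldots,x_k))$ be the maximal $r$ such that there is a pointed $r$-simplex $(y_0,\ldots,y_r)$ with $y_0=x_0$, $y_r=x_k$. For a pointed $(k-1)$-simplex $\widehat{\eta}=(x_1,\ldots,x_k)$ let $N_{\widehat{\eta}}=\{z\in X^0:(z,\widehat{\eta})=(z,x_1,\ldots,x_k)\text{ is a pointed }k\text{-simplex}\}$, partially ordered by $u_1\le u_2$ iff $u_1=u_2$ or $(u_1,u_2,\widehat{\eta})$ is a pointed $(k+1)$-simplex. For $u_1,u_2\in N_{\widehat{\eta}}$, if $W=\{u\in N_{\widehat{\eta}}:u\le u_1,u\le u_2\}$ is nonempty then it contains a unique element $u$ with $\ell((u,\widehat{\eta}))<\ell((w,\widehat{\eta}))$ for all $w\in W\setminus\{u\}$, denoted $[\widehat{\eta}|u_1,u_2]$; if $W=\emptyset$ then $[\widehat{\eta}|u_1,u_2]$ is undefined. A subset $M_0\subset N_{\widehat{\eta}}$ is stable with respect to $\widehat{\eta}$ if for any $u_1,u_2\in M_0$ the vertex $[\widehat{\eta}|u_1,u_2]$ is defined and lies in $M_0$. Condition $\mathcal{S}(k)$ for a ccs $\mathcal{F}$: for any pointed $(k-1)$-simplex $\widehat{\eta}$ with underlying simplex $\eta$ and any $M_0\subset N_{\widehat{\eta}}$ stable with respect to $\widehat{\eta}$, the subquotient complex of $C^\bullet(X,\mathcal{F})$ $$\mathcal{F}(\eta)\xrightarrow{\partial^k}\prod_{z\in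 M_0}\mathcal{F}(\{z\}\cup\eta)\xrightarrow{\partial^{k+1}}\prod_{z,z'\in M_0,\ \{z,z'\}\in X^1}\mathcal{F}(\{z,z'\}\cup\eta)$$ is exact (at the middle term). *)

theory Defs
  imports "HOL-Analysis.Analysis" "HOL-Algebra.QuotRing" "HOL-Library.Poly_Mapping"
begin

section \<open>Non-archimedean locally compact fields\<close>

text \<open>
  The topology of \<open>K\<close> is given by a non-trivial non-archimedean absolute value \<open>av\<close>. The notions
  below depend on \<open>av\<close> only through its ring of integers, hence only on the topology.
\<close>

locale nonarch_local_field =
  fixes av :: "'k::field \<Rightarrow> real"
  assumes av_nonneg: "av x \<ge> 0"
    and av_eq_0_iff: "av x = 0 \<longleftrightarrow> x = 0"
    and av_mult: "av (x * y) = av x * av y"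
    and av_ultrametric: "av (x + y) \<le> max (av x) (av y)"
    and av_nontrivial: "\<exists>x. x \<noteq> 0 \<and> av x \<noteq> 1"
    and av_locally_compact:
      "locally_compact_space (Metric_space.mtopology UNIV (\<lambda>x y. av (x - y)))"

definition int_ring :: "('k::field \<Rightarrow> real) \<Rightarrow> 'k set" where
  "int_ring av = {x. av x \<le> 1}"

definition prime_element :: "('k::field \<Rightarrow> real) \<Rightarrow> 'k \<Rightarrow> bool" where
  "prime_element av \<pi> \<longleftrightarrow> \<pi> \<in> int_ring av \<and> {x. av x < 1} = (\<lambda>y. \<pi> * y) ` int_ring av"


section \<open>The building and its orientation\<close>

text \<open>
  \<open>K\<^sup>d\<^sup>+\<^sup>1\<close> is the type \<^typ>\<open>'k ^ 'n\<close> with \<open>CARD('n) = d + 1\<close>. A lattice is the free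
  \<open>\<O>\<close>-module on a family of \<open>d + 1\<close> vectors that is linearly independent over \<open>\<O>\<close>.
\<close>

definition is_lattice :: "('k::field \<Rightarrow> real) \<Rightarrow> ('k ^ 'n) set \<Rightarrow> bool" where
  "is_lattice av L \<longleftrightarrow> (\<exists>b :: 'n \<Rightarrow> 'k ^ 'n.
     (\<forall>c. (\<forall>i. c i \<in> int_ring av) \<and> (\<Sum>i\<in>UNIV. c i *s b i) = 0 \<longrightarrow> (\<forall>i. c i = 0)) \<and>
     L = {\<Sum>i\<in>UNIV. c i *s b i | c. \<forall>i. c i \<in> int_ring av})"

definition scale_set :: "'k::field \<Rightarrow> ('k ^ 'n) set \<Rightarrow> ('k ^ 'n) set" where
  "scale_set c L = (\<lambda>v. c *s v) ` L"

type_synonym ('k, 'n) vertex = "('k ^ 'n) set set"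

definition hclass :: "('k::field ^ 'n) set \<Rightarrow> ('k, 'n::finite) vertex" where
  "hclass L = {scale_set c L | c. c \<noteq> 0}"

text \<open>A pointed \<open>k\<close>-simplex is a list of \<open>k + 1\<close> vertices.\<close>

definition pointed :: "('k::field \<Rightarrow> real) \<Rightarrow> 'k \<Rightarrow> nat \<Rightarrow> ('k, 'n::finite) vertex list \<Rightarrow> bool" where
  "pointed av \<pi> k xs \<longleftrightarrow> (\<exists>Ls. length Ls = k + 1 \<and> (\<forall>L\<in>set Ls. is_lattice av L) \<and>
     scale_set \<pi> (last Ls) \<subset> hd Ls \<and> sorted_wrt (\<subset>) Ls \<and> xs = map hclass Ls)"

definition simplices ::
    "('k::field \<Rightarrow> real) \<Rightarrow> 'k \<Rightarrow> nat \<Rightarrow> ('k, 'n::finite) vertex set set" where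
  "simplices av \<pi> k = {set xs | xs. pointed av \<pi> k xs}"

definition all_simplices ::
    "('k::field \<Rightarrow> real) \<Rightarrow> 'k \<Rightarrow> ('k, 'n::finite) vertex set set" where
  "all_simplices av \<pi> = (\<Union>k. simplices av \<pi> k)"

text \<open>A labelling of the vertices by the types \<open>0, \<dots>, d\<close>: the vertices of each simplex have
  distinct types.\<close>

definition labelling ::
    "('k::field \<Rightarrow> real) \<Rightarrow> 'k \<Rightarrow> (('k, 'n::finite) vertex \<Rightarrow> nat) \<Rightarrow> bool" where
  "labelling av \<pi> lab \<longleftrightarrow>
     (\<forall>L. is_lattice av L \<longrightarrow> lab (hclass L) < CARD('n)) \<and>
     (\<forall>\<sigma>\<in>all_simplices av \<pi>. inj_on lab \<sigma>)"


section \<open>Stability\<close>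

definition ell :: "('k::field \<Rightarrow> real) \<Rightarrow> 'k \<Rightarrow> ('k, 'n::finite) vertex list \<Rightarrow> nat" where
  "ell av \<pi> xs = (GREATEST r. \<exists>ys. pointed av \<pi> r ys \<and> hd ys = hd xs \<and> last ys = last xs)"

text \<open>For a pointed \<open>(k-1)\<close>-simplex \<open>h\<close>, given as a list of length \<open>k\<close>.\<close>

definition nbrs :: "('k::field \<Rightarrow> real) \<Rightarrow> 'k \<Rightarrow> ('k, 'n::finite) vertex list \<Rightarrow> ('k, 'n) vertex set" where
  "nbrs av \<pi> h = {z. pointed av \<pi> (length h) (z # h)}"

definition nbr_le ::
    "('k::field \<Rightarrow> real) \<Rightarrow> 'k \<Rightarrow> ('k, 'n::finite) vertex list \<Rightarrow> ('k, 'n) vertex \<Rightarrow> ('k, 'n) vertex \<Rightarrow> bool" where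
  "nbr_le av \<pi> h u1 u2 \<longleftrightarrow> u1 = u2 \<or> pointed av \<pi> (length h + 1) (u1 # u2 # h)"

text \<open>\<open>is_bracket av \<pi> h u1 u2 u\<close> says that \<open>[h | u1, u2]\<close> is defined and equal to \<open>u\<close>; the strict
  inequality makes \<open>u\<close> unique.\<close>

definition is_bracket ::
    "('k::field \<Rightarrow> real) \<Rightarrow> 'k \<Rightarrow> ('k, 'n::finite) vertex list \<Rightarrow>
     ('k, 'n) vertex \<Rightarrow> ('k, 'n) vertex \<Rightarrow> ('k, 'n) vertex \<Rightarrow> bool" where
  "is_bracket av \<pi> h u1 u2 u \<longleftrightarrow>
     (let W = {w \<in> nbrs av \<pi> h. nbr_le av \<pi> h w u1 \<and> nbr_le av \<pi> h w u2}
      in u \<in> W \<and> (\<forall>w\<in>W - {u}. ell av \<pi> (u # h) < ell av \<pi> (w # h)))"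

definition stable ::
    "('k::field \<Rightarrow> real) \<Rightarrow> 'k \<Rightarrow> ('k, 'n::finite) vertex list \<Rightarrow> ('k, 'n) vertex set \<Rightarrow> bool" where
  "stable av \<pi> h M0 \<longleftrightarrow> M0 \<subseteq> nbrs av \<pi> h \<and>
     (\<forall>u1\<in>M0. \<forall>u2\<in>M0. \<exists>u\<in>M0. is_bracket av \<pi> h u1 u2 u)"


section \<open>Cohomological coefficient systems\<close>

text \<open>Only the additive groups of the records \<open>F \<tau>\<close> matter.\<close>

locale ccs =
  fixes X :: "'v set set"
    and F :: "'v set \<Rightarrow> ('m, 'b) ring_scheme"
    and r :: "'v set \<Rightarrow> 'v set \<Rightarrow> 'm \<Rightarrow> 'm"
  assumes grp: "\<tau> \<in> X \<Longrightarrow> abelian_group (F \<tau>)"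
    and hom: "\<tau> \<in> X \<Longrightarrow> \<sigma> \<in> X \<Longrightarrow> \<tau> \<subseteq> \<sigma> \<Longrightarrow> abelian_group_hom (F \<tau>) (F \<sigma>) (r \<tau> \<sigma>)"
    and refl: "\<tau> \<in> X \<Longrightarrow> a \<in> carrier (F \<tau>) \<Longrightarrow> r \<tau> \<tau> a = a"
    and trans: "\<rho> \<in> X \<Longrightarrow> \<tau> \<in> X \<Longrightarrow> \<sigma> \<in> X \<Longrightarrow> \<rho> \<subseteq> \<tau> \<Longrightarrow> \<tau> \<subseteq> \<sigma> \<Longrightarrow> a \<in> carrier (F \<rho>) \<Longrightarrow>
      r \<tau> \<sigma> (r \<rho> \<tau> a) = r \<rho> \<sigma> a"

text \<open>If the vertices of \<open>\<tau>\<close> are enumerated as \<open>v\<^sub>0, \<dots>, v\<^sub>k\<close> with increasing labels and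
  \<open>\<tau>' = \<tau> - {v\<^sub>i}\<close>, this is \<open>(-1)\<^sup>i\<close>.\<close>

definition incidence :: "('v \<Rightarrow> nat) \<Rightarrow> 'v set \<Rightarrow> 'v set \<Rightarrow> int" where
  "incidence lab \<tau> \<tau>' = (-1) ^ card {w \<in> \<tau>. \<exists>v\<in>\<tau> - \<tau>'. lab w < lab v}"

text \<open>The product \<open>\<Prod>\<^bsub>\<tau>\<in>S\<^esub> F \<tau>\<close>, realised by families extended by zero outside \<open>S\<close>. For
  \<open>S\<close> the set of all \<open>k\<close>-simplices this is the group of \<open>k\<close>-cochains.\<close>

definition cochains ::
    "('v set \<Rightarrow> ('m, 'b) ring_scheme) \<Rightarrow> 'v set set \<Rightarrow> ('v set \<Rightarrow> 'm) set" where
  "cochains F S = {c. (\<forall>\<tau>\<in>S. c \<tau> \<in> carrier (F \<tau>)) \<and> (\<forall>\<tau>. \<tau> \<notin> S \<longrightarrow> c \<tau> = \<zero>\<^bsub>F \<tau>\<^esub>)}"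

text \<open>The value at the \<open>k\<close>-simplex \<open>\<tau>\<close> of the coboundary of the \<open>(k-1)\<close>-cochain \<open>c\<close>.\<close>

definition coboundary ::
    "('k::field \<Rightarrow> real) \<Rightarrow> 'k \<Rightarrow> (('k, 'n::finite) vertex \<Rightarrow> nat) \<Rightarrow>
     (('k, 'n) vertex set \<Rightarrow> ('m, 'b) ring_scheme) \<Rightarrow>
     (('k, 'n) vertex set \<Rightarrow> ('k, 'n) vertex set \<Rightarrow> 'm \<Rightarrow> 'm) \<Rightarrow>
     nat \<Rightarrow> (('k, 'n) vertex set \<Rightarrow> 'm) \<Rightarrow> ('k, 'n) vertex set \<Rightarrow> 'm" where
  "coboundary av \<pi> lab F r k c \<tau> =
     (\<Oplus>\<^bsub>F \<tau>\<^esub>\<tau>'\<in>{\<tau>' \<in> simplices av \<pi> (k - 1). \<tau>' \<subset> \<tau>}.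
        [incidence lab \<tau> \<tau>'] \<cdot>\<^bsub>F \<tau>\<^esub> r \<tau>' \<tau> (c \<tau>'))"

text \<open>For sets of simplices \<open>S0\<close>, \<open>S1\<close>, \<open>S2\<close> of dimensions \<open>k-1\<close>, \<open>k\<close>, \<open>k+1\<close>: exactness at the
  middle term of the subquotient complex of products over \<open>S0\<close>, \<open>S1\<close>, \<open>S2\<close>, whose differentials
  are the corresponding components of the coboundary maps.\<close>

definition exact_at_middle ::
    "('k::field \<Rightarrow> real) \<Rightarrow> 'k \<Rightarrow> (('k, 'n::finite) vertex \<Rightarrow> nat) \<Rightarrow>
     (('k, 'n) vertex set \<Rightarrow> ('m, 'b) ring_scheme) \<Rightarrow>
     (('k, 'n) vertex set \<Rightarrow> ('k, 'n) vertex set \<Rightarrow> 'm \<Rightarrow> 'm) \<Rightarrow>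
     nat \<Rightarrow> ('k, 'n) vertex set set \<Rightarrow> ('k, 'n) vertex set set \<Rightarrow> ('k, 'n) vertex set set \<Rightarrow> bool" where
  "exact_at_middle av \<pi> lab F r k S0 S1 S2 \<longleftrightarrow> (\<forall>c\<in>cochains F S1.
     (\<forall>\<tau>\<in>S2. coboundary av \<pi> lab F r (k + 1) c \<tau> = \<zero>\<^bsub>F \<tau>\<^esub>) \<longleftrightarrow>
     (\<exists>b\<in>cochains F S0. \<forall>\<tau>\<in>S1. coboundary av \<pi> lab F r k b \<tau> = c \<tau>))"

definition condition_S ::
    "('k::field \<Rightarrow> real) \<Rightarrow> 'k \<Rightarrow> (('k, 'n::finite) vertex \<Rightarrow> nat) \<Rightarrow>
     (('k, 'n) vertex set \<Rightarrow> ('m, 'b) ring_scheme) \<Rightarrow>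
     (('k, 'n) vertex set \<Rightarrow> ('k, 'n) vertex set \<Rightarrow> 'm \<Rightarrow> 'm) \<Rightarrow> nat \<Rightarrow> bool" where
  "condition_S av \<pi> lab F r k \<longleftrightarrow>
     (\<forall>h M0. pointed av \<pi> (k - 1) h \<longrightarrow> stable av \<pi> h M0 \<longrightarrow>
        exact_at_middle av \<pi> lab F r k
          {set h}
          {{z} \<union> set h | z. z \<in> M0}
          {{z, z'} \<union> set h | z z'. z \<in> M0 \<and> z' \<in> M0 \<and> {z, z'} \<in> simplices av \<pi> 1})"


section \<open>The free exterior algebra\<close>

text \<open>
  Lists are made into the free monoid (written additively), so that \<^typ>\<open>'a list \<Rightarrow>\<^sub>0 'r\<close> with its
  convolution product is the free associative algebra on \<^typ>\<open>'a\<close>. The sort of the coefficients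
  admits the zero ring.
\<close>

instantiation list :: (type) monoid_add
begin
definition zero_list :: "'a list" where "zero_list = []"
definition plus_list :: "'a list \<Rightarrow> 'a list \<Rightarrow> 'a list" where "plus_list xs ys = xs @ ys"
instance by standard (auto simp: zero_list_def plus_list_def)
end

definition free_alg :: "'a set \<Rightarrow> ('a list \<Rightarrow>\<^sub>0 'r::{comm_ring, comm_monoid_mult}) ring" where
  "free_alg A = \<lparr>carrier = {f. Poly_Mapping.keys f \<subseteq> lists A}, mult = (*),
     one = Poly_Mapping.single [] 1, zero = 0, add = (+)\<rparr>"

text \<open>The ideal generated by the squares of the elements of the free module on \<open>A\<close>.\<close>

definition ext_rel :: "'a set \<Rightarrow> ('a list \<Rightarrow>\<^sub>0 'r::{comm_ring, comm_monoid_mult}) set" where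
  "ext_rel A = Idl\<^bsub>free_alg A\<^esub> {m * m | m. Poly_Mapping.keys m \<subseteq> {[a] | a. a \<in> A}}"

definition ext_alg :: "'a set \<Rightarrow> ('a list \<Rightarrow>\<^sub>0 'r::{comm_ring, comm_monoid_mult}) set ring" where
  "ext_alg A = free_alg A Quot ext_rel A"

definition ext_gen :: "'a set \<Rightarrow> 'a \<Rightarrow> ('a list \<Rightarrow>\<^sub>0 'r::{comm_ring, comm_monoid_mult}) set" where
  "ext_gen A a = ext_rel A +>\<^bsub>free_alg A\<^esub> Poly_Mapping.single [a] 1"

definition wedge :: "'a set \<Rightarrow> 'a list \<Rightarrow> ('a list \<Rightarrow>\<^sub>0 'r::{comm_ring, comm_monoid_mult}) set" where
  "wedge A as = foldr (\<lambda>a g. ext_gen A a \<otimes>\<^bsub>ext_alg A\<^esub> g) as \<one>\<^bsub>ext_alg A\<^esub>"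

text \<open>The derivation is defined on the free algebra and descends to the exterior algebra.\<close>

definition free_delta ::
    "('a list \<Rightarrow>\<^sub>0 'r::{comm_ring, comm_monoid_mult}) \<Rightarrow> ('a list \<Rightarrow>\<^sub>0 'r)" where
  "free_delta f = (\<Sum>w\<in>Poly_Mapping.keys f. \<Sum>i<length w.
     Poly_Mapping.single (take i w @ drop (Suc i) w)
       (if even i then Poly_Mapping.lookup f w else - Poly_Mapping.lookup f w))"

definition ext_delta ::
    "'a set \<Rightarrow> ('a list \<Rightarrow>\<^sub>0 'r::{comm_ring, comm_monoid_mult}) set \<Rightarrow> ('a list \<Rightarrow>\<^sub>0 'r) set" where
  "ext_delta A c = (\<Union>f\<in>c. ext_rel A +>\<^bsub>free_alg A\<^esub> free_delta f)"

text \<open>The subalgebra \<open>E = im \<delta>\<close>.\<close>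

definition ext_im :: "'a set \<Rightarrow> ('a list \<Rightarrow>\<^sub>0 'r::{comm_ring, comm_monoid_mult}) set ring" where
  "ext_im A = (ext_alg A)\<lparr>carrier := ext_delta A ` carrier (ext_alg A)\<rparr>"


section \<open>The coefficient systems attached to a set of lines\<close>

definition line :: "'k::field ^ 'n \<Rightarrow> ('k ^ 'n) set" where
  "line a = vec.span {a}"

definition projective_space :: "('k::field ^ 'n) set set" where
  "projective_space = {line a | a. a \<noteq> 0}"

text \<open>Linear dependence of the reductions in \<open>L/\<pi>L\<close>: the coefficients in the residue field are
  represented by integers, not all of which reduce to zero.\<close>

definition dependent_mod ::
    "('k::field \<Rightarrow> real) \<Rightarrow> 'k \<Rightarrow> ('k ^ 'n) set \<Rightarrow> ('k ^ 'n) list \<Rightarrow> bool" where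
  "dependent_mod av \<pi> L as \<longleftrightarrow> (\<exists>c :: nat \<Rightarrow> 'k.
     (\<forall>i<length as. c i \<in> int_ring av) \<and>
     (\<exists>i<length as. c i \<notin> (\<lambda>y. \<pi> * y) ` int_ring av) \<and>
     (\<Sum>i<length as. c i *s as ! i) \<in> scale_set \<pi> L)"

definition std_gens ::
    "('k::field \<Rightarrow> real) \<Rightarrow> 'k \<Rightarrow> ('k ^ 'n) set set \<Rightarrow> ('k, 'n) vertex \<Rightarrow>
     (('k ^ 'n) set list \<Rightarrow>\<^sub>0 'r::{comm_ring, comm_monoid_mult}) set set" where
  "std_gens av \<pi> A x = {ext_delta A (wedge A (map line as)) | as.
     \<exists>L. is_lattice av L \<and> hclass L = x \<and> as \<noteq> [] \<and> set as \<subseteq> L - scale_set \<pi> L \<and>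
         line ` set as \<subseteq> A \<and> dependent_mod av \<pi> L as}"

definition vertex_ideal ::
    "('k::field \<Rightarrow> real) \<Rightarrow> 'k \<Rightarrow> ('k ^ 'n) set set \<Rightarrow> ('k, 'n) vertex \<Rightarrow>
     (('k ^ 'n) set list \<Rightarrow>\<^sub>0 'r::{comm_ring, comm_monoid_mult}) set set" where
  "vertex_ideal av \<pi> A x = Idl\<^bsub>ext_alg A\<^esub> (std_gens av \<pi> A x)"

text \<open>The sum of the ideals of the vertices, i.e. the ideal generated by their union.\<close>

definition simplex_ideal ::
    "('k::field \<Rightarrow> real) \<Rightarrow> 'k \<Rightarrow> ('k ^ 'n) set set \<Rightarrow> ('k, 'n) vertex set \<Rightarrow>
     (('k ^ 'n) set list \<Rightarrow>\<^sub>0 'r::{comm_ring, comm_monoid_mult}) set set" where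
  "simplex_ideal av \<pi> A \<sigma> = Idl\<^bsub>ext_alg A\<^esub> (\<Union>x\<in>\<sigma>. vertex_ideal av \<pi> A x)"

text \<open>The natural projections send a coset \<open>g + I\<close> to \<open>(g + I) + J = g + J\<close> for \<open>I \<subseteq> J\<close>.\<close>

definition At_sys ::
    "('k::field \<Rightarrow> real) \<Rightarrow> 'k \<Rightarrow> ('k ^ 'n) set set \<Rightarrow> ('k, 'n) vertex set \<Rightarrow>
     (('k ^ 'n) set list \<Rightarrow>\<^sub>0 'r::{comm_ring, comm_monoid_mult}) set set ring" where
  "At_sys av \<pi> A \<sigma> = ext_alg A Quot simplex_ideal av \<pi> A \<sigma>"

definition At_res ::
    "('k::field \<Rightarrow> real) \<Rightarrow> 'k \<Rightarrow> ('k ^ 'n) set set \<Rightarrow> ('k, 'n) vertex set \<Rightarrow> ('k, 'n) vertex set \<Rightarrow>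
     (('k ^ 'n) set list \<Rightarrow>\<^sub>0 'r::{comm_ring, comm_monoid_mult}) set set \<Rightarrow>
     (('k ^ 'n) set list \<Rightarrow>\<^sub>0 'r) set set" where
  "At_res av \<pi> A \<tau> \<sigma> c = c <+>\<^bsub>ext_alg A\<^esub> simplex_ideal av \<pi> A \<sigma>"

definition A_sys ::
    "('k::field \<Rightarrow> real) \<Rightarrow> 'k \<Rightarrow> ('k ^ 'n) set set \<Rightarrow> ('k, 'n) vertex set \<Rightarrow>
     (('k ^ 'n) set list \<Rightarrow>\<^sub>0 'r::{comm_ring, comm_monoid_mult}) set set ring" where
  "A_sys av \<pi> A \<sigma> = ext_im A Quot (carrier (ext_im A) \<inter> simplex_ideal av \<pi> A \<sigma>)"

definition A_res ::
    "('k::field \<Rightarrow> real) \<Rightarrow> 'k \<Rightarrow> ('k ^ 'n) set set \<Rightarrow> ('k, 'n) vertex set \<Rightarrow> ('k, 'n) vertex set \<Rightarrow>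
     (('k ^ 'n) set list \<Rightarrow>\<^sub>0 'r::{comm_ring, comm_monoid_mult}) set set \<Rightarrow>
     (('k ^ 'n) set list \<Rightarrow>\<^sub>0 'r) set set" where
  "A_res av \<pi> A \<tau> \<sigma> c = c <+>\<^bsub>ext_im A\<^esub> (carrier (ext_im A) \<inter> simplex_ideal av \<pi> A \<sigma>)"


section \<open>Well-definedness of the above constructions\<close>

text \<open>
  The exterior algebra is a ring, the derivation is well defined on it and given by the usual
  alternating sum, and the two families of quotients are coefficient systems on the building.
\<close>

lemma poly_mapping_eq_sum_single:
  fixes f :: "'a \<Rightarrow>\<^sub>0 'b::comm_monoid_add"
  shows "f = (\<Sum>w\<in>Poly_Mapping.keys f. Poly_Mapping.single w (Poly_Mapping.lookup f w))"
proof (rule poly_mapping_eqI)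
  fix v
  have "(\<Sum>w\<in>Poly_Mapping.keys f. Poly_Mapping.lookup (Poly_Mapping.single w (Poly_Mapping.lookup f w)) v)
      = (\<Sum>w\<in>Poly_Mapping.keys f. if v = w then Poly_Mapping.lookup f w else 0)"
    by (intro sum.cong) (auto simp: lookup_single when_def)
  then show "Poly_Mapping.lookup f v = Poly_Mapping.lookup
      (\<Sum>w\<in>Poly_Mapping.keys f. Poly_Mapping.single w (Poly_Mapping.lookup f w)) v"
    by (simp add: lookup_sum sum.delta in_keys_iff)
qed

lemma free_alg_induct [consumes 1, case_names zero add single]:
  fixes f :: "'a \<Rightarrow>\<^sub>0 'b::comm_monoid_add"
  assumes "Poly_Mapping.keys f \<subseteq> W"
    and "P 0"
    and "\<And>f g. Poly_Mapping.keys f \<subseteq> W \<Longrightarrow> Poly_Mapping.keys g \<subseteq> W \<Longrightarrow> P f \<Longrightarrow> P g \<Longrightarrow> P (f + g)"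
    and "\<And>w r. w \<in> W \<Longrightarrow> P (Poly_Mapping.single w r)"
  shows "P f"
proof -
  have *: "P (\<Sum>w\<in>B. Poly_Mapping.single w (Poly_Mapping.lookup f w)) \<and>
      Poly_Mapping.keys (\<Sum>w\<in>B. Poly_Mapping.single w (Poly_Mapping.lookup f w)) \<subseteq> W"
    if "finite B" "B \<subseteq> W" for B
    using that
  proof (induction B rule: finite_induct)
    case empty
    show ?case using assms(2) by simp
  next
    case (insert w B)
    have k: "Poly_Mapping.keys (Poly_Mapping.single w (Poly_Mapping.lookup f w)) \<subseteq> W"
      using insert.prems by auto
    show ?case
      using insert k keys_add[of "Poly_Mapping.single w (Poly_Mapping.lookup f w)"
          "\<Sum>w\<in>B. Poly_Mapping.single w (Poly_Mapping.lookup f w)"]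
      by (auto intro!: assms(3,4))
  qed
  show ?thesis
    using *[OF finite_keys assms(1)] poly_mapping_eq_sum_single[of f] by simp
qed

lemma free_alg_simps [simp]:
  "carrier (free_alg A) = {f. Poly_Mapping.keys f \<subseteq> lists A}"
  "mult (free_alg A) = (*)" "one (free_alg A) = Poly_Mapping.single [] 1"
  "zero (free_alg A) = 0" "add (free_alg A) = (+)"
  by (simp_all add: free_alg_def)

lemma keys_add_lists:
  "Poly_Mapping.keys f \<subseteq> lists A \<Longrightarrow> Poly_Mapping.keys g \<subseteq> lists A \<Longrightarrow>
   Poly_Mapping.keys (f + g) \<subseteq> lists A"
  using keys_add[of f g] by blast

lemma keys_mult_lists:
  "Poly_Mapping.keys f \<subseteq> lists A \<Longrightarrow> Poly_Mapping.keys g \<subseteq> lists A \<Longrightarrow>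
   Poly_Mapping.keys (f * g) \<subseteq> lists A"
  using keys_mult[of f g] by (fastforce simp: plus_list_def)

lemma single_Nil_mult [simp]:
  fixes f :: "'a list \<Rightarrow>\<^sub>0 'r::{comm_ring, comm_monoid_mult}"
  shows "Poly_Mapping.single [] 1 * f = f" "f * Poly_Mapping.single [] 1 = f"
proof -
  have "Poly_Mapping.keys f \<subseteq> UNIV" by simp
  then have "Poly_Mapping.single [] 1 * f = f \<and> f * Poly_Mapping.single [] 1 = f"
    by (induction rule: free_alg_induct)
       (auto simp: mult_single plus_list_def algebra_simps)
  then show "Poly_Mapping.single [] 1 * f = f" "f * Poly_Mapping.single [] 1 = f" by auto
qed

lemma ring_free_alg: "ring (free_alg A :: ('a list \<Rightarrow>\<^sub>0 'r::{comm_ring, comm_monoid_mult}) ring)"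
proof (rule ringI)
  show "abelian_group (free_alg A :: ('a list \<Rightarrow>\<^sub>0 'r) ring)"
  proof (rule abelian_groupI)
    fix x :: "'a list \<Rightarrow>\<^sub>0 'r" assume "x \<in> carrier (free_alg A)"
    then show "\<exists>y\<in>carrier (free_alg A). y \<oplus>\<^bsub>free_alg A\<^esub> x = \<zero>\<^bsub>free_alg A\<^esub>"
      by (intro bexI[of _ "- x"]) (auto simp: in_keys_iff)
  qed (use keys_add in \<open>fastforce simp: algebra_simps\<close>)+
  show "Group.monoid (free_alg A :: ('a list \<Rightarrow>\<^sub>0 'r) ring)"
    by (rule monoidI) (simp_all add: keys_mult_lists mult.assoc)
qed (auto simp: algebra_simps)

lemma ext_rel_gens_subset:
  "{m * m | m. Poly_Mapping.keys m \<subseteq> {[a] | a. a \<in> A}}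
    \<subseteq> carrier (free_alg A :: ('a list \<Rightarrow>\<^sub>0 'r::{comm_ring, comm_monoid_mult}) ring)"
proof -
  have "Poly_Mapping.keys (m * m) \<subseteq> lists A"
    if "Poly_Mapping.keys m \<subseteq> {[a] | a. a \<in> A}" for m :: "'a list \<Rightarrow>\<^sub>0 'r"
    using that by (intro keys_mult_lists) auto
  then show ?thesis by auto
qed

lemma ideal_ext_rel:
  "ideal (ext_rel A) (free_alg A :: ('a list \<Rightarrow>\<^sub>0 'r::{comm_ring, comm_monoid_mult}) ring)"
  unfolding ext_rel_def by (rule ring.genideal_ideal[OF ring_free_alg ext_rel_gens_subset])

lemma ring_ext_alg: "ring (ext_alg A :: ('a list \<Rightarrow>\<^sub>0 'r::{comm_ring, comm_monoid_mult}) set ring)"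
  unfolding ext_alg_def by (rule ideal.quotient_is_ring[OF ideal_ext_rel])

definition fd_word :: "'a list \<Rightarrow> 'r::{comm_ring, comm_monoid_mult} \<Rightarrow> ('a list \<Rightarrow>\<^sub>0 'r)" where
  "fd_word w r = (\<Sum>i<length w. Poly_Mapping.single (take i w @ drop (Suc i) w) (if even i then r else - r))"

lemma fd_word_0 [simp]: "fd_word w 0 = 0"
  by (simp add: fd_word_def cong: if_cong)

lemma fd_word_add: "fd_word w (r + s) = fd_word w r + fd_word w s"
  by (simp add: fd_word_def single_add[symmetric] sum.distrib[symmetric] if_distrib cong: if_cong)

lemma free_delta_fd: "free_delta f = (\<Sum>w\<in>Poly_Mapping.keys f. fd_word w (Poly_Mapping.lookup f w))"
  by (simp add: free_delta_def fd_word_def)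

lemma free_delta_0 [simp]: "free_delta 0 = 0"
  by (simp add: free_delta_def)

lemma free_delta_add: "free_delta (f + g) = free_delta f + free_delta g"
  unfolding free_delta_fd
  by (rule setsum_keys_plus_distrib) (auto simp: fd_word_add)

lemma free_delta_single: "free_delta (Poly_Mapping.single w r) = fd_word w r"
  by (simp add: free_delta_fd)

lemma fd_word_Cons:
  "fd_word (a # w) r = Poly_Mapping.single w r - Poly_Mapping.single [a] 1 * fd_word w r"
  unfolding fd_word_def length_Cons sum.lessThan_Suc_shift
  by (simp add: sum_distrib_left mult_single plus_list_def sum_negf[symmetric] single_uminus[symmetric])
     (intro sum.cong, auto simp: single_uminus)

text \<open>The grading involution, acting as \<open>(-1)\<^sup>n\<close> in degree \<open>n\<close>.\<close>

definition sgn_inv :: "('a list \<Rightarrow>\<^sub>0 'r::{comm_ring, comm_monoid_mult}) \<Rightarrow> ('a list \<Rightarrow>\<^sub>0 'r)" where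
  "sgn_inv f = (\<Sum>w\<in>Poly_Mapping.keys f.
     Poly_Mapping.single w (if even (length w) then Poly_Mapping.lookup f w else - Poly_Mapping.lookup f w))"

lemma sgn_inv_0 [simp]: "sgn_inv 0 = 0" by (simp add: sgn_inv_def)
lemma sgn_inv_add: "sgn_inv (f + g) = sgn_inv f + sgn_inv g"
  unfolding sgn_inv_def
  by (rule setsum_keys_plus_distrib) (auto simp: single_add[symmetric])
lemma sgn_inv_single: "sgn_inv (Poly_Mapping.single w r) = Poly_Mapping.single w (if even (length w) then r else - r)"
  by (simp add: sgn_inv_def)

lemma fd_word_append:
  "fd_word (u @ v) (r * s) = fd_word u r * Poly_Mapping.single v s
     + sgn_inv (Poly_Mapping.single u r) * fd_word v s"
proof (induction u)
  case Nil
  have "fd_word v (r * s) = Poly_Mapping.single [] r * fd_word v s"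
    by (simp add: fd_word_def sum_distrib_left mult_single plus_list_def) (intro sum.cong, auto)
  then show ?case by (simp add: sgn_inv_single) (simp add: fd_word_def)
next
  case (Cons a u)
  have 1: "Poly_Mapping.single [a] 1 * Poly_Mapping.single u r' = Poly_Mapping.single (a # u) r'" for r' :: 'b
    by (simp add: mult_single plus_list_def)
  have 2: "sgn_inv (Poly_Mapping.single (a # u) r) = - (Poly_Mapping.single [a] 1 * sgn_inv (Poly_Mapping.single u r))"
    by (simp add: sgn_inv_single 1 single_uminus[symmetric])
  have 3: "Poly_Mapping.single (u @ v) (r * s) = Poly_Mapping.single u r * Poly_Mapping.single v s"
    by (simp add: mult_single plus_list_def)
  show ?case
    unfolding append_Cons fd_word_Cons Cons.IH 2 3
    by (simp add: distrib_left distrib_right left_diff_distrib right_diff_distrib mult.assoc)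
qed

lemma free_delta_mult:
  "free_delta (f * g) = free_delta f * g + sgn_inv f * free_delta g"
proof -
  have "Poly_Mapping.keys f \<subseteq> UNIV" "Poly_Mapping.keys g \<subseteq> UNIV" by simp_all
  from this(1) show ?thesis
  proof (induction rule: free_alg_induct)
    case (single u r)
    from \<open>Poly_Mapping.keys g \<subseteq> UNIV\<close> show ?case
    proof (induction rule: free_alg_induct)
      case (single v s)
      show ?case using fd_word_append[of u v r s]
        by (simp add: mult_single free_delta_single plus_list_def)
    qed (simp_all add: algebra_simps free_delta_add)
  qed (simp_all add: algebra_simps free_delta_add sgn_inv_add)
qed

lemma sgn_inv_mult: "sgn_inv (f * g) = sgn_inv f * sgn_inv g"
proof -
  have "Poly_Mapping.keys f \<subseteq> UNIV" "Poly_Mapping.keys g \<subseteq> UNIV" by simp_all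
  from this(1) show ?thesis
  proof (induction rule: free_alg_induct)
    case (single u r)
    from \<open>Poly_Mapping.keys g \<subseteq> UNIV\<close> show ?case
    proof (induction rule: free_alg_induct)
      case (single v s)
      show ?case 
        by (simp add: mult_single sgn_inv_single plus_list_def)
    qed (simp_all add: algebra_simps sgn_inv_add)
  qed (simp_all add: algebra_simps sgn_inv_add)
qed

lemma keys_free_delta: "Poly_Mapping.keys f \<subseteq> lists A \<Longrightarrow> Poly_Mapping.keys (free_delta f) \<subseteq> lists A"
proof (induction rule: free_alg_induct)
  case (add f g)
  then show ?case by (simp add: free_delta_add keys_add_lists)
next
  case (single w r)
  then have "Poly_Mapping.keys (fd_word w r) \<subseteq> lists A"
  proof (induction w)
    case (Cons a w)
    have "Poly_Mapping.keys (- (Poly_Mapping.single [a] 1 * fd_word w r)) \<subseteq> lists A"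
      using Cons keys_mult_lists[of "Poly_Mapping.single [a] 1" A "fd_word w r"] by (auto simp: in_keys_iff)
    then show ?case using Cons 
      keys_add[of "Poly_Mapping.single w r" "- (Poly_Mapping.single [a] 1 * fd_word w r)"]
      by (auto simp: fd_word_Cons split: if_splits)
  qed (simp add: fd_word_def)
  then show ?case by (simp add: free_delta_single)
qed simp

lemma keys_sgn_inv: "Poly_Mapping.keys f \<subseteq> lists A \<Longrightarrow> Poly_Mapping.keys (sgn_inv f) \<subseteq> lists A"
proof (induction rule: free_alg_induct)
  case (add f g)
  then show ?case by (simp add: sgn_inv_add keys_add_lists)
qed (auto simp: sgn_inv_single)

lemma single_Nil_commute:
  fixes f :: "'a list \<Rightarrow>\<^sub>0 'r::{comm_ring, comm_monoid_mult}"
  shows "Poly_Mapping.single [] r * f = f * Poly_Mapping.single [] r"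
proof -
  have "Poly_Mapping.keys f \<subseteq> UNIV" by simp
  then show ?thesis
    by (induction rule: free_alg_induct)
       (auto simp: mult_single plus_list_def algebra_simps)
qed

lemma deg_one_props:
  assumes "Poly_Mapping.keys m \<subseteq> {[a] | a. a \<in> A}"
  shows "sgn_inv m = - m" "\<exists>r. free_delta m = Poly_Mapping.single [] r"
proof -
  have "sgn_inv m = - m \<and> (\<exists>r. free_delta m = Poly_Mapping.single [] r)"
    using assms
  proof (induction rule: free_alg_induct)
    case zero
    show ?case by (auto intro!: exI[of _ 0])
  next
    case (add f g)
    then show ?case by (auto simp: sgn_inv_add free_delta_add single_add[symmetric])
  next
    case (single w r)
    then show ?case by (auto simp: sgn_inv_single single_uminus free_delta_single fd_word_def)
  qed
  then show "sgn_inv m = - m" "\<exists>r. free_delta m = Poly_Mapping.single [] r" by auto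
qed

lemma ext_rel_stable:
  fixes f :: "'a list \<Rightarrow>\<^sub>0 'r::{comm_ring, comm_monoid_mult}"
  assumes "f \<in> ext_rel A"
  shows "free_delta f \<in> ext_rel A" "sgn_inv f \<in> ext_rel A"
proof -
  interpret I: ideal "ext_rel A" "free_alg A :: ('a list \<Rightarrow>\<^sub>0 'r) ring" by (rule ideal_ext_rel)
  let ?T = "free_alg A :: ('a list \<Rightarrow>\<^sub>0 'r) ring"
  define J :: "('a list \<Rightarrow>\<^sub>0 'r) set" where "J = {f \<in> ext_rel A. free_delta f \<in> ext_rel A \<and> sgn_inv f \<in> ext_rel A}"
  have sub: "g \<in> ext_rel A \<Longrightarrow> Poly_Mapping.keys g \<subseteq> lists A" for g :: "'a list \<Rightarrow>\<^sub>0 'r"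
    using I.a_subset by auto
  have addc: "g + h \<in> ext_rel A" if "g \<in> ext_rel A" "h \<in> ext_rel A" for g h :: "'a list \<Rightarrow>\<^sub>0 'r"
    using additive_subgroup.a_closed[OF I.additive_subgroup_axioms that] by simp
  have ml: "g * h \<in> ext_rel A" if "h \<in> ext_rel A" "Poly_Mapping.keys g \<subseteq> lists A" for g h :: "'a list \<Rightarrow>\<^sub>0 'r"
    using I.I_l_closed[of h g] that by simp
  have mr: "h * g \<in> ext_rel A" if "h \<in> ext_rel A" "Poly_Mapping.keys g \<subseteq> lists A" for g h :: "'a list \<Rightarrow>\<^sub>0 'r"
    using I.I_r_closed[of h g] that by simp
  have z: "0 \<in> (ext_rel A :: ('a list \<Rightarrow>\<^sub>0 'r) set)"
    using additive_subgroup.zero_closed[OF I.additive_subgroup_axioms] by simp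
  have neg: "- g \<in> ext_rel A" if "g \<in> ext_rel A" for g :: "'a list \<Rightarrow>\<^sub>0 'r"
    using mr[OF that, of "Poly_Mapping.single [] (-1)"] by (simp add: single_uminus)
  have dneg: "free_delta (- g) = - free_delta g" "sgn_inv (- g) = - sgn_inv g" for g :: "'a list \<Rightarrow>\<^sub>0 'r"
    using free_delta_add[of g "- g"] sgn_inv_add[of g "- g"] by (simp_all add: eq_neg_iff_add_eq_0 add.commute)
  have inv: "\<ominus>\<^bsub>?T\<^esub> g = - g" if "g \<in> carrier ?T" for g
    using that by (intro I.minus_equality) (auto simp: in_keys_iff)
  have "ideal J ?T"
  proof (rule idealI[OF ring_free_alg])
    show "subgroup J (add_monoid ?T)"
    proof (rule group.subgroupI)
      show "group (add_monoid ?T)" by (rule I.a_group)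
      show "J \<subseteq> carrier (add_monoid ?T)" using sub by (auto simp: J_def)
      show "J \<noteq> {}" using z by (auto simp: J_def intro: exI[of _ 0])
      fix g assume g: "g \<in> J"
      then have "inv\<^bsub>add_monoid ?T\<^esub> g = - g" using inv[of g] sub by (auto simp: J_def a_inv_def)
      then show "inv\<^bsub>add_monoid ?T\<^esub> g \<in> J" using g by (auto simp: J_def dneg intro: neg)
      fix h assume "h \<in> J"
      then show "g \<otimes>\<^bsub>add_monoid ?T\<^esub> h \<in> J" using g 
        by (auto simp: J_def free_delta_add sgn_inv_add intro: addc)
    qed
    fix g h assume "g \<in> J" "h \<in> carrier ?T"
    then have g: "g \<in> ext_rel A" "free_delta g \<in> ext_rel A" "sgn_inv g \<in> ext_rel A"
      and h: "Poly_Mapping.keys h \<subseteq> lists A" "Poly_Mapping.keys (free_delta h) \<subseteq> lists A"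
        "Poly_Mapping.keys (sgn_inv h) \<subseteq> lists A"
      by (simp_all add: J_def keys_sgn_inv keys_free_delta)
    have "free_delta (h * g) \<in> ext_rel A"
      unfolding free_delta_mult by (intro addc ml g h)
    moreover have "free_delta (g * h) \<in> ext_rel A"
      unfolding free_delta_mult by (intro addc mr g h)
    moreover have "sgn_inv (h * g) \<in> ext_rel A" "sgn_inv (g * h) \<in> ext_rel A"
      unfolding sgn_inv_mult by (intro ml mr g h)+
    ultimately show "h \<otimes>\<^bsub>?T\<^esub> g \<in> J" "g \<otimes>\<^bsub>?T\<^esub> h \<in> J"
      using ml[OF g(1) h(1)] mr[OF g(1) h(1)] by (simp_all add: J_def)
  qed
  moreover have "{m * m | m. Poly_Mapping.keys m \<subseteq> {[a] | a. a \<in> A}} \<subseteq> J"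
  proof clarify
    fix m :: "'a list \<Rightarrow>\<^sub>0 'r" assume m: "Poly_Mapping.keys m \<subseteq> {[a] | a. a \<in> A}"
    obtain r where r: "free_delta m = Poly_Mapping.single [] r" using deg_one_props(2)[OF m] by blast
    have "m * m \<in> ext_rel A"
      using I.genideal_self[OF ext_rel_gens_subset] m unfolding ext_rel_def by blast
    moreover have "free_delta (m * m) = 0"
      by (simp add: free_delta_mult deg_one_props(1)[OF m] r single_Nil_commute[of r m])
    ultimately show "m * m \<in> J" using z
      by (simp add: J_def sgn_inv_mult deg_one_props(1)[OF m])
  qed
  ultimately have "ext_rel A \<subseteq> J" unfolding ext_rel_def by (rule I.genideal_minimal)
  with assms show "free_delta f \<in> ext_rel A" "sgn_inv f \<in> ext_rel A" by (auto simp: J_def)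
qed

lemma ext_delta_coset:
  fixes f :: "'a list \<Rightarrow>\<^sub>0 'r::{comm_ring, comm_monoid_mult}"
  assumes "f \<in> carrier (free_alg A)"
  shows "ext_delta A (ext_rel A +>\<^bsub>free_alg A\<^esub> f) = ext_rel A +>\<^bsub>free_alg A\<^esub> free_delta f"
proof -
  interpret I: ideal "ext_rel A" "free_alg A :: ('a list \<Rightarrow>\<^sub>0 'r) ring" by (rule ideal_ext_rel)
  have car: "free_delta f \<in> carrier (free_alg A)" using assms by (simp add: keys_free_delta)
  have "ext_rel A +>\<^bsub>free_alg A\<^esub> free_delta g = ext_rel A +>\<^bsub>free_alg A\<^esub> free_delta f"
    if "g \<in> ext_rel A +>\<^bsub>free_alg A\<^esub> f" for g
  proof -
    from that obtain h where h: "h \<in> ext_rel A" "g = h + f" by (auto simp: a_r_coset_def')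
    have "free_delta g \<in> ext_rel A +>\<^bsub>free_alg A\<^esub> free_delta f"
      using ext_rel_stable(1)[OF h(1)] by (auto simp: a_r_coset_def' h(2) free_delta_add)
    then show ?thesis using I.a_repr_independence[OF _ car] I.a_subgroup by metis
  qed
  moreover have "f \<in> ext_rel A +>\<^bsub>free_alg A\<^esub> f" using I.a_rcos_self[OF assms] .
  ultimately show ?thesis unfolding ext_delta_def by blast
qed

lemma carrier_ext_algE:
  assumes "c \<in> carrier (ext_alg A)"
  obtains f where "f \<in> carrier (free_alg A)" "c = ext_rel A +>\<^bsub>free_alg A\<^esub> f"
  using assms by (auto simp: ext_alg_def FactRing_def A_RCOSETS_def')

lemma ext_rel_coset_closed:
  "f \<in> carrier (free_alg A) \<Longrightarrow> ext_rel A +>\<^bsub>free_alg A\<^esub> f \<in> carrier (ext_alg A)"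
  unfolding ext_alg_def FactRing_def A_RCOSETS_def' by (simp only: ring.simps partial_object.simps) blast

lemma ext_delta_closed:
  assumes "c \<in> carrier (ext_alg A)" shows "ext_delta A c \<in> carrier (ext_alg A)"
  using assms
proof (rule carrier_ext_algE)
  fix f assume f: "f \<in> carrier (free_alg A)" "c = ext_rel A +>\<^bsub>free_alg A\<^esub> f"
  then have "free_delta f \<in> carrier (free_alg A)" by (simp add: keys_free_delta)
  then show ?thesis using f by (simp only: ext_delta_coset ext_rel_coset_closed)
qed

lemma ext_delta_add:
  fixes c c' :: "('a list \<Rightarrow>\<^sub>0 'r::{comm_ring, comm_monoid_mult}) set"
  assumes "c \<in> carrier (ext_alg A)" "c' \<in> carrier (ext_alg A)"
  shows "ext_delta A (c \<oplus>\<^bsub>ext_alg A\<^esub> c') = ext_delta A c \<oplus>\<^bsub>ext_alg A\<^esub> ext_delta A c'"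
proof -
  interpret I: ideal "ext_rel A" "free_alg A :: ('a list \<Rightarrow>\<^sub>0 'r) ring" by (rule ideal_ext_rel)
  obtain f where f: "f \<in> carrier (free_alg A)" "c = ext_rel A +>\<^bsub>free_alg A\<^esub> f"
    using assms(1) by (rule carrier_ext_algE)
  obtain g where g: "g \<in> carrier (free_alg A)" "c' = ext_rel A +>\<^bsub>free_alg A\<^esub> g"
    using assms(2) by (rule carrier_ext_algE)
  have add: "(ext_rel A +>\<^bsub>free_alg A\<^esub> h) \<oplus>\<^bsub>ext_alg A\<^esub> (ext_rel A +>\<^bsub>free_alg A\<^esub> h') =
      ext_rel A +>\<^bsub>free_alg A\<^esub> (h + h')"
    if "h \<in> carrier (free_alg A)" "h' \<in> carrier (free_alg A)" for h h' :: "'a list \<Rightarrow>\<^sub>0 'r"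
    using I.a_rcos_sum[OF that] by (simp add: ext_alg_def FactRing_def)
  have "free_delta f \<in> carrier (free_alg A)" "free_delta g \<in> carrier (free_alg A)"
    "f + g \<in> carrier (free_alg A)"
    using f g by (simp_all add: keys_free_delta keys_add_lists)
  then show ?thesis using f g
    by (simp only: add ext_delta_coset free_delta_add)
qed

lemma wedge_closed:
  fixes A :: "'a set"
  assumes "set as \<subseteq> A"
  shows "(wedge A as :: ('a list \<Rightarrow>\<^sub>0 'r::{comm_ring, comm_monoid_mult}) set) \<in> carrier (ext_alg A)"
proof -
  interpret ring "ext_alg A :: ('a list \<Rightarrow>\<^sub>0 'r) set ring" by (rule ring_ext_alg)
  show ?thesis using assms
  proof (induction as)
    case (Cons a as)
    then have "(ext_gen A a :: ('a list \<Rightarrow>\<^sub>0 'r) set) \<in> carrier (ext_alg A)"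
      unfolding ext_gen_def by (intro ext_rel_coset_closed) auto
    then show ?case using Cons by (simp add: wedge_def)
  qed (simp add: wedge_def)
qed

lemma wedge_eq_coset:
  fixes A :: "'a set"
  assumes "set as \<subseteq> A"
  shows "(wedge A as :: ('a list \<Rightarrow>\<^sub>0 'r::{comm_ring, comm_monoid_mult}) set) =
    ext_rel A +>\<^bsub>free_alg A\<^esub> Poly_Mapping.single as 1"
proof -
  interpret I: ideal "ext_rel A" "free_alg A :: ('a list \<Rightarrow>\<^sub>0 'r) ring" by (rule ideal_ext_rel)
  show ?thesis using assms
  proof (induction as)
    case Nil
    show ?case by (simp add: wedge_def ext_alg_def FactRing_def)
  next
    case (Cons a as)
    have "Poly_Mapping.single [a] (1::'r) \<in> carrier (free_alg A)"
      "Poly_Mapping.single as (1::'r) \<in> carrier (free_alg A)"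
      using Cons.prems by auto
    from I.rcoset_mult_add[OF this] Cons show ?case
      by (simp add: wedge_def ext_alg_def FactRing_def ext_gen_def mult_single plus_list_def)
  qed
qed

lemma ext_delta_wedge:
  fixes A :: "'a set"
  assumes "set as \<subseteq> A"
  shows "ext_delta A (wedge A as :: ('a list \<Rightarrow>\<^sub>0 'r::{comm_ring, comm_monoid_mult}) set) =
    ext_rel A +>\<^bsub>free_alg A\<^esub>
      (\<Sum>i<length as. Poly_Mapping.single (take i as @ drop (Suc i) as) (if even i then 1 else - 1))"
proof -
  have "Poly_Mapping.single as (1::'r) \<in> carrier (free_alg A)" using assms by auto
  from ext_delta_coset[OF this] show ?thesis
    by (simp only: wedge_eq_coset[OF assms] free_delta_single fd_word_def)
qed

lemma ideal_vertex_ideal: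
  "ideal (vertex_ideal av \<pi> A x)
     (ext_alg A :: (('k::field ^ 'n) set list \<Rightarrow>\<^sub>0 'r::{comm_ring, comm_monoid_mult}) set ring)"
  unfolding vertex_ideal_def
  by (rule ring.genideal_ideal[OF ring_ext_alg])
     (auto simp: std_gens_def intro!: ext_delta_closed wedge_closed)

lemma ideal_simplex_ideal:
  "ideal (simplex_ideal av \<pi> A \<sigma>)
     (ext_alg A :: (('k::field ^ 'n) set list \<Rightarrow>\<^sub>0 'r::{comm_ring, comm_monoid_mult}) set ring)"
  unfolding simplex_ideal_def
proof (rule ring.genideal_ideal[OF ring_ext_alg])
  show "(\<Union>x\<in>\<sigma>. vertex_ideal av \<pi> A x)
    \<subseteq> carrier (ext_alg A :: (('k ^ 'n) set list \<Rightarrow>\<^sub>0 'r) set ring)"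
    using additive_subgroup.a_subset[OF ideal.axioms(1)[OF ideal_vertex_ideal]] by blast
qed

lemma simplex_ideal_mono:
  fixes A :: "('k::field ^ 'n) set set"
  assumes "\<tau> \<subseteq> \<sigma>"
  shows "(simplex_ideal av \<pi> A \<tau> :: (('k ^ 'n) set list \<Rightarrow>\<^sub>0 'r::{comm_ring, comm_monoid_mult}) set set)
    \<subseteq> simplex_ideal av \<pi> A \<sigma>"
  using assms unfolding simplex_ideal_def genideal_def by blast

lemma quot_system_ccs:
  fixes G :: "'g ring" and I :: "'v set \<Rightarrow> 'g set"
  assumes G: "abelian_group G"
    and I: "\<And>\<sigma>. additive_subgroup (I \<sigma>) G"
    and mono: "\<And>\<tau> \<sigma>. \<tau> \<subseteq> \<sigma> \<Longrightarrow> I \<tau> \<subseteq> I \<sigma>"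
  shows "ccs X (\<lambda>\<sigma>. G Quot I \<sigma>) (\<lambda>\<tau> \<sigma> c. c <+>\<^bsub>G\<^esub> I \<sigma>)"
proof -
  interpret G: abelian_group G by (rule G)
  have S: "abelian_subgroup (I \<sigma>) G" for \<sigma>
    by (intro abelian_subgroupI3 I G)
  have carE: "\<exists>g\<in>carrier G. c = I \<sigma> +>\<^bsub>G\<^esub> g" if "c \<in> carrier (G Quot I \<sigma>)" for c \<sigma>
    using that by (auto simp: FactRing_def A_RCOSETS_def')
  have car: "I \<sigma> +>\<^bsub>G\<^esub> g \<in> carrier (G Quot I \<sigma>)" if "g \<in> carrier G" for g \<sigma>
    using that by (auto simp: FactRing_def A_RCOSETS_def')
  have sum: "(I \<sigma> +>\<^bsub>G\<^esub> g) \<oplus>\<^bsub>G Quot I \<sigma>\<^esub> (I \<sigma> +>\<^bsub>G\<^esub> h) = I \<sigma> +>\<^bsub>G\<^esub> (g \<oplus>\<^bsub>G\<^esub> h)"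
    if "g \<in> carrier G" "h \<in> carrier G" for g h \<sigma>
    using abelian_subgroup.a_rcos_sum[OF S that] by (simp add: FactRing_def)
  have res: "(I \<tau> +>\<^bsub>G\<^esub> g) <+>\<^bsub>G\<^esub> I \<sigma> = I \<sigma> +>\<^bsub>G\<^esub> g" if g: "g \<in> carrier G" and "\<tau> \<subseteq> \<sigma>" for \<tau> \<sigma> g
  proof -
    interpret s: additive_subgroup "I \<sigma>" G by (rule I)
    interpret t: additive_subgroup "I \<tau>" G by (rule I)
    have sub: "I \<tau> \<subseteq> I \<sigma>" by (rule mono) fact
    show ?thesis
    proof (intro equalityI subsetI)
      fix y assume "y \<in> (I \<tau> +>\<^bsub>G\<^esub> g) <+>\<^bsub>G\<^esub> I \<sigma>"
      then obtain a b where ab: "a \<in> I \<tau>" "b \<in> I \<sigma>" "y = (a \<oplus>\<^bsub>G\<^esub> g) \<oplus>\<^bsub>G\<^esub> b"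
        by (auto simp: a_r_coset_def' set_add_def set_mult_def)
      then have "a \<in> carrier G" "b \<in> carrier G" "a \<oplus>\<^bsub>G\<^esub> b \<in> I \<sigma>"
        using s.a_subset sub by auto
      moreover from this have "y = (a \<oplus>\<^bsub>G\<^esub> b) \<oplus>\<^bsub>G\<^esub> g"
        using ab g by (simp add: G.a_ac)
      ultimately show "y \<in> I \<sigma> +>\<^bsub>G\<^esub> g" by (auto simp: a_r_coset_def')
    next
      fix y assume "y \<in> I \<sigma> +>\<^bsub>G\<^esub> g"
      then obtain b where b: "b \<in> I \<sigma>" "y = b \<oplus>\<^bsub>G\<^esub> g" by (auto simp: a_r_coset_def')
      then have "b \<in> carrier G" using s.a_subset by auto
      then have "y = (\<zero>\<^bsub>G\<^esub> \<oplus>\<^bsub>G\<^esub> g) \<oplus>\<^bsub>G\<^esub> b" using b g by (simp add: G.a_ac)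
      moreover have "\<zero>\<^bsub>G\<^esub> \<oplus>\<^bsub>G\<^esub> g \<in> I \<tau> +>\<^bsub>G\<^esub> g" using t.zero_closed by (auto simp: a_r_coset_def')
      ultimately show "y \<in> (I \<tau> +>\<^bsub>G\<^esub> g) <+>\<^bsub>G\<^esub> I \<sigma>" using b(1)
        by (auto simp: set_add_def set_mult_def)
    qed
  qed
  have grp: "abelian_group (G Quot I \<sigma>)" for \<sigma>
    by (rule comm_group_abelian_groupI)
       (use abelian_subgroup.a_factorgroup_is_comm_group[OF S, unfolded A_FactGroup_def']
         in \<open>simp add: FactRing_def\<close>)
  show ?thesis
  proof (rule ccs.intro)
    fix \<tau> \<sigma> :: "'v set" assume "\<tau> \<subseteq> \<sigma>"
    show "abelian_group_hom (G Quot I \<tau>) (G Quot I \<sigma>) (\<lambda>c. c <+>\<^bsub>G\<^esub> I \<sigma>)"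
    proof (rule abelian_group_homI[OF grp grp], unfold group_hom_def group_hom_axioms_def,
        intro conjI homI; (simp only: monoid.simps partial_object.simps)?)
      show "Group.group (add_monoid (G Quot I \<tau>))" "Group.group (add_monoid (G Quot I \<sigma>))"
        by (rule abelian_group.a_group[OF grp])+
    next
      fix c c' assume "c \<in> carrier (G Quot I \<tau>)" "c' \<in> carrier (G Quot I \<tau>)"
      then obtain g g' where g: "g \<in> carrier G" "c = I \<tau> +>\<^bsub>G\<^esub> g" "g' \<in> carrier G" "c' = I \<tau> +>\<^bsub>G\<^esub> g'"
        using carE by metis
      show "c <+>\<^bsub>G\<^esub> I \<sigma> \<in> carrier (G Quot I \<sigma>)"
        unfolding g(2) res[OF g(1) \<open>\<tau> \<subseteq> \<sigma>\<close>] by (rule car[OF g(1)])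
      show "(c \<oplus>\<^bsub>G Quot I \<tau>\<^esub> c') <+>\<^bsub>G\<^esub> I \<sigma> = (c <+>\<^bsub>G\<^esub> I \<sigma>) \<oplus>\<^bsub>G Quot I \<sigma>\<^esub> (c' <+>\<^bsub>G\<^esub> I \<sigma>)"
        using g \<open>\<tau> \<subseteq> \<sigma>\<close> by (simp add: sum res)
    qed
  next
    fix \<tau> c assume "c \<in> carrier (G Quot I \<tau>)"
    then show "c <+>\<^bsub>G\<^esub> I \<tau> = c" using carE[of c \<tau>] by (auto simp: res)
  next
    fix \<rho> \<tau> \<sigma> c assume "\<rho> \<subseteq> \<tau>" "\<tau> \<subseteq> \<sigma>" "c \<in> carrier (G Quot I \<rho>)"
    then show "(c <+>\<^bsub>G\<^esub> I \<tau>) <+>\<^bsub>G\<^esub> I \<sigma> = c <+>\<^bsub>G\<^esub> I \<sigma>"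
      using carE[of c \<rho>] by (auto simp: res)
  qed (rule grp)
qed

lemma subgroup_ext_im:
  "subgroup (carrier (ext_im A))
     (add_monoid (ext_alg A :: ('a list \<Rightarrow>\<^sub>0 'r::{comm_ring, comm_monoid_mult}) set ring))"
proof -
  let ?E = "ext_alg A :: ('a list \<Rightarrow>\<^sub>0 'r) set ring"
  interpret E: ring ?E by (rule ring_ext_alg)
  have "ext_delta A \<in> hom (add_monoid ?E) (add_monoid ?E)"
    by (rule homI) (simp_all add: ext_delta_closed ext_delta_add)
  then have "group_hom (add_monoid ?E) (add_monoid ?E) (ext_delta A)"
    using E.a_group by (simp add: group_hom_def group_hom_axioms_def)
  from group_hom.img_is_subgroup[OF this] show ?thesis
    by (simp add: ext_im_def)
qed

lemma At_ccs:
  fixes av :: "'k::field \<Rightarrow> real" and A :: "('k ^ 'n) set set"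
  shows "ccs (all_simplices av \<pi>)
    (At_sys av \<pi> A :: _ \<Rightarrow> (('k ^ 'n) set list \<Rightarrow>\<^sub>0 'r::{comm_ring, comm_monoid_mult}) set set ring)
    (At_res av \<pi> A)"
  unfolding At_sys_def[abs_def] At_res_def[abs_def]
  by (rule quot_system_ccs[OF ring.is_abelian_group[OF ring_ext_alg]
        ideal.axioms(1)[OF ideal_simplex_ideal] simplex_ideal_mono])

lemma A_ccs:
  fixes av :: "'k::field \<Rightarrow> real" and A :: "('k ^ 'n) set set"
  shows "ccs (all_simplices av \<pi>)
    (A_sys av \<pi> A :: _ \<Rightarrow> (('k ^ 'n) set list \<Rightarrow>\<^sub>0 'r::{comm_ring, comm_monoid_mult}) set set ring)
    (A_res av \<pi> A)"
proof -
  let ?E = "ext_alg A :: (('k ^ 'n) set list \<Rightarrow>\<^sub>0 'r) set ring"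
  let ?D = "ext_im A :: (('k ^ 'n) set list \<Rightarrow>\<^sub>0 'r) set ring"
  interpret E: ring ?E by (rule ring_ext_alg)
  have eq: "add_monoid ?D = (add_monoid ?E)\<lparr>carrier := carrier ?D\<rparr>"
    by (simp add: ext_im_def)
  have D: "comm_group (add_monoid ?D)"
    unfolding eq
  proof (rule group.group_comm_groupI)
    show "Group.group ((add_monoid ?E)\<lparr>carrier := carrier ?D\<rparr>)"
      by (rule subgroup.subgroup_is_group[OF subgroup_ext_im E.a_group])
    have sub: "carrier ?D \<subseteq> carrier ?E" using subgroup.subset[OF subgroup_ext_im, of A] by simp
    show "c \<otimes>\<^bsub>(add_monoid ?E)\<lparr>carrier := carrier ?D\<rparr>\<^esub> c' =
        c' \<otimes>\<^bsub>(add_monoid ?E)\<lparr>carrier := carrier ?D\<rparr>\<^esub> c"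
      if "c \<in> carrier ((add_monoid ?E)\<lparr>carrier := carrier ?D\<rparr>)"
        "c' \<in> carrier ((add_monoid ?E)\<lparr>carrier := carrier ?D\<rparr>)" for c c'
    proof -
      have "c \<in> carrier ?E" "c' \<in> carrier ?E" using that sub by auto
      then show ?thesis by (simp add: E.a_comm)
    qed
  qed
  have "abelian_group ?D"
    by (rule comm_group_abelian_groupI) (use D in simp)
  moreover have "additive_subgroup (carrier ?D \<inter> simplex_ideal av \<pi> A \<sigma>) ?D" for \<sigma>
  proof (rule additive_subgroupI)
    have I: "subgroup (simplex_ideal av \<pi> A \<sigma>) (add_monoid ?E)"
      using ideal.axioms(1)[OF ideal_simplex_ideal] by (rule additive_subgroup.a_subgroup)
    show "subgroup (carrier ?D \<inter> simplex_ideal av \<pi> A \<sigma>) (add_monoid ?D)"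
      unfolding eq
      by (rule group.subgroup_incl[OF E.a_group group.subgroups_Inter_pair[OF E.a_group subgroup_ext_im I] subgroup_ext_im]) simp
  qed
  ultimately show ?thesis
    unfolding A_sys_def[abs_def] A_res_def[abs_def]
    by (rule quot_system_ccs) (intro Int_mono order_refl simplex_ideal_mono)
qed

end

theory Submission
  imports Defs
begin

text \<open>
  Let \<open>\<pi>L \<subset> \<dots> \<subset> L\<close> be the chain of lattices of a simplex \<open>\<sigma>\<close>. Choosing on every line of \<open>\<A>\<close> a
  generator in \<open>L - \<pi>L\<close>, the ideal \<open>I(\<sigma>)\<close> becomes the Orlik-Solomon ideal of a matroid on \<open>\<A>\<close>, the
  direct sum of the matroids cut out by the successive quotients of the chain. A stable set is a
  finite family of subspaces of \<open>L\<^sub>1/\<pi>L\<close> closed under intersection, and compatible elements are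
  glued by adding its members \<open>U\<close> one at a time in increasing order. The correction term for \<open>U\<close>
  is produced by a projection \<open>P\<close> along \<open>I(U)\<close> that is linear over the exterior algebra on the lines
  in \<open>U\<close>; this linearity makes \<open>P\<close> map \<open>I(U) + I(U \<inter> V)\<close> into \<open>I(V)\<close>. Such a projection is given by
  the recursion \<open>P(w) = e\<^sub>m \<and> P(\<delta> w)\<close> on words, where \<open>m\<close> is a chosen element of the closure of the
  letters of \<open>w\<close> outside \<open>U\<close>.
\<close>

section \<open>Boundaries in the free algebra\<close>

text \<open>\<open>A\<close> may be infinite and the coefficient ring is arbitrary, so no basis or
  dimension count is at hand. The choice of m replaces a basis of monomials: it plays the part of
  the least element of a flat without any order on \<open>A\<close>. The recursion has two sources.
  If m extends w to a dependent word, the boundary of that word is w - e_m \<delta>(w), so P(w) is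
  congruent to w. If w has a dependent outer part, all deletions of one letter that make this part
  independent leave the same closure, hence the same m, and \<delta>\<delta> = 0 controls
  P(\<delta>(w)). Letters in U never enter the choice of m; this is the linearity over the algebra
  of U, and it keeps the correction for U compatible with the members already treated. Everything is
  computed with words of the free algebra: P is then defined without checking antisymmetry, and the
  exterior relations reappear through words with a repeated letter, which are counted among the
  dependent ones.\<close>

abbreviation word :: "'a list \<Rightarrow> 'r::{comm_ring, comm_monoid_mult} \<Rightarrow> 'a list \<Rightarrow>\<^sub>0 'r" where
  "word \<equiv> Poly_Mapping.single"

abbreviation polys :: "'a set \<Rightarrow> ('a list \<Rightarrow>\<^sub>0 'r::{comm_ring, comm_monoid_mult}) set" where
  "polys A \<equiv> {f. Poly_Mapping.keys f \<subseteq> lists A}"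

definition remove_nth :: "nat \<Rightarrow> 'a list \<Rightarrow> 'a list" where
  "remove_nth i w = take i w @ drop (Suc i) w"

lemma length_remove_nth: "i < length w \<Longrightarrow> length (remove_nth i w) < length w"
  by (simp add: remove_nth_def)

lemma set_remove_nth_subset: "set (remove_nth i w) \<subseteq> set w"
  by (auto simp: remove_nth_def dest: in_set_takeD in_set_dropD)

lemma remove_nth_in_lists: "w \<in> lists A \<Longrightarrow> remove_nth i w \<in> lists A"
  using set_remove_nth_subset[of i w] by (auto simp: in_lists_conv_set)

lemma keys_neg [simp]: "Poly_Mapping.keys (- f) = Poly_Mapping.keys f"
  by (auto simp: in_keys_iff)

lemma word_mult: "word u r * word v s = word (u @ v) (r * s)"
  by (simp add: mult_single plus_list_def)

lemma free_delta_uminus: "free_delta (- f) = - free_delta f"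
  using free_delta_add[of f "- f"] by (simp add: eq_neg_iff_add_eq_0 add.commute)

lemma free_delta_diff: "free_delta (f - g) = free_delta f - free_delta g"
  using free_delta_add[of f "- g"] by (simp add: free_delta_uminus)

lemma free_delta_sum: "free_delta (sum f I) = (\<Sum>i\<in>I. free_delta (f i))"
  by (induction I rule: infinite_finite_induct) (simp_all add: free_delta_add)

lemma fd_word_Nil [simp]: "fd_word [] r = 0"
  by (simp add: fd_word_def)

lemma free_delta_Nil_mult: "free_delta (word [] r * f) = word [] r * free_delta f"
  by (simp add: free_delta_mult free_delta_single sgn_inv_single)

lemma free_delta_letter_mult: "free_delta (word [a] 1 * f) = f - word [a] 1 * free_delta f"
  by (simp add: free_delta_mult free_delta_single fd_word_Cons sgn_inv_single single_uminus)

lemma free_delta_fd_word [simp]: "free_delta (fd_word w r) = 0"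
proof (induction w)
  case (Cons a w)
  then show ?case
    by (simp add: fd_word_Cons free_delta_diff free_delta_letter_mult free_delta_single)
qed simp

lemma free_delta_free_delta [simp]: "free_delta (free_delta f) = 0"
  by (simp add: free_delta_fd[of f] free_delta_sum)

lemma fd_word_scale: "fd_word w r = word [] r * fd_word w 1"
  using free_delta_Nil_mult[of r "word w 1"] by (simp add: word_mult free_delta_single)

lemma fd_word_1:
  "fd_word w (1::'r::{comm_ring, comm_monoid_mult}) =
     (\<Sum>i<length w. word [] (if even i then 1 else - 1) * word (remove_nth i w) 1)"
  by (simp add: fd_word_def word_mult remove_nth_def)

lemma fd_word_in_polys: "w \<in> lists A \<Longrightarrow> fd_word w r \<in> polys A"
  using keys_free_delta[of "word w r" A] by (simp add: free_delta_single)

section \<open>Ideals generated by boundaries of dependent words\<close>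

text \<open>Only closure under addition is built in. For \<open>D\<close> closed under enlarging
  words this is already a two-sided ideal: by the Leibniz rule the product of a boundary with a word
  is, up to sign, the boundary of a longer word minus words of \<open>D\<close>. The words of
  \<open>D\<close> are included because e_a \<delta>(w) equals w modulo the exterior relations when
  a is a letter of w.\<close>

inductive_set dep_ideal :: "'a list set \<Rightarrow> ('a list \<Rightarrow>\<^sub>0 'r::{comm_ring, comm_monoid_mult}) set"
  for D where
  zero [intro!, simp]: "0 \<in> dep_ideal D"
| add [intro]: "f \<in> dep_ideal D \<Longrightarrow> g \<in> dep_ideal D \<Longrightarrow> f + g \<in> dep_ideal D"
| word: "w \<in> D \<Longrightarrow> word w r \<in> dep_ideal D"
| delta: "w \<in> D \<Longrightarrow> fd_word w r \<in> dep_ideal D"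

lemma dep_ideal_mono: "f \<in> dep_ideal D \<Longrightarrow> D \<subseteq> D' \<Longrightarrow> f \<in> dep_ideal D'"
  by (induction rule: dep_ideal.induct) (auto intro: dep_ideal.intros)

lemma dep_ideal_uminus: "f \<in> dep_ideal D \<Longrightarrow> - f \<in> dep_ideal D"
proof (induction rule: dep_ideal.induct)
  case (add f g)
  then have "- f + - g \<in> dep_ideal D" by blast
  then show ?case by simp
next
  case (word w r)
  then show ?case using dep_ideal.word[of w D "- r"] by (simp add: single_uminus)
next
  case (delta w r)
  moreover have "fd_word w (- r) = - fd_word w r"
    using fd_word_add[of w r "- r"] by (simp add: eq_neg_iff_add_eq_0 add.commute)
  ultimately show ?case using dep_ideal.delta[of w D "- r"] by simp
qed simp

lemma dep_ideal_diff: "f \<in> dep_ideal D \<Longrightarrow> g \<in> dep_ideal D \<Longrightarrow> f - g \<in> dep_ideal D"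
  using dep_ideal.add[of f D "- g"] by (simp add: dep_ideal_uminus)

lemma dep_ideal_sum: "(\<And>i. i \<in> I \<Longrightarrow> f i \<in> dep_ideal D) \<Longrightarrow> sum f I \<in> dep_ideal D"
  by (induction I rule: infinite_finite_induct) auto

lemma dep_ideal_delta: "f \<in> dep_ideal D \<Longrightarrow> free_delta f \<in> dep_ideal D"
  by (induction rule: dep_ideal.induct)
     (auto simp: free_delta_add free_delta_single intro: dep_ideal.delta)

definition upclosed :: "'a set \<Rightarrow> 'a list set \<Rightarrow> bool" where
  "upclosed A D \<longleftrightarrow> D \<subseteq> lists A \<and> (\<forall>u\<in>lists A. \<forall>v\<in>lists A. \<forall>w\<in>D. u @ w @ v \<in> D)"

lemma upclosedD: "upclosed A D \<Longrightarrow> u \<in> lists A \<Longrightarrow> v \<in> lists A \<Longrightarrow> w \<in> D \<Longrightarrow> u @ w @ v \<in> D"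
  by (simp add: upclosed_def)

lemma upclosed_ConsD: "upclosed A D \<Longrightarrow> a \<in> A \<Longrightarrow> w \<in> D \<Longrightarrow> a # w \<in> D"
  using upclosedD[of A D "[a]" "[]" w] by simp

lemma dep_ideal_in_polys:
  assumes "D \<subseteq> lists A" shows "f \<in> dep_ideal D \<Longrightarrow> f \<in> polys A"
proof (induction rule: dep_ideal.induct)
  case (add f g)
  then show ?case by (simp add: keys_add_lists)
next
  case (word w r)
  then show ?case using assms by auto
next
  case (delta w r)
  then show ?case using assms by (intro fd_word_in_polys) auto
qed simp

lemma dep_ideal_mult_left_word:
  assumes "upclosed A D" "u \<in> lists A"
  shows "f \<in> dep_ideal D \<Longrightarrow> word u s * f \<in> dep_ideal D"
proof (induction rule: dep_ideal.induct)
  case (add f g)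
  then show ?case by (auto simp: distrib_left)
next
  case (word w r)
  then show ?case using upclosedD[OF assms, of "[]"] by (auto simp: word_mult intro: dep_ideal.word)
next
  case (delta w r)
  \<comment> \<open>The sign absorbs the grading involution that the Leibniz rule puts on
    \<open>u\<close>.\<close>
  define s' where "s' = (if even (length u) then s else - s)"
  have uw: "u @ w \<in> D" using upclosedD[OF assms, of "[]"] delta by auto
  have "fd_word u s' * word w r \<in> dep_ideal D"
    unfolding fd_word_def sum_distrib_right remove_nth_def[symmetric]
  proof (intro dep_ideal_sum)
    fix i assume "i \<in> {..<length u}"
    have "remove_nth i u @ w \<in> D"
      using upclosedD[OF assms(1) remove_nth_in_lists[OF assms(2)], of "[]" w i] delta by simp
    then show "word (remove_nth i u) (if even i then s' else - s') * word w r \<in> dep_ideal D"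
      unfolding word_mult by (rule dep_ideal.word)
  qed
  moreover have "word u s * fd_word w r = fd_word (u @ w) (s' * r) - fd_word u s' * word w r"
    unfolding fd_word_append by (simp add: sgn_inv_single s'_def)
  ultimately show ?case using dep_ideal.delta[OF uw] by (auto intro: dep_ideal_diff)
qed simp

lemma dep_ideal_mult_right_word:
  assumes "upclosed A D" "v \<in> lists A"
  shows "f \<in> dep_ideal D \<Longrightarrow> f * word v s \<in> dep_ideal D"
proof (induction rule: dep_ideal.induct)
  case (add f g)
  then show ?case by (auto simp: distrib_right)
next
  case (word w r)
  then show ?case using upclosedD[OF assms(1) _ assms(2), of "[]"] by (auto simp: word_mult intro: dep_ideal.word)
next
  case (delta w r)
  have wv: "w @ v \<in> D" using upclosedD[OF assms(1) _ assms(2), of "[]"] delta by auto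
  have "sgn_inv (word w r) * fd_word v s \<in> dep_ideal D"
    unfolding fd_word_def sum_distrib_left sgn_inv_single remove_nth_def[symmetric]
  proof (intro dep_ideal_sum)
    fix i assume "i \<in> {..<length v}"
    have "w @ remove_nth i v \<in> D"
      using upclosedD[OF assms(1) _ remove_nth_in_lists[OF assms(2)], of "[]" w i] delta by simp
    then show "word w (if even (length w) then r else - r) * word (remove_nth i v) (if even i then s else - s)
        \<in> dep_ideal D"
      unfolding word_mult by (rule dep_ideal.word)
  qed
  moreover have "fd_word w r * word v s = fd_word (w @ v) (r * s) - sgn_inv (word w r) * fd_word v s"
    unfolding fd_word_append by simp
  ultimately show ?case using dep_ideal.delta[OF wv] by (auto intro: dep_ideal_diff)
qed simp

lemma dep_ideal_mult:
  assumes "upclosed A D" "f \<in> dep_ideal D" "Poly_Mapping.keys g \<subseteq> lists A"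
  shows "g * f \<in> dep_ideal D" "f * g \<in> dep_ideal D"
proof -
  have "g * f \<in> dep_ideal D \<and> f * g \<in> dep_ideal D"
    using assms(3)
    by (induction rule: free_alg_induct)
       (auto simp: distrib_left distrib_right
             intro: dep_ideal_mult_left_word[OF assms(1)] dep_ideal_mult_right_word[OF assms(1)] assms(2))
  then show "g * f \<in> dep_ideal D" "f * g \<in> dep_ideal D" by auto
qed

lemma ideal_dep_ideal:
  assumes "upclosed A D"
  shows "ideal (dep_ideal D) (free_alg A :: ('a list \<Rightarrow>\<^sub>0 'r::{comm_ring, comm_monoid_mult}) ring)"
proof (rule idealI[OF ring_free_alg])
  interpret R: ring "free_alg A :: ('a list \<Rightarrow>\<^sub>0 'r) ring" by (rule ring_free_alg)
  have car: "(dep_ideal D :: ('a list \<Rightarrow>\<^sub>0 'r) set) \<subseteq> polys A"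
    using dep_ideal_in_polys[of D A] assms unfolding upclosed_def by blast
  show "subgroup (dep_ideal D) (add_monoid (free_alg A :: ('a list \<Rightarrow>\<^sub>0 'r) ring))"
  proof (rule group.subgroupI[OF R.a_group])
    fix f :: "'a list \<Rightarrow>\<^sub>0 'r" assume f: "f \<in> dep_ideal D"
    have "\<ominus>\<^bsub>free_alg A\<^esub> f = - f"
      using subsetD[OF car f] subsetD[OF car dep_ideal_uminus[OF f]] by (intro R.minus_equality) auto
    then show "inv\<^bsub>add_monoid (free_alg A)\<^esub> f \<in> dep_ideal D"
      using dep_ideal_uminus[OF f] by (simp add: a_inv_def)
  qed (use car in \<open>auto intro: dep_ideal.intros\<close>)
qed (use dep_ideal_mult[OF assms] in auto)

text \<open>The square of a linear form expands into squares of letters and sums ab + ba, and ab +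
  ba = \<delta>(aba) + aa. All of these come from words with a repeated letter.\<close>

lemma ext_rel_subset_dep_ideal:
  assumes "upclosed A D" and nd: "\<And>w. w \<in> lists A \<Longrightarrow> \<not> distinct w \<Longrightarrow> w \<in> D"
  shows "ext_rel A \<subseteq> (dep_ideal D :: ('a list \<Rightarrow>\<^sub>0 'r::{comm_ring, comm_monoid_mult}) set)"
  unfolding ext_rel_def
proof (intro ring.genideal_minimal[OF ring_free_alg ideal_dep_ideal[OF assms(1)]] subsetI)
  fix x :: "'a list \<Rightarrow>\<^sub>0 'r"
  assume "x \<in> {m * m |m. Poly_Mapping.keys m \<subseteq> {[a] |a. a \<in> A}}"
  then obtain m where m: "x = m * m" "Poly_Mapping.keys m \<subseteq> {[a] |a. a \<in> A}" by blast
  have comm: "word [a] r * word [b] s + word [b] s * word [a] r \<in> dep_ideal D"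
    if "a \<in> A" "b \<in> A" for a b and r s :: 'r
  proof -
    have "word [a] r * word [b] s + word [b] s * word [a] r
        = fd_word [a, b, a] (r * s) + word [a, a] (r * s)"
      by (simp add: word_mult fd_word_Cons algebra_simps single_uminus)
    then show ?thesis using that nd[of "[a,b,a]"] nd[of "[a,a]"]
      by (auto intro!: dep_ideal.add intro: dep_ideal.word dep_ideal.delta)
  qed
  have comm': "m * word [b] s + word [b] s * m \<in> dep_ideal D"
    if "Poly_Mapping.keys m \<subseteq> {[a] |a. a \<in> A}" "b \<in> A" for b s and m :: "'a list \<Rightarrow>\<^sub>0 'r"
    using that(1)
  proof (induction rule: free_alg_induct)
    case (add f g)
    then have "(f * word [b] s + word [b] s * f) + (g * word [b] s + word [b] s * g) \<in> dep_ideal D"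
      by blast
    then show ?case by (simp add: algebra_simps)
  qed (use comm that in auto)
  have comm'': "m * n + n * m \<in> dep_ideal D"
    if "Poly_Mapping.keys m \<subseteq> {[a] |a. a \<in> A}" "Poly_Mapping.keys n \<subseteq> {[a] |a. a \<in> A}"
    for n m :: "'a list \<Rightarrow>\<^sub>0 'r"
    using that(2)
  proof (induction rule: free_alg_induct)
    case (add f g)
    then have "(m * f + f * m) + (m * g + g * m) \<in> dep_ideal D"
      by blast
    then show ?case by (simp add: algebra_simps)
  qed (use comm' that in auto)
  show "x \<in> dep_ideal D"
    unfolding m(1) using m(2)
  proof (induction rule: free_alg_induct)
    case (add f g)
    then have "f * f + g * g + (f * g + g * f) \<in> dep_ideal D"
      using comm'' by blast
    then show ?case by (simp add: algebra_simps)
  next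
    case (single w r)
    then show ?case using nd[of "w @ w"] by (auto simp: word_mult intro!: dep_ideal.word)
  qed simp
qed

section \<open>Straightening operators\<close>

definition lin_ext :: "('a list \<Rightarrow> 'b list \<Rightarrow>\<^sub>0 'r) \<Rightarrow> ('a list \<Rightarrow>\<^sub>0 'r::{comm_ring, comm_monoid_mult}) \<Rightarrow> ('b list \<Rightarrow>\<^sub>0 'r)" where
  "lin_ext Q f = (\<Sum>w\<in>Poly_Mapping.keys f. word [] (Poly_Mapping.lookup f w) * Q w)"

lemma lin_ext_0 [simp]: "lin_ext Q 0 = 0"
  by (simp add: lin_ext_def)

lemma lin_ext_add: "lin_ext Q (f + g) = lin_ext Q f + lin_ext Q g"
  unfolding lin_ext_def
  by (rule setsum_keys_plus_distrib) (auto simp: single_add distrib_right)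

lemma lin_ext_sum: "lin_ext Q (sum f I) = (\<Sum>i\<in>I. lin_ext Q (f i))"
  by (induction I rule: infinite_finite_induct) (simp_all add: lin_ext_add)

lemma lin_ext_word: "lin_ext Q (word w r) = word [] r * Q w"
  by (simp add: lin_ext_def)

lemma lin_ext_Nil_mult: "lin_ext Q (word [] s * f) = word [] s * lin_ext Q f"
proof -
  have "Poly_Mapping.keys f \<subseteq> UNIV" by simp
  then show ?thesis
    by (induction rule: free_alg_induct)
       (auto simp: word_mult distrib_left lin_ext_add lin_ext_word mult.assoc[symmetric])
qed

lemma lin_ext_fd_word:
  fixes Q :: "'a list \<Rightarrow> 'a list \<Rightarrow>\<^sub>0 'r::{comm_ring, comm_monoid_mult}"
  shows "lin_ext Q (fd_word w 1) =
    (\<Sum>i<length w. word [] (if even i then 1 else - 1) * Q (remove_nth i w))"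
  by (simp add: fd_word_1 lin_ext_sum lin_ext_Nil_mult lin_ext_word)

lemma filter_remove_nth:
  assumes "i < length w"
  shows "\<not> P (w ! i) \<Longrightarrow> filter P (remove_nth i w) = filter P w"
    and "P (w ! i) \<Longrightarrow> \<exists>j<length (filter P w). filter P (remove_nth i w) = remove_nth j (filter P w)"
proof -
  have w: "filter P w = filter P (take i w) @ filter P [w ! i] @ filter P (drop (Suc i) w)"
    by (subst id_take_nth_drop[OF assms]) simp
  show "\<not> P (w ! i) \<Longrightarrow> filter P (remove_nth i w) = filter P w"
    using w by (simp add: remove_nth_def)
  show "\<exists>j<length (filter P w). filter P (remove_nth i w) = remove_nth j (filter P w)" if "P (w ! i)"
    using w that by (intro exI[of _ "length (filter P (take i w))"]) (simp add: remove_nth_def)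
qed

text \<open>The letters in \<open>B\<close> are spectators: they stay in the word and enter neither
  the test for dependence nor the choice of \<open>m\<close>. The sum is the linear extension of the
  function itself at the boundary of \<open>w\<close>, written termwise so that each recursive call
  concerns a shorter word.\<close>

function straighten ::
    "'a set \<Rightarrow> 'a list set \<Rightarrow> ('a list \<Rightarrow> 'a) \<Rightarrow> 'a list \<Rightarrow> ('a list \<Rightarrow>\<^sub>0 'r::{comm_ring, comm_monoid_mult})" where
  "straighten B D m w =
    (let v = filter (\<lambda>a. a \<notin> B) w in
     if v = [] then word w 1
     else if v \<in> D then 0
     else word [m v] 1 *
       (\<Sum>i<length w. word [] (if even i then 1 else - 1) * straighten B D m (remove_nth i w)))"
  by auto
termination
  by (relation "inv_image less_than (\<lambda>(B, D, m, w). length w)") (auto simp: length_remove_nth)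

declare straighten.simps [simp del]

text \<open>
  \<open>D\<close> plays the role of the dependent words of a matroid on \<open>A\<close> that is the direct sum of its
  restrictions to \<open>B\<close> and \<open>A - B\<close>; \<open>m v\<close> is a chosen element of the closure of \<open>v\<close>, depending
  only on this closure.
\<close>

locale straightening =
  fixes A B :: "'a set" and D :: "'a list set" and m :: "'a list \<Rightarrow> 'a"
  assumes up: "upclosed A D"
    and Nil: "[] \<notin> D"
    and loopless: "a \<in> A - B \<Longrightarrow> [a] \<notin> D"
    and filter_D: "w \<in> lists A \<Longrightarrow> filter (\<lambda>a. a \<notin> B) w \<in> D \<Longrightarrow> w \<in> D"
    and m_in: "v \<in> lists (A - B) \<Longrightarrow> v \<noteq> [] \<Longrightarrow> v \<notin> D \<Longrightarrow> m v \<in> A - B"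
    and m_closure: "v \<in> lists (A - B) \<Longrightarrow> v \<noteq> [] \<Longrightarrow> v \<notin> D \<Longrightarrow> m v # v \<in> D"
    and m_eq: "v \<in> lists (A - B) \<Longrightarrow> v \<in> D \<Longrightarrow> i < length v \<Longrightarrow> j < length v \<Longrightarrow>
      remove_nth i v \<notin> D \<Longrightarrow> remove_nth j v \<notin> D \<Longrightarrow> m (remove_nth i v) = m (remove_nth j v)"
begin

abbreviation outer :: "'a list \<Rightarrow> 'a list" where
  "outer w \<equiv> filter (\<lambda>a. a \<notin> B) w"

abbreviation "Q \<equiv> straighten B D m :: 'a list \<Rightarrow> ('a list \<Rightarrow>\<^sub>0 'r::{comm_ring, comm_monoid_mult})"
abbreviation "P \<equiv> lin_ext Q :: ('a list \<Rightarrow>\<^sub>0 'r::{comm_ring, comm_monoid_mult}) \<Rightarrow> ('a list \<Rightarrow>\<^sub>0 'r)"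

lemma outer_in_lists: "w \<in> lists A \<Longrightarrow> outer w \<in> lists (A - B)"
  by auto

lemma Q_inner: "outer w = [] \<Longrightarrow> Q w = word w 1"
  by (simp add: straighten.simps[of B D m w])

lemma Q_dep: "outer w \<in> D \<Longrightarrow> Q w = 0"
  using Nil by (auto simp: straighten.simps[of B D m w] Let_def)

lemma Q_indep: "outer w \<noteq> [] \<Longrightarrow> outer w \<notin> D \<Longrightarrow> Q w = word [m (outer w)] 1 * P (fd_word w 1)"
  by (subst straighten.simps) (simp only: Let_def if_False lin_ext_fd_word)

text \<open>The word \<mu> w is dependent and its boundary is w - e_\<mu> \<delta>(w), so w may be
  replaced by e_\<mu> \<delta>(w); the induction hypothesis then treats the words of
  \<delta>(w).\<close>

lemma Q_cong: "w \<in> lists A \<Longrightarrow>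
    (Q w :: 'a list \<Rightarrow>\<^sub>0 'r::{comm_ring, comm_monoid_mult}) - word w 1 \<in> dep_ideal D"
proof (induction w rule: length_induct)
  case (1 w)
  show ?case
  proof (cases "outer w = [] \<or> outer w \<in> D")
    case True
    then show ?thesis
    proof
      assume "outer w \<in> D"
      then have "w \<in> D" using filter_D 1 by blast
      then show ?thesis using \<open>outer w \<in> D\<close>
        by (simp add: Q_dep dep_ideal_uminus dep_ideal.word)
    qed (simp add: Q_inner)
  next
    case False
    define \<mu> where "\<mu> = m (outer w)"
    have \<mu>: "\<mu> \<in> A - B" "\<mu> # outer w \<in> D"
      using False m_in[OF outer_in_lists] m_closure[OF outer_in_lists] 1 by (auto simp: \<mu>_def)
    then have "\<mu> # w \<in> D" using filter_D[of "\<mu> # w"] 1 by simp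
    then have d: "fd_word (\<mu> # w) (1::'r) \<in> dep_ideal D" by (rule dep_ideal.delta)
    have "P (fd_word w 1) - fd_word w (1::'r) = (\<Sum>i<length w. word [] (if even i then 1 else - 1) *
        (Q (remove_nth i w) - word (remove_nth i w) 1))"
      unfolding lin_ext_fd_word right_diff_distrib sum_subtractf fd_word_1[of w, symmetric] ..
    also have "\<dots> \<in> dep_ideal D"
    proof (intro dep_ideal_sum dep_ideal_mult_left_word[OF up])
      fix i assume i: "i \<in> {..<length w}"
      show "Q (remove_nth i w) - word (remove_nth i w) (1::'r) \<in> dep_ideal D"
        using 1(1)[rule_format, OF length_remove_nth remove_nth_in_lists[OF 1(2)]] i by simp
    qed simp
    finally have "word [\<mu>] 1 * (P (fd_word w 1) - fd_word w (1::'r)) \<in> dep_ideal D"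
      using \<mu> by (intro dep_ideal_mult_left_word[OF up]) auto
    from dep_ideal_diff[OF this d] False show ?thesis
      by (simp add: fd_word_Cons Q_indep right_diff_distrib \<mu>_def)
  qed
qed

lemma P_cong:
  assumes "Poly_Mapping.keys f \<subseteq> lists A"
  shows "P f - f \<in> dep_ideal D"
  using assms
proof (induction rule: free_alg_induct)
  case (add f g)
  from dep_ideal.add[OF add.IH] show ?case by (simp add: lin_ext_add algebra_simps)
next
  case (single w r)
  have "word [] r * (Q w - word w 1) \<in> dep_ideal D"
    by (intro dep_ideal_mult_left_word[OF up] Q_cong single) simp
  then show ?case by (simp add: lin_ext_word right_diff_distrib word_mult)
qed simp

text \<open>\<open>P (\<delta> w)\<close> is compared termwise with \<open>e\<^sub>\<mu> P (\<delta> (\<delta> w)) = 0\<close>.\<close>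

lemma P_boundary_in:
  fixes w :: "'a list"
  assumes D'': "upclosed A D''" and "\<mu> \<in> A"
    and "\<And>i. i < length w \<Longrightarrow>
      (Q (remove_nth i w) :: 'a list \<Rightarrow>\<^sub>0 'r::{comm_ring, comm_monoid_mult}) = word [\<mu>] 1 * P (fd_word (remove_nth i w) 1) \<or>
      (Q (remove_nth i w) :: 'a list \<Rightarrow>\<^sub>0 'r) \<in> dep_ideal D'' \<and>
      (P (fd_word (remove_nth i w) 1) :: 'a list \<Rightarrow>\<^sub>0 'r) \<in> dep_ideal D''"
  shows "(P (fd_word w 1) :: 'a list \<Rightarrow>\<^sub>0 'r) \<in> dep_ideal D''"
proof -
  let ?s = "\<lambda>i. word [] (if even i then 1 else - 1) :: 'a list \<Rightarrow>\<^sub>0 'r"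
  have "P (free_delta (fd_word w 1)) = (\<Sum>i<length w. ?s i * P (fd_word (remove_nth i w) 1))"
    unfolding fd_word_1[of w] free_delta_sum free_delta_Nil_mult lin_ext_sum lin_ext_Nil_mult
      free_delta_single ..
  then have "(\<Sum>i<length w. ?s i * P (fd_word (remove_nth i w) 1)) = 0" by simp
  moreover have comm: "word [\<mu>] 1 * (?s i * f) = ?s i * (word [\<mu>] 1 * f)" for i and f :: "'a list \<Rightarrow>\<^sub>0 'r"
    by (simp only: mult.assoc[symmetric] single_Nil_commute[of _ "word [\<mu>] 1"])
  ultimately have "(\<Sum>i<length w. ?s i * (word [\<mu>] 1 * P (fd_word (remove_nth i w) 1))) = 0"
    unfolding comm[symmetric] sum_distrib_left[symmetric] by (simp only: mult_zero_right)
  then have "(P (fd_word w 1) :: 'a list \<Rightarrow>\<^sub>0 'r) = (\<Sum>i<length w. ?s i *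
      (Q (remove_nth i w) - word [\<mu>] 1 * P (fd_word (remove_nth i w) 1)))"
    unfolding lin_ext_fd_word[of _ w] right_diff_distrib sum_subtractf by (simp only: diff_zero)
  also have "\<dots> \<in> dep_ideal D''"
  proof (intro dep_ideal_sum dep_ideal_mult_left_word[OF D''])
    fix i assume "i \<in> {..<length w}"
    then have "i < length w" by simp
    from assms(3)[OF this]
    show "(Q (remove_nth i w) :: 'a list \<Rightarrow>\<^sub>0 'r) - word [\<mu>] 1 * P (fd_word (remove_nth i w) 1) \<in> dep_ideal D''"
    proof
      assume "(Q (remove_nth i w) :: 'a list \<Rightarrow>\<^sub>0 'r) \<in> dep_ideal D'' \<and>
        (P (fd_word (remove_nth i w) 1) :: 'a list \<Rightarrow>\<^sub>0 'r) \<in> dep_ideal D''"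
      then show ?thesis
        using assms(2) by (intro dep_ideal_diff dep_ideal_mult_left_word[OF D'']) auto
    qed simp
  qed simp
  finally show ?thesis .
qed

text \<open>In the gluing argument \<open>D\<close> belongs to U, \<open>D'\<close> to the
  intersection of U and V, and \<open>D''\<close> to V. The images of w and of its boundary are
  treated together: the image of w is zero or a multiple of that of its boundary unless all letters
  are inner, and the image of the boundary is governed by both images for the words with one letter
  deleted. Some deletions preserve the dependence and fall under the induction hypothesis; the
  others share one \<mu>, and \<open>P_boundary_in\<close> applies.\<close>

lemma Q_in_dep_ideal:
  assumes D'': "upclosed A D''"
    and inner: "\<And>v. v \<in> lists (A \<inter> B) \<Longrightarrow> v \<in> D' \<Longrightarrow> v \<in> D''"
  shows "w \<in> lists A \<Longrightarrow> outer w \<in> D \<or> filter (\<lambda>a. a \<in> B) w \<in> D' \<Longrightarrow>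
    (Q w :: 'a list \<Rightarrow>\<^sub>0 'r::{comm_ring, comm_monoid_mult}) \<in> dep_ideal D'' \<and>
    (P (fd_word w 1) :: 'a list \<Rightarrow>\<^sub>0 'r) \<in> dep_ideal D''"
proof (induction w rule: length_induct)
  case (1 w)
  have IH: "(Q (remove_nth i w) :: 'a list \<Rightarrow>\<^sub>0 'r) \<in> dep_ideal D'' \<and>
      (P (fd_word (remove_nth i w) 1) :: 'a list \<Rightarrow>\<^sub>0 'r) \<in> dep_ideal D''"
    if "i < length w" "outer (remove_nth i w) \<in> D \<or> filter (\<lambda>a. a \<in> B) (remove_nth i w) \<in> D'" for i
    using 1(1)[rule_format, OF length_remove_nth remove_nth_in_lists[OF 1(2)]] that by blast
  show ?case
  proof (cases "outer w \<in> D")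
    case True
    \<comment> \<open>The deletions that make the outer part independent. They remove an outer
      letter, and something of the outer part remains because no single outer letter is dependent.
      All remainders have the same closure, hence the same value of \<open>m\<close>.\<close>
    define good where "good = {i. i < length w \<and> outer (remove_nth i w) \<notin> D}"
    have good: "outer (remove_nth i w) \<noteq> [] \<and> w ! i \<notin> B \<and>
        (\<exists>j<length (outer w). outer (remove_nth i w) = remove_nth j (outer w))" if "i \<in> good" for i
    proof -
      have i: "i < length w" "outer (remove_nth i w) \<notin> D" using that by (auto simp: good_def)
      then have B: "w ! i \<notin> B" using filter_remove_nth(1)[of i w "\<lambda>a. a \<notin> B"] True by auto
      then obtain j where j: "j < length (outer w)" "outer (remove_nth i w) = remove_nth j (outer w)"
        using filter_remove_nth(2)[of i w "\<lambda>a. a \<notin> B"] i by auto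
      have "outer (remove_nth i w) \<noteq> []"
      proof
        assume "outer (remove_nth i w) = []"
        then have "remove_nth j (outer w) = []" using j by simp
        then have "outer w = [outer w ! j]"
          by (subst id_take_nth_drop[OF j(1)]) (simp add: remove_nth_def)
        moreover have "outer w ! j \<in> A - B" using j(1) outer_in_lists[of w] 1 nth_mem by blast
        ultimately show False using loopless True by metis
      qed
      then show ?thesis using B j by blast
    qed
    have eq: "m (outer (remove_nth i w)) = m (outer (remove_nth j w))" if ij: "i \<in> good" "j \<in> good" for i j
    proof -
      obtain i' j' where "i' < length (outer w)" "outer (remove_nth i w) = remove_nth i' (outer w)"
         "j' < length (outer w)" "outer (remove_nth j w) = remove_nth j' (outer w)"
        using good ij by metis
      then show ?thesis using m_eq[OF outer_in_lists True, of i' j'] ij 1 by (simp add: good_def)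
    qed
    have "\<exists>\<mu>\<in>A. \<forall>i\<in>good. m (outer (remove_nth i w)) = \<mu>"
    proof (cases "good = {}")
      case True
      \<comment> \<open>If there is no such deletion, any letter of \<open>A\<close> can serve as
        \<mu>, for instance the first letter of \<open>w\<close>.\<close>
      have "w \<noteq> []" using \<open>outer w \<in> D\<close> Nil by auto
      then have "hd w \<in> A" using 1 by (cases w) auto
      then show ?thesis using True by auto
    next
      case False
      then obtain j where j: "j \<in> good" by blast
      have "m (outer (remove_nth j w)) \<in> A"
        using m_in[OF outer_in_lists[OF remove_nth_in_lists]] good[OF j] j 1 by (auto simp: good_def)
      then show ?thesis using eq j by blast
    qed
    then obtain \<mu> where \<mu>: "\<mu> \<in> A" "\<And>i. i \<in> good \<Longrightarrow> m (outer (remove_nth i w)) = \<mu>" by blast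
    have "(P (fd_word w 1) :: 'a list \<Rightarrow>\<^sub>0 'r) \<in> dep_ideal D''"
    proof (rule P_boundary_in[OF D'' \<mu>(1)])
      fix i assume i: "i < length w"
      show "(Q (remove_nth i w) :: 'a list \<Rightarrow>\<^sub>0 'r) = word [\<mu>] 1 * P (fd_word (remove_nth i w) 1) \<or>
        (Q (remove_nth i w) :: 'a list \<Rightarrow>\<^sub>0 'r) \<in> dep_ideal D'' \<and>
        (P (fd_word (remove_nth i w) 1) :: 'a list \<Rightarrow>\<^sub>0 'r) \<in> dep_ideal D''"
      proof (cases "i \<in> good")
        case True
        then have "outer (remove_nth i w) \<noteq> []" "outer (remove_nth i w) \<notin> D"
          using good[OF True] by (auto simp: good_def)
        from Q_indep[OF this] show ?thesis unfolding \<mu>(2)[OF True] by (rule disjI1)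
      next
        case False
        then show ?thesis using IH[OF i] i by (simp add: good_def)
      qed
    qed
    then show ?thesis using True by (simp add: Q_dep)
  next
    case False
    then have DB: "filter (\<lambda>a. a \<in> B) w \<in> D'" using 1 by blast
    show ?thesis
    proof (cases "outer w = []")
      case True
      then have B: "set w \<subseteq> B" by (simp add: filter_empty_conv) blast
      then have w: "w \<in> D''" using DB inner[of w] 1 by (auto simp: filter_id_conv subset_iff)
      have "(Q (remove_nth i w) :: 'a list \<Rightarrow>\<^sub>0 'r) = word (remove_nth i w) 1" for i
        by (rule Q_inner) (use B set_remove_nth_subset[of i w] in \<open>auto simp: filter_empty_conv\<close>)
      then have "(P (fd_word w 1) :: 'a list \<Rightarrow>\<^sub>0 'r) = fd_word w 1" by (simp only: lin_ext_fd_word) (simp only: fd_word_1)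
      then show ?thesis using w by (simp add: Q_inner[OF True] dep_ideal.word dep_ideal.delta)
    next
      case outer: False
      \<comment> \<open>Deleting an inner letter leaves the outer part, hence \<mu>, unchanged;
        deleting an outer letter leaves the dependent inner part unchanged.\<close>
      define \<mu> where "\<mu> = m (outer w)"
      have \<mu>: "\<mu> \<in> A" using m_in[OF outer_in_lists outer False] 1 by (simp add: \<mu>_def)
      have "(P (fd_word w 1) :: 'a list \<Rightarrow>\<^sub>0 'r) \<in> dep_ideal D''"
      proof (rule P_boundary_in[OF D'' \<mu>])
        fix i assume i: "i < length w"
        show "(Q (remove_nth i w) :: 'a list \<Rightarrow>\<^sub>0 'r) = word [\<mu>] 1 * P (fd_word (remove_nth i w) 1) \<or>
          (Q (remove_nth i w) :: 'a list \<Rightarrow>\<^sub>0 'r) \<in> dep_ideal D'' \<and>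
          (P (fd_word (remove_nth i w) 1) :: 'a list \<Rightarrow>\<^sub>0 'r) \<in> dep_ideal D''"
        proof (cases "w ! i \<in> B")
          case True
          then have "outer (remove_nth i w) = outer w" using filter_remove_nth(1)[OF i, of "\<lambda>a. a \<notin> B"] by simp
          then have "outer (remove_nth i w) \<noteq> []" "outer (remove_nth i w) \<notin> D" "m (outer (remove_nth i w)) = \<mu>"
            using outer False by (simp_all add: \<mu>_def)
          then show ?thesis by (intro disjI1) (simp add: Q_indep)
        next
          case False
          then have "filter (\<lambda>a. a \<in> B) (remove_nth i w) = filter (\<lambda>a. a \<in> B) w"
            using filter_remove_nth(1)[OF i, of "\<lambda>a. a \<in> B"] by simp
          then show ?thesis using IH[OF i] DB by simp
        qed
      qed
      then show ?thesis using \<mu> unfolding Q_indep[OF outer False] \<mu>_def[symmetric]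
        by (simp add: dep_ideal_mult_left_word[OF D''])
    qed
  qed
qed

lemma P_in_dep_ideal:
  fixes f :: "'a list \<Rightarrow>\<^sub>0 'r::{comm_ring, comm_monoid_mult}"
  assumes D'': "upclosed A D''" and "E \<subseteq> lists A"
    and E: "\<And>w. w \<in> E \<Longrightarrow> outer w \<in> D \<or> filter (\<lambda>a. a \<in> B) w \<in> D'"
    and inner: "\<And>v. v \<in> lists (A \<inter> B) \<Longrightarrow> v \<in> D' \<Longrightarrow> v \<in> D''"
    and f: "f \<in> dep_ideal E"
  shows "P f \<in> dep_ideal D''"
  using f
proof (induction rule: dep_ideal.induct)
  case (add f g)
  then show ?case by (auto simp: lin_ext_add)
next
  case (word w r)
  then have "(Q w :: 'a list \<Rightarrow>\<^sub>0 'r) \<in> dep_ideal D''"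
    using Q_in_dep_ideal[OF D'' inner] E \<open>E \<subseteq> lists A\<close> by blast
  then show ?case by (auto simp: lin_ext_word intro: dep_ideal_mult_left_word[OF D''])
next
  case (delta w r)
  then have "(P (fd_word w 1) :: 'a list \<Rightarrow>\<^sub>0 'r) \<in> dep_ideal D''"
    using Q_in_dep_ideal[OF D'' inner] E \<open>E \<subseteq> lists A\<close> by blast
  then show ?case
    by (subst fd_word_scale) (auto simp: lin_ext_Nil_mult intro: dep_ideal_mult_left_word[OF D''])
qed simp

end

section \<open>Gluing along families of sets stable under intersection\<close>

text \<open>The member U added last is maximal in the current subfamily, so its intersections with
  the other members are proper subsets of U that have already been treated. Compatibility for nested
  pairs is therefore enough: U is compared with V through their intersection.\<close>

lemma glue:
  fixes D :: "'s set \<Rightarrow> 'a list set" and f :: "'s set \<Rightarrow> ('a list \<Rightarrow>\<^sub>0 'r::{comm_ring, comm_monoid_mult})"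
  assumes "finite \<M>"
    and "\<And>U V. U \<in> \<M> \<Longrightarrow> V \<in> \<M> \<Longrightarrow> U \<inter> V \<in> \<M>"
    and str: "\<And>U. U \<in> \<M> \<Longrightarrow> straightening A (B U) (D U) (m U)"
    and split: "\<And>U W w. U \<in> \<M> \<Longrightarrow> W \<in> \<M> \<Longrightarrow> W \<subset> U \<Longrightarrow> w \<in> D U \<union> D W \<Longrightarrow>
      filter (\<lambda>a. a \<notin> B U) w \<in> D U \<or> filter (\<lambda>a. a \<in> B U) w \<in> D W"
    and inner: "\<And>U V v. U \<in> \<M> \<Longrightarrow> V \<in> \<M> \<Longrightarrow> v \<in> lists (A \<inter> B U) \<Longrightarrow> v \<in> D (V \<inter> U) \<Longrightarrow> v \<in> D V"
    and "\<And>U. U \<in> \<M> \<Longrightarrow> f U \<in> polys A"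
    and "\<And>U V. U \<in> \<M> \<Longrightarrow> V \<in> \<M> \<Longrightarrow> V \<subset> U \<Longrightarrow> f U - f V \<in> dep_ideal (D U \<union> D V)"
  shows "\<exists>g\<in>polys A. \<forall>U\<in>\<M>. g - f U \<in> dep_ideal (D U)"
proof -
  have upc: "upclosed A (D V)" if "V \<in> \<M>" for V using str[OF that] by (rule straightening.up)
  have "\<exists>g\<in>polys A. \<forall>U\<in>\<N>. g - f U \<in> dep_ideal (D U)"
    if "\<N> \<subseteq> \<M>" "\<And>U V. U \<in> \<N> \<Longrightarrow> V \<in> \<N> \<Longrightarrow> U \<inter> V \<in> \<N>" for \<N>
    using finite_subset[OF that(1) assms(1)] that
  proof (induction \<N> rule: finite_psubset_induct)
    case (psubset \<N>)
    note sub = subsetD[OF psubset.prems(1)]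
    show ?case
    proof (cases "\<N> = {}")
      case True
      then show ?thesis by (intro bexI[of _ 0]) auto
    next
      case False
      obtain U where U: "U \<in> \<N>" "\<And>V. V \<in> \<N> \<Longrightarrow> U \<subseteq> V \<Longrightarrow> V = U"
        using finite_has_maximal[OF psubset.hyps(1) False] by metis
      have "\<exists>g\<in>polys A. \<forall>V\<in>\<N> - {U}. g - f V \<in> dep_ideal (D V)"
      proof (rule psubset.IH)
        show "\<N> - {U} \<subset> \<N>" "\<N> - {U} \<subseteq> \<M>" using U(1) psubset.prems(1) by blast+
        fix V V' assume V: "V \<in> \<N> - {U}" "V' \<in> \<N> - {U}"
        \<comment> \<open>If the intersection were U, then U would be contained in V, and maximality
          would give V = U.\<close>
        then show "V \<inter> V' \<in> \<N> - {U}" using psubset.prems(2) U(2) by blast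
      qed
      then obtain g where g: "g \<in> polys A" and gV: "\<forall>V\<in>\<N> - {U}. g - f V \<in> dep_ideal (D V)"
        by (elim bexE)
      have g': "g - f V \<in> dep_ideal (D V)" if "V \<in> \<N>" "V \<noteq> U" for V
        using gV that by simp
      interpret straightening A "B U" "D U" "m U" by (rule str[OF sub[OF U(1)]])
      \<comment> \<open>The defect of \<open>g\<close> at U. Adding \<open>P h\<close> repairs it
        modulo the ideal of U and must not disturb the other members.\<close>
      define h where "h = f U - g"
      have hA: "h \<in> polys A"
        using keys_add_lists[of "f U" A "- g"] assms(6)[OF sub[OF U(1)]] g by (simp add: h_def)
      have Pc: "P h - h \<in> dep_ideal (D U)" using P_cong hA by simp
      have "P h - h \<in> polys A"
        using dep_ideal_in_polys[OF _ Pc] upc[OF sub[OF U(1)]] by (simp add: upclosed_def)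
      then have "P h \<in> polys A" using keys_add_lists[of "P h - h" A h] hA by simp
      then have "g + P h \<in> polys A" using g keys_add_lists[of g A "P h"] by simp
      moreover have "g + P h - f V \<in> dep_ideal (D V)" if V: "V \<in> \<N>" for V
      proof (cases "V = U")
        case True
        then show ?thesis using Pc by (simp add: h_def algebra_simps)
      next
        case False
        \<comment> \<open>Comparison through W, where \<open>g\<close> is already correct, writes
          the defect as a sum of elements of the ideals of U and of W; \<open>P\<close> sends both
          into the ideal of V.\<close>
        define W where "W = V \<inter> U"
        have W: "W \<in> \<N>" "W \<subset> U" using psubset.prems(2)[OF V U(1)] U(2)[OF V] False by (auto simp: W_def)
        have "g - f W \<in> dep_ideal (D U \<union> D W)"
          using g'[OF W(1)] W(2) by (intro dep_ideal_mono[OF _ Un_upper2]) auto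
        from dep_ideal_diff[OF assms(7)[OF sub[OF U(1)] sub[OF W(1)] W(2)] this]
        have h: "h \<in> dep_ideal (D U \<union> D W)"
          by (simp add: h_def)
        have "P h \<in> dep_ideal (D V)"
        proof (rule P_in_dep_ideal[OF upc[OF sub[OF V]] _ _ _ h])
          show "D U \<union> D W \<subseteq> lists A" using upc[OF sub[OF U(1)]] upc[OF sub[OF W(1)]]
            by (simp add: upclosed_def)
          show "outer w \<in> D U \<or> filter (\<lambda>a. a \<in> B U) w \<in> D W" if "w \<in> D U \<union> D W" for w
            using split[OF sub[OF U(1)] sub[OF W(1)] W(2) that] .
          show "v \<in> D V" if "v \<in> lists (A \<inter> B U)" "v \<in> D W" for v
            using inner[OF sub[OF U(1)] sub[OF V] that(1)] that(2) by (simp add: W_def)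
        qed
        from dep_ideal.add[OF g'[OF V False] this] show ?thesis by (simp add: algebra_simps)
      qed
      ultimately show ?thesis by blast
    qed
  qed
  then show ?thesis using assms(2) by blast
qed

section \<open>Lattices\<close>

definition kbasis :: "('n \<Rightarrow> 'k::field ^ 'n::finite) \<Rightarrow> bool" where
  "kbasis b \<longleftrightarrow> (\<forall>c. (\<Sum>i\<in>UNIV. c i *s b i) = 0 \<longrightarrow> (\<forall>i. c i = 0))"

lemma kbasisD: "kbasis b \<Longrightarrow> (\<Sum>i\<in>UNIV. c i *s b i) = 0 \<Longrightarrow> c i = 0"
  by (simp add: kbasis_def)

lemma kbasis_coords:
  assumes "kbasis b" obtains c where "v = (\<Sum>i\<in>UNIV. c i *s b i)"
proof -
  define M where "M = (\<chi> i j. b j $ i)"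
  have M: "M *v x = (\<Sum>i\<in>UNIV. x $ i *s b i)" for x
    unfolding matrix_mult_sum by (simp add: M_def column_def vec_eq_iff)
  have "\<forall>x. M *v x = 0 \<longrightarrow> x = 0"
    using assms unfolding M kbasis_def by (auto simp: vec_eq_iff)
  then have "\<exists>B. M ** B = mat 1"
    using matrix_left_invertible_ker[of M] matrix_left_right_inverse[of M] by metis
  then have "surj ((*v) M)" by (simp add: matrix_right_invertible_surjective)
  then obtain x where "v = M *v x" by (metis surjD)
  then show ?thesis using that M by blast
qed

lemma kbasis_unique:
  assumes "kbasis b" "(\<Sum>i\<in>UNIV. c i *s b i) = (\<Sum>i\<in>UNIV. c' i *s b i)"
  shows "c = c'"
proof
  fix i
  have "(\<Sum>i\<in>UNIV. (c i - c' i) *s b i) = 0"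
    using assms(2) by (simp add: vec.scale_left_diff_distrib sum_subtractf)
  from kbasisD[OF assms(1) this, of i] show "c i = c' i" by simp
qed

text \<open>The change of coordinates behind \<open>basis_exchange\<close>.\<close>

lemma sum_fun_upd:
  fixes b :: "'n::finite \<Rightarrow> 'k::field ^ 'm"
  shows "(\<Sum>i\<in>UNIV. d i *s (b(j := (\<Sum>i\<in>UNIV. c i *s b i))) i)
    = (\<Sum>i\<in>UNIV. (if i = j then d j * c j else d i + d j * c i) *s b i)"
proof -
  let ?y = "\<Sum>i\<in>UNIV. c i *s b i"
  have "(\<Sum>i\<in>UNIV. d i *s (b(j := ?y)) i) = d j *s ?y + (\<Sum>i\<in>UNIV - {j}. d i *s b i)"
    by (subst sum.remove[of _ j]) (auto intro: sum.cong)
  also have "d j *s ?y = (d j * c j) *s b j + (\<Sum>i\<in>UNIV - {j}. (d j * c i) *s b i)"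
    unfolding vec.scale_sum_right by (subst sum.remove[of _ j]) (auto simp: vec.scale_scale)
  also have "\<dots> + (\<Sum>i\<in>UNIV - {j}. d i *s b i)
      = (d j * c j) *s b j + (\<Sum>i\<in>UNIV - {j}. (d i + d j * c i) *s b i)"
    by (simp add: sum.distrib vec.scale_left_distrib algebra_simps)
  also have "\<dots> = (\<Sum>i\<in>UNIV. (if i = j then d j * c j else d i + d j * c i) *s b i)"
    by (subst (2) sum.remove[of _ j]) (auto intro: sum.cong)
  finally show ?thesis .
qed

section \<open>Homotheties, homothety classes and lines\<close>

lemma scale_set_1 [simp]: "scale_set 1 L = L"
  by (simp add: scale_set_def)

lemma scale_set_scale_set: "scale_set c (scale_set d L) = scale_set (c * d) L"
  by (simp add: scale_set_def image_image)

lemma scale_set_mono: "M \<subseteq> N \<Longrightarrow> scale_set c M \<subseteq> scale_set c N"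
  by (auto simp: scale_set_def)

lemma in_scale_set_iff: "c \<noteq> 0 \<Longrightarrow> v \<in> scale_set c L \<longleftrightarrow> inverse c *s v \<in> L"
proof
  assume c: "c \<noteq> 0" and "inverse c *s v \<in> L"
  then have "c *s (inverse c *s v) \<in> scale_set c L" unfolding scale_set_def by blast
  then show "v \<in> scale_set c L" using c by simp
qed (auto simp: scale_set_def)

lemma scale_set_strict_mono: "c \<noteq> 0 \<Longrightarrow> M \<subset> N \<Longrightarrow> scale_set c M \<subset> scale_set c N"
proof -
  assume c: "c \<noteq> 0" and "M \<subset> N"
  then have "scale_set c M \<subseteq> scale_set c N" using scale_set_mono by blast
  moreover have "scale_set c M \<noteq> scale_set c N"
    using c \<open>M \<subset> N\<close> scale_set_scale_set[of "inverse c" c] by (metis left_inverse psubset_eq scale_set_1)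
  ultimately show ?thesis by blast
qed

lemma self_in_hclass: "L \<in> hclass L"
  unfolding hclass_def by (intro CollectI exI[of _ 1]) simp

lemma hclass_scale: "c \<noteq> 0 \<Longrightarrow> hclass (scale_set c L) = hclass L"
proof -
  assume c: "c \<noteq> 0"
  have "scale_set d L = scale_set (d / c) (scale_set c L)" for d
    using c by (simp add: scale_set_scale_set)
  moreover have "d / c \<noteq> 0" if "d \<noteq> 0" for d using that c by simp
  ultimately have "hclass L \<subseteq> hclass (scale_set c L)" unfolding hclass_def by blast
  moreover have "hclass (scale_set c L) \<subseteq> hclass L"
    using c unfolding hclass_def by (auto simp: scale_set_scale_set)
  ultimately show ?thesis by blast
qed

lemma hclass_eqD: "hclass L = hclass M \<Longrightarrow> \<exists>c. c \<noteq> 0 \<and> M = scale_set c L"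
  using self_in_hclass[of M] unfolding hclass_def by blast

lemma line_smult: "c \<noteq> 0 \<Longrightarrow> line (c *s a) = line a"
proof -
  assume c: "c \<noteq> 0"
  have "k *s a = (k / c) *s (c *s a)" for k
    using c by simp
  then have "k *s a \<in> range (\<lambda>k. k *s (c *s a))" for k by (rule range_eqI)
  then show ?thesis by (auto simp: line_def vec.span_singleton)
qed

lemma line_eqD: "line a = line b \<Longrightarrow> b \<noteq> 0 \<Longrightarrow> \<exists>c. c \<noteq> 0 \<and> b = c *s a"
proof -
  assume "line a = line b" "b \<noteq> 0"
  then have "b \<in> line a" by (simp add: line_def vec.span_base)
  then obtain c where "b = c *s a" by (auto simp: line_def vec.span_singleton)
  then show ?thesis using \<open>b \<noteq> 0\<close> by (intro exI[of _ c]) auto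
qed

section \<open>The ring of integers and its nonunits\<close>

locale prime_local_field = nonarch_local_field av for av :: "'k::field \<Rightarrow> real" +
  fixes \<pi> :: 'k
  assumes prime_el: "prime_element av \<pi>"
begin

abbreviation \<O> :: "'k set" where "\<O> \<equiv> int_ring av"

lemma \<O>_iff: "x \<in> \<O> \<longleftrightarrow> av x \<le> 1" by (simp add: int_ring_def)

lemma av_0 [simp]: "av 0 = 0" by (simp add: av_eq_0_iff)

lemma av_1 [simp]: "av 1 = 1"
  using av_mult[of 1 1] av_eq_0_iff[of 1] by simp

lemma av_minus [simp]: "av (- x) = av x"
proof -
  have "av (-1) * av (-1) = 1" using av_mult[of "-1" "-1"] by simp
  then have "av (-1) = 1" using av_nonneg[of "-1"] by (metis abs_of_nonneg abs_1 abs_square_eq_1 power2_eq_square)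
  then show ?thesis using av_mult[of "-1" x] by simp
qed

lemma av_pos: "x \<noteq> 0 \<Longrightarrow> av x > 0"
  using av_nonneg[of x] av_eq_0_iff[of x] by linarith

lemma av_inverse: "av (inverse x) = inverse (av x)"
proof (cases "x = 0")
  case False
  then have "av x * av (inverse x) = 1" using av_mult[of x "inverse x"] by simp
  then show ?thesis by (metis inverse_unique)
qed simp

lemma av_divide: "av (x / y) = av x / av y"
  by (simp add: divide_inverse av_mult av_inverse)

lemma \<O>_simps [simp, intro]: "0 \<in> \<O>" "1 \<in> \<O>" "x \<in> \<O> \<Longrightarrow> - x \<in> \<O>"
  by (simp_all add: \<O>_iff)

lemma \<O>_add: "x \<in> \<O> \<Longrightarrow> y \<in> \<O> \<Longrightarrow> x + y \<in> \<O>"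
  using av_ultrametric[of x y] by (auto simp: \<O>_iff)

lemma \<O>_diff: "x \<in> \<O> \<Longrightarrow> y \<in> \<O> \<Longrightarrow> x - y \<in> \<O>"
  using \<O>_add[of x "- y"] by simp

lemma \<O>_mult: "x \<in> \<O> \<Longrightarrow> y \<in> \<O> \<Longrightarrow> x * y \<in> \<O>"
  using mult_mono[of "av x" 1 "av y" 1] by (simp add: \<O>_iff av_mult av_nonneg)

lemma nonunit_iff: "av x < 1 \<longleftrightarrow> (\<exists>y\<in>\<O>. x = \<pi> * y)"
  using prime_el unfolding prime_element_def by blast

lemma \<pi>_nonunit: "av \<pi> < 1"
  unfolding nonunit_iff by (intro bexI[of _ 1]) auto

text \<open>If \<pi> were zero, every nonunit would vanish, and inverting elements of absolute value
  greater than 1 would make the absolute value trivial.\<close>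

lemma \<pi>_nonzero [simp]: "\<pi> \<noteq> 0"
proof
  assume "\<pi> = 0"
  then have *: "x = 0" if "av x < 1" for x using that by (auto simp: nonunit_iff)
  obtain x where x: "x \<noteq> 0" "av x \<noteq> 1" using av_nontrivial by blast
  show False
  proof (cases "av x < 1")
    case False
    then have "av (inverse x) < 1" using x by (simp add: av_inverse inverse_less_1_iff)
    then show False using * x by fastforce
  qed (use * x in blast)
qed

lemma \<pi>_int [simp]: "\<pi> \<in> \<O>" using \<pi>_nonunit by (simp add: \<O>_iff)

lemma int_cases: "x \<in> \<O> \<Longrightarrow> av x < 1 \<or> av x = 1" by (auto simp: \<O>_iff)

section \<open>Submodules over the ring of integers\<close>

definition osub :: "('k ^ 'n::finite) set \<Rightarrow> bool" where
  "osub M \<longleftrightarrow> 0 \<in> M \<and> (\<forall>x\<in>M. \<forall>y\<in>M. x + y \<in> M) \<and> (\<forall>c\<in>\<O>. \<forall>x\<in>M. c *s x \<in> M)"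

lemma osub_0: "osub M \<Longrightarrow> 0 \<in> M" by (simp add: osub_def)
lemma osub_add: "osub M \<Longrightarrow> x \<in> M \<Longrightarrow> y \<in> M \<Longrightarrow> x + y \<in> M" by (simp add: osub_def)
lemma osub_smult: "osub M \<Longrightarrow> c \<in> \<O> \<Longrightarrow> x \<in> M \<Longrightarrow> c *s x \<in> M" by (simp add: osub_def)
lemma osub_minus: "osub M \<Longrightarrow> x \<in> M \<Longrightarrow> - x \<in> M" using osub_smult[of M "-1" x] by simp
lemma osub_diff: "osub M \<Longrightarrow> x \<in> M \<Longrightarrow> y \<in> M \<Longrightarrow> x - y \<in> M"
  using osub_add[of M x "- y"] osub_minus by auto
lemma osub_sum: "osub M \<Longrightarrow> (\<And>i. i \<in> I \<Longrightarrow> f i \<in> M) \<Longrightarrow> sum f I \<in> M"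
  by (induction I rule: infinite_finite_induct) (auto intro: osub_0 osub_add)
lemma osub_Int: "osub M \<Longrightarrow> osub N \<Longrightarrow> osub (M \<inter> N)" by (simp add: osub_def)

lemma osub_scale: "osub M \<Longrightarrow> osub (scale_set c M)"
  unfolding osub_def scale_set_def
proof (intro conjI ballI)
  assume M: "0 \<in> M \<and> (\<forall>x\<in>M. \<forall>y\<in>M. x + y \<in> M) \<and> (\<forall>c\<in>\<O>. \<forall>x\<in>M. c *s x \<in> M)"
  show "0 \<in> (*s) c ` M" using M by (intro image_eqI[of _ _ 0]) auto
  fix x assume x: "x \<in> (*s) c ` M"
  show "x + y \<in> (*s) c ` M" if "y \<in> (*s) c ` M" for y
  proof -
    note y = that
    obtain w z where "w \<in> M" "z \<in> M" "x = c *s w" "y = c *s z" using x y by blast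
    then have "x + y = c *s (w + z)" "w + z \<in> M" using M by (simp_all add: vec.scale_right_distrib)
    then show ?thesis by blast
  qed
  show "d *s x \<in> (*s) c ` M" if "d \<in> \<O>" for d
  proof -
    obtain z where "z \<in> M" "x = c *s z" using x by blast
    then have "d *s x = c *s (d *s z)" by (simp add: mult.commute)
    then show ?thesis using M that \<open>z \<in> M\<close> by blast
  qed
qed

lemma osub_scale_subset: "osub M \<Longrightarrow> c \<in> \<O> \<Longrightarrow> scale_set c M \<subseteq> M"
  by (auto simp: scale_set_def intro: osub_smult)

lemma osub_unit_iff:
  assumes "osub M" "av c = 1" shows "c *s x \<in> M \<longleftrightarrow> x \<in> M"
proof
  assume "c *s x \<in> M"
  moreover have "inverse c \<in> \<O>" using assms by (simp add: \<O>_iff av_inverse)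
  ultimately have "inverse c *s (c *s x) \<in> M" by (rule osub_smult[OF assms(1), rotated])
  moreover have "c \<noteq> 0" using assms by auto
  then have "inverse c *s (c *s x) = x" by simp
  ultimately show "x \<in> M" by metis
qed (use assms in \<open>auto intro: osub_smult simp: \<O>_iff\<close>)

lemma scale_unit: "osub M \<Longrightarrow> av c = 1 \<Longrightarrow> scale_set c M = M"
proof -
  assume M: "osub M" "av c = 1"
  then have "c \<noteq> 0" by auto
  have "av (inverse c) = 1" using M by (simp add: av_inverse)
  then show ?thesis using M \<open>c \<noteq> 0\<close> by (auto simp: in_scale_set_iff osub_unit_iff)
qed

lemma nonunit_smult: "osub L \<Longrightarrow> av c < 1 \<Longrightarrow> x \<in> L \<Longrightarrow> c *s x \<in> scale_set \<pi> L"
proof -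
  assume L: "osub L" "av c < 1" "x \<in> L"
  then obtain y where "y \<in> \<O>" "c = \<pi> * y" by (auto simp: nonunit_iff)
  then have "c *s x = \<pi> *s (y *s x)" "y *s x \<in> L" using L by (auto intro: osub_smult)
  then show ?thesis unfolding scale_set_def by blast
qed

lemma ex_max_coefficient: "\<exists>j. \<forall>i. av (c i) \<le> av (c (j :: 'n::finite))"
proof -
  have "Max (range (\<lambda>i. av (c i))) \<in> range (\<lambda>i. av (c i))" by (intro Max_in) auto
  then obtain j where "Max (range (\<lambda>i. av (c i))) = av (c j)" by blast
  moreover have "av (c i) \<le> Max (range (\<lambda>i. av (c i)))" for i by (intro Max_ge) auto
  ultimately show ?thesis by metis
qed

section \<open>Lattices and their bases\<close>

definition lat :: "('n \<Rightarrow> 'k ^ 'n::finite) \<Rightarrow> ('k ^ 'n) set" where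
  "lat b = {\<Sum>i\<in>UNIV. c i *s b i | c. \<forall>i. c i \<in> \<O>}"

text \<open>Independence over \<O> implies independence over the field: a relation can be divided by
  its coefficient of largest absolute value.\<close>

lemma is_lattice_iff: "is_lattice av L \<longleftrightarrow> (\<exists>b. kbasis b \<and> L = lat b)"
proof
  assume "is_lattice av L"
  then obtain b where b: "\<And>c. (\<forall>i. c i \<in> \<O>) \<Longrightarrow> (\<Sum>i\<in>UNIV. c i *s b i) = 0 \<Longrightarrow> (\<forall>i. c i = 0)"
    "L = lat b" unfolding is_lattice_def lat_def by blast
  have "kbasis b"
    unfolding kbasis_def
  proof (intro allI impI)
    fix c i
    assume c: "(\<Sum>i\<in>UNIV. c i *s b i) = 0"
    obtain j where j: "\<And>i. av (c i) \<le> av (c j)"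
      using ex_max_coefficient[of c] by blast
    show "c i = 0"
    proof (rule ccontr)
      assume "c i \<noteq> 0"
      then have cj: "c j \<noteq> 0" using j[of i] av_pos[of "c i"] by auto
      have "\<forall>i. c i / c j = 0"
      proof (rule b(1))
        show "\<forall>i. c i / c j \<in> \<O>" using j av_pos[OF cj] by (auto simp: \<O>_iff av_divide)
        have "(\<Sum>i\<in>UNIV. (c i / c j) *s b i) = inverse (c j) *s (\<Sum>i\<in>UNIV. c i *s b i)"
          by (simp add: vec.scale_sum_right divide_inverse mult.commute)
        then show "(\<Sum>i\<in>UNIV. (c i / c j) *s b i) = 0" using c by simp
      qed
      then show False using cj by auto
    qed
  qed
  then show "\<exists>b. kbasis b \<and> L = lat b" using b(2) by blast
next
  assume "\<exists>b. kbasis b \<and> L = lat b"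
  then show "is_lattice av L" unfolding is_lattice_def kbasis_def lat_def by blast
qed

lemma in_lat_iff: "kbasis b \<Longrightarrow> (\<Sum>i\<in>UNIV. c i *s b i) \<in> lat b \<longleftrightarrow> (\<forall>i. c i \<in> \<O>)"
  using kbasis_unique[of b c] unfolding lat_def by blast

lemma osub_lat: "osub (lat b)"
  unfolding osub_def
proof (intro conjI ballI)
  show "0 \<in> lat b" unfolding lat_def by (intro CollectI exI[of _ "\<lambda>_. 0"]) auto
  fix x assume "x \<in> lat b"
  then obtain c where c: "\<forall>i. c i \<in> \<O>" "x = (\<Sum>i\<in>UNIV. c i *s b i)" unfolding lat_def by blast
  show "x + y \<in> lat b" if "y \<in> lat b" for y
  proof -
    from that obtain d where "\<forall>i. d i \<in> \<O>" "y = (\<Sum>i\<in>UNIV. d i *s b i)" unfolding lat_def by blast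
    then show ?thesis using c unfolding lat_def
      by (intro CollectI exI[of _ "\<lambda>i. c i + d i"]) (auto simp: vec.scale_left_distrib sum.distrib \<O>_add)
  qed
  show "d *s x \<in> lat b" if "d \<in> \<O>" for d
    using c that unfolding lat_def
    by (intro CollectI exI[of _ "\<lambda>i. d * c i"]) (auto simp: vec.scale_sum_right \<O>_mult)
qed

lemma osub_lattice: "is_lattice av L \<Longrightarrow> osub L"
  unfolding is_lattice_iff using osub_lat by blast

lemma basis_in_lat: "b i \<in> lat b"
proof -
  have "(\<Sum>j\<in>UNIV. (if j = i then 1 else 0) *s b j) = (\<Sum>j\<in>UNIV. if j = i then b j else 0)"
    by (intro sum.cong) auto
  then have "(\<Sum>j\<in>UNIV. (if j = i then 1 else 0) *s b j) = b i" by simp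
  then show ?thesis unfolding lat_def by (intro CollectI exI[of _ "\<lambda>j. if j = i then 1 else 0"]) auto
qed

lemma is_lattice_scale:
  assumes "is_lattice av L" "c \<noteq> 0" shows "is_lattice av (scale_set c L)"
proof -
  obtain b where b: "kbasis b" "L = lat b" using assms(1) is_lattice_iff by blast
  have eq: "(\<Sum>i\<in>UNIV. d i *s (c *s b i)) = c *s (\<Sum>i\<in>UNIV. d i *s b i)" for d
    by (simp add: vec.scale_sum_right mult.commute)
  have "kbasis (\<lambda>i. c *s b i)"
    using b(1) assms(2) unfolding kbasis_def eq by simp
  moreover have "scale_set c L = lat (\<lambda>i. c *s b i)"
    unfolding b(2) scale_set_def lat_def eq by blast
  ultimately show ?thesis unfolding is_lattice_iff by blast
qed

text \<open>Division by the coordinate of largest absolute value makes all coordinates integral and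
  one of them equal to 1. This provides the generators \<rho> of the lines.\<close>

lemma primitive_multiple:
  assumes L: "is_lattice av L" and v: "v \<noteq> 0"
  shows "\<exists>c. c \<noteq> 0 \<and> c *s v \<in> L \<and> c *s v \<notin> scale_set \<pi> L"
proof -
  obtain b where b: "kbasis b" "L = lat b" using L is_lattice_iff by blast
  obtain x where x: "v = (\<Sum>i\<in>UNIV. x i *s b i)" using kbasis_coords[OF b(1)] by blast
  obtain j where le: "\<And>i. av (x i) \<le> av (x j)"
    using ex_max_coefficient[of x] by blast
  have xj: "x j \<noteq> 0"
  proof
    assume "x j = 0"
    then have "x i = 0" for i using le[of i] av_pos[of "x i"] by force
    then show False using v x by simp
  qed
  have s: "inverse (x j) *s v = (\<Sum>i\<in>UNIV. (x i / x j) *s b i)"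
    unfolding x vec.scale_sum_right by (simp add: divide_inverse mult.commute)
  have "inverse (x j) *s v \<in> L"
    unfolding s b(2) in_lat_iff[OF b(1)] using le av_pos[OF xj] by (auto simp: \<O>_iff av_divide)
  moreover have "inverse (x j) *s v \<notin> scale_set \<pi> L"
  proof
    assume "inverse (x j) *s v \<in> scale_set \<pi> L"
    then have "inverse \<pi> *s (inverse (x j) *s v) \<in> L" by (simp add: in_scale_set_iff)
    moreover have "inverse \<pi> *s (inverse (x j) *s v) = (\<Sum>i\<in>UNIV. (inverse \<pi> * (x i / x j)) *s b i)"
      unfolding s by (simp add: vec.scale_sum_right)
    ultimately have "inverse \<pi> * (x j / x j) \<in> \<O>"
      using in_lat_iff[OF b(1), of "\<lambda>i. inverse \<pi> * (x i / x j)"] b(2) by metis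
    then show False using xj \<pi>_nonunit av_pos[OF \<pi>_nonzero]
      by (simp add: \<O>_iff av_inverse inverse_le_1_iff)
  qed
  ultimately show ?thesis using xj by (intro exI[of _ "inverse (x j)"]) auto
qed

text \<open>The matrix of the exchange is the identity with one row replaced, and its determinant
  \<open>c j\<close> is a unit.\<close>

lemma basis_exchange:
  assumes b: "kbasis b" and c: "\<And>i. c i \<in> \<O>" "av (c j) = 1"
  shows "kbasis (b(j := (\<Sum>i\<in>UNIV. c i *s b i)))" "lat (b(j := (\<Sum>i\<in>UNIV. c i *s b i))) = lat b"
proof -
  let ?b = "b(j := (\<Sum>i\<in>UNIV. c i *s b i))"
  have cj: "c j \<noteq> 0" using c(2) by auto
  show "kbasis ?b"
    unfolding kbasis_def
  proof (intro allI impI)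
    fix d i assume "(\<Sum>i\<in>UNIV. d i *s ?b i) = 0"
    then have "(\<Sum>i\<in>UNIV. (if i = j then d j * c j else d i + d j * c i) *s b i) = 0"
      unfolding sum_fun_upd .
    note * = kbasisD[OF b this]
    have "d j = 0" using *[of j] cj by simp
    then show "d i = 0" using *[of i] by (simp split: if_splits)
  qed
  show "lat ?b = lat b"
  proof (intro equalityI subsetI)
    fix x assume "x \<in> lat ?b"
    then obtain d where d: "\<forall>i. d i \<in> \<O>" "x = (\<Sum>i\<in>UNIV. d i *s ?b i)" unfolding lat_def by blast
    have "\<forall>i. (if i = j then d j * c j else d i + d j * c i) \<in> \<O>" using d c by (auto intro: \<O>_add \<O>_mult)
    then show "x \<in> lat b" unfolding d(2) sum_fun_upd in_lat_iff[OF b] .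
  next
    fix x assume "x \<in> lat b"
    then obtain e where e: "\<forall>i. e i \<in> \<O>" "x = (\<Sum>i\<in>UNIV. e i *s b i)" unfolding lat_def by blast
    \<comment> \<open>The coordinates of \<open>x\<close> in the new basis, solved from
      \<open>sum_fun_upd\<close>.\<close>
    define d where "d i = (if i = j then e j / c j else e i - (e j / c j) * c i)" for i
    have ejc: "e j / c j \<in> \<O>" using e c by (simp add: \<O>_iff av_divide)
    have d: "\<forall>i. d i \<in> \<O>"
      using e(1) c(1) ejc \<O>_diff \<O>_mult[OF ejc] unfolding d_def by presburger
    have "(\<Sum>i\<in>UNIV. (if i = j then d j * c j else d i + d j * c i) *s b i) = x"
      unfolding e(2) using cj by (intro sum.cong) (auto simp: d_def)
    then have "x = (\<Sum>i\<in>UNIV. d i *s ?b i)" unfolding sum_fun_upd ..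
    then show "x \<in> lat ?b" using d unfolding lat_def by blast
  qed
qed

text \<open>The dimension of \<open>N/\<pi>L\<close> over the residue field.\<close>

definition lrank :: "('k ^ 'n::finite) set \<Rightarrow> ('k ^ 'n) set \<Rightarrow> nat" where
  "lrank L N = Max {card {i. b i \<in> N} | b. kbasis b \<and> lat b = L}"

lemma
  assumes L: "is_lattice av (L :: ('k ^ 'n::finite) set)"
  shows lrank_ge: "kbasis b \<Longrightarrow> lat b = L \<Longrightarrow> card {i. b i \<in> N} \<le> lrank L N"
    and lrank_attained: "\<exists>b. kbasis b \<and> lat b = L \<and> card {i. b i \<in> N} = lrank L N"
    and lrank_le: "lrank L N \<le> CARD('n)"
proof -
  let ?S = "{card {i. b i \<in> N} | b. kbasis b \<and> lat b = L}"
  have "card {i. b i \<in> N} \<le> CARD('n)" for b :: "'n \<Rightarrow> 'k ^ 'n"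
    by (intro card_mono) auto
  then have "?S \<subseteq> {..CARD('n)}" by blast
  then have fin: "finite ?S" using finite_subset by blast
  have ne: "?S \<noteq> {}" using L unfolding is_lattice_iff by blast
  have "lrank L N \<in> ?S" unfolding lrank_def using fin ne by (rule Max_in)
  then show "\<exists>b. kbasis b \<and> lat b = L \<and> card {i. b i \<in> N} = lrank L N" "lrank L N \<le> CARD('n)"
    using \<open>?S \<subseteq> {..CARD('n)}\<close> by fastforce+
  show "card {i. b i \<in> N} \<le> lrank L N" if "kbasis b" "lat b = L" for b
    unfolding lrank_def using fin that by (intro Max_ge) auto
qed

text \<open>The exchange replaces the basis vector \<open>b j\<close> outside \<open>N\<close> by a
  vector in \<open>N'\<close> and so raises the count. With \<open>N' = N\<close> it shows that an
  optimal basis admits no such vector.\<close>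

lemma lrank_exchange:
  assumes L: "is_lattice av L" and b: "kbasis b" "lat b = L"
    and c: "\<And>i. c i \<in> \<O>" "av (c j) = 1" "b j \<notin> N" "N \<subseteq> N'" "(\<Sum>i\<in>UNIV. c i *s b i) \<in> N'"
  shows "card {i. b i \<in> N} < lrank L N'"
proof -
  let ?b = "b(j := (\<Sum>i\<in>UNIV. c i *s b i))"
  have "card {i. b i \<in> N} < card (insert j {i. b i \<in> N})" using c(3) by simp
  also have "\<dots> \<le> card {i. ?b i \<in> N'}" using c by (intro card_mono) auto
  also have "\<dots> \<le> lrank L N'"
    using basis_exchange[of b c j] b c(1,2) by (intro lrank_ge[OF L]) (auto simp del: fun_upd_apply)
  finally show ?thesis .
qed

text \<open>If a basis has as many members as possible in \<open>N\<close>, these members span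
  \<open>N\<close> modulo \<pi>L: an element of \<open>N\<close> with a unit coefficient at another
  basis vector could be exchanged for it.\<close>

lemma adapted_basis:
  assumes L: "is_lattice av L" and N: "osub N" "scale_set \<pi> L \<subseteq> N"
    and b: "kbasis b" "lat b = L" "card {i. b i \<in> N} = lrank L N" and c: "\<And>i. c i \<in> \<O>"
  shows "(\<Sum>i\<in>UNIV. c i *s b i) \<in> N \<longleftrightarrow> (\<forall>i. b i \<notin> N \<longrightarrow> av (c i) < 1)"
proof
  assume *: "(\<Sum>i\<in>UNIV. c i *s b i) \<in> N"
  show "\<forall>i. b i \<notin> N \<longrightarrow> av (c i) < 1"
  proof (intro allI impI, rule ccontr)
    fix j assume "b j \<notin> N" "\<not> av (c j) < 1"
    then show False
      using lrank_exchange[OF L b(1,2) c _ _ order_refl *, of j] int_cases[OF c, of j] b(3) by auto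
  qed
next
  assume *: "\<forall>i. b i \<notin> N \<longrightarrow> av (c i) < 1"
  show "(\<Sum>i\<in>UNIV. c i *s b i) \<in> N"
  proof (rule osub_sum[OF N(1)])
    fix i
    show "c i *s b i \<in> N"
    proof (cases "b i \<in> N")
      case False
      then have "c i *s b i \<in> scale_set \<pi> L"
        using * basis_in_lat[of b i] b(2) osub_lattice[OF L] by (intro nonunit_smult) auto
      then show ?thesis using N by blast
    qed (use osub_smult[OF N(1) c] in blast)
  qed
qed

text \<open>In an adapted basis of \<open>L\<close>, keep the vectors lying in \<open>N\<close> and
  multiply the others by \<pi>.\<close>

lemma intermediate_lattice:
  assumes L: "is_lattice av L" and N: "osub N" "scale_set \<pi> L \<subseteq> N" "N \<subseteq> L"
  shows "is_lattice av N"
proof -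
  obtain b where b: "kbasis b" "lat b = L" "card {i. b i \<in> N} = lrank L N"
    using lrank_attained[OF L] by blast
  note ab = adapted_basis[OF L N(1,2) b]
  define e where "e i = (if b i \<in> N then 1 else \<pi>)" for i
  have e: "e i \<noteq> 0" "e i \<in> \<O>" for i by (auto simp: e_def)
  have eq: "(\<Sum>i\<in>UNIV. d i *s (e i *s b i)) = (\<Sum>i\<in>UNIV. (d i * e i) *s b i)" for d
    by simp
  have "kbasis (\<lambda>i. e i *s b i)"
    unfolding kbasis_def eq
  proof (intro allI impI)
    fix c i assume "(\<Sum>i\<in>UNIV. (c i * e i) *s b i) = 0"
    from kbasisD[OF b(1) this, of i] show "c i = 0" using e by simp
  qed
  moreover have "N = lat (\<lambda>i. e i *s b i)"
  proof (intro equalityI subsetI)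
    fix x assume "x \<in> lat (\<lambda>i. e i *s b i)"
    then obtain d where d: "\<forall>i. d i \<in> \<O>" "x = (\<Sum>i\<in>UNIV. d i *s (e i *s b i))"
      unfolding lat_def by blast
    have de: "d i * e i \<in> \<O>" for i using d e by (simp add: \<O>_mult)
    have "av (d i * e i) < 1" if "b i \<notin> N" for i
      using that d(1) nonunit_iff[of "d i * e i"] by (auto simp: e_def mult.commute)
    then show "x \<in> N" unfolding d(2) eq by (subst ab[OF de]) blast
  next
    fix x assume x: "x \<in> N"
    then obtain c where c: "\<forall>i. c i \<in> \<O>" "x = (\<Sum>i\<in>UNIV. c i *s b i)"
      using N(3) b(2) unfolding lat_def by blast
    have "\<forall>i. b i \<notin> N \<longrightarrow> av (c i) < 1" using ab c x by blast
    then have *: "\<exists>y\<in>\<O>. c i = y * e i" for i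
      using c(1) nonunit_iff[of "c i"] by (auto simp: e_def mult.commute)
    define y where "y i = (SOME y. y \<in> \<O> \<and> c i = y * e i)" for i
    have y: "y i \<in> \<O> \<and> c i = y i * e i" for i
      using someI_ex[of "\<lambda>y. y \<in> \<O> \<and> c i = y * e i"] * unfolding y_def by blast
    have "x = (\<Sum>i\<in>UNIV. y i *s (e i *s b i))" unfolding eq c(2) using y by (metis (no_types, lifting))
    then show "x \<in> lat (\<lambda>i. e i *s b i)" unfolding lat_def using y by blast
  qed
  ultimately show ?thesis unfolding is_lattice_iff by blast
qed

lemma lrank_strict_mono:
  assumes L: "is_lattice av L" and N: "osub N" "scale_set \<pi> L \<subseteq> N" "N \<subset> N'" "N' \<subseteq> L"
  shows "lrank L N < lrank L N'"
proof -
  obtain b where b: "kbasis b" "lat b = L" "card {i. b i \<in> N} = lrank L N"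
    using lrank_attained[OF L] by blast
  obtain x where x: "x \<in> N'" "x \<notin> N" using N by blast
  then obtain c where c: "\<forall>i. c i \<in> \<O>" "x = (\<Sum>i\<in>UNIV. c i *s b i)"
    using N(4) b(2) unfolding lat_def by blast
  then obtain j where j: "b j \<notin> N" "\<not> av (c j) < 1"
    using adapted_basis[OF L N(1,2) b, of c] x(2) by blast
  then have "av (c j) = 1" using int_cases[of "c j"] c(1) by blast
  then show ?thesis
    using lrank_exchange[OF L b(1,2), of c j N N'] c j x N(3) b(3) by auto
qed

text \<open>A small multiple c\<O> of the ring of integers lies in a compact neighbourhood of 0, so
  finitely many balls of radius \<open>av c\<close> cover it. Dividing by c leaves finitely many
  residue classes.\<close>

lemma finite_residues: "\<exists>Y. finite Y \<and> Y \<subseteq> \<O> \<and> (\<forall>x\<in>\<O>. \<exists>y\<in>Y. av (x - y) < 1)"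
proof -
  interpret M: Metric_space UNIV "\<lambda>x y. av (x - y)"
  proof
    fix x y z :: 'k
    show "0 \<le> av (x - y)" by (rule av_nonneg)
    show "av (x - y) = av (y - x)" using av_minus[of "x - y"] by simp
    show "av (x - y) = 0 \<longleftrightarrow> x = y" by (simp add: av_eq_0_iff)
    show "av (x - z) \<le> av (x - y) + av (y - z)"
      using av_ultrametric[of "x - y" "y - z"] av_nonneg[of "x - y"] av_nonneg[of "y - z"] by auto
  qed
  obtain U C where UC: "openin M.mtopology U" "compactin M.mtopology C" "0 \<in> U" "U \<subseteq> C"
    using av_locally_compact unfolding locally_compact_space_def M.topspace_mtopology
    by (metis UNIV_I)
  obtain r where r: "r > 0" "M.mball 0 r \<subseteq> U"
    using UC(1,3) unfolding M.openin_mtopology by blast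
  obtain n where n: "av \<pi> ^ n < r" using real_arch_pow_inv[OF r(1) \<pi>_nonunit] by blast
  define c where "c = \<pi> ^ n"
  have c: "c \<noteq> 0" "av c < r" 
  proof -
    have "av (\<pi> ^ n) = av \<pi> ^ n" by (induction n) (auto simp: av_mult)
    then show "c \<noteq> 0" "av c < r" using n by (auto simp: c_def)
  qed
  have "M.mtotally_bounded C" using UC(2) by (rule M.compactin_imp_mtotally_bounded)
  then obtain X where X: "finite X" "C \<subseteq> (\<Union>x\<in>X. M.mball x (av c))"
    unfolding M.mtotally_bounded_def using av_pos[OF c(1)] by blast
  have cov: "\<exists>x\<in>X. av (c * y - x) < av c" if "y \<in> \<O>" for y
  proof -
    have "av (c * y) \<le> av c" using that av_nonneg[of c] by (simp add: \<O>_iff av_mult mult_left_le)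
    then have "c * y \<in> M.mball 0 r" using c(2) by (simp add: M.in_mball)
    then have "c * y \<in> C" using r(2) UC(4) by blast
    then obtain x where "x \<in> X" "c * y \<in> M.mball x (av c)" using X(2) by blast
    then have "av (c * y - x) < av c" using av_minus[of "c * y - x"] by (simp add: M.in_mball)
    then show ?thesis using \<open>x \<in> X\<close> by blast
  qed
  \<comment> \<open>The centres of the balls may lie outside c\<O>. Each centre in use is replaced
    by an integer whose multiple by c lies in the same ball; by the ultrametric inequality it serves
    equally well.\<close>
  define g where "g x = (SOME y. y \<in> \<O> \<and> av (c * y - x) < av c)" for x
  have "\<exists>y\<in>g ` X \<inter> \<O>. av (z - y) < 1" if z: "z \<in> \<O>" for z
  proof -
    obtain x where x: "x \<in> X" "av (c * z - x) < av c" using cov[OF z] by blast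
    have g: "g x \<in> \<O> \<and> av (c * g x - x) < av c"
      unfolding g_def by (rule someI[of _ z]) (use x z in blast)
    have "av (c * (z - g x)) \<le> max (av (c * z - x)) (av (- (c * g x - x)))"
      using av_ultrametric[of "c * z - x" "- (c * g x - x)"] by (simp add: algebra_simps)
    also have "\<dots> < av c" using x g unfolding av_minus by simp
    finally have "av (z - g x) < 1" using av_pos[OF c(1)] by (simp add: av_mult)
    then show ?thesis using g x by blast
  qed
  then show ?thesis using X(1) by (intro exI[of _ "g ` X \<inter> \<O>"]) auto
qed

text \<open>Such an \<open>N\<close> is determined by which members of a finite set of
  representatives of L/\<pi>L it contains. This makes stable sets finite, as the induction in
  \<open>glue\<close> requires.\<close>

lemma finite_intermediate:
  assumes L: "is_lattice av L"
  shows "finite {N. osub N \<and> scale_set \<pi> L \<subseteq> N \<and> N \<subseteq> L}"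
proof -
  obtain b where b: "kbasis b" "L = lat b" using L is_lattice_iff by blast
  obtain Y where Y: "finite Y" "Y \<subseteq> \<O>" "\<forall>x\<in>\<O>. \<exists>y\<in>Y. av (x - y) < 1" using finite_residues by blast
  define G where "G = (\<lambda>c. \<Sum>i\<in>UNIV. c i *s b i) ` (PiE UNIV (\<lambda>_. Y))"
  have "finite G" unfolding G_def using Y(1) by (intro finite_imageI finite_PiE) auto
  have near: "\<exists>g\<in>G. x - g \<in> scale_set \<pi> L" if x: "x \<in> L" for x
  proof -
    obtain c where c: "\<forall>i. c i \<in> \<O>" "x = (\<Sum>i\<in>UNIV. c i *s b i)"
      using x unfolding b(2) lat_def by blast
    then have "\<forall>i. \<exists>y\<in>Y. av (c i - y) < 1" using Y(3) by blast
    then obtain y where y: "\<And>i. y i \<in> Y" "\<And>i. av (c i - y i) < 1" by metis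
    have "x - (\<Sum>i\<in>UNIV. y i *s b i) = (\<Sum>i\<in>UNIV. (c i - y i) *s b i)"
      by (simp add: c(2) sum_subtractf vec.scale_left_diff_distrib)
    also have "\<dots> \<in> scale_set \<pi> L"
      using osub_lattice[OF L] y(2) basis_in_lat b(2)
      by (intro osub_sum osub_scale nonunit_smult) auto
    finally show ?thesis using y(1) unfolding G_def by blast
  qed
  define F where "F S = {x\<in>L. \<exists>g\<in>S. x - g \<in> scale_set \<pi> L}" for S
  have "F (G \<inter> N) = N"
    if N: "osub N" "scale_set \<pi> L \<subseteq> N" "N \<subseteq> L" for N
  proof (intro equalityI subsetI)
    fix x assume x: "x \<in> N"
    then obtain g where g: "g \<in> G" "x - g \<in> scale_set \<pi> L" using near N by blast
    then have "x - (x - g) \<in> N" using osub_diff[OF N(1) x, of "x - g"] N(2) by blast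
    then have "g \<in> N" by simp
    then show "x \<in> F (G \<inter> N)" unfolding F_def using x g N by auto
  next
    fix x assume "x \<in> F (G \<inter> N)"
    then obtain g where "g \<in> N" "x - g \<in> N" using N unfolding F_def by blast
    then have "g + (x - g) \<in> N" by (rule osub_add[OF N(1)])
    then show "x \<in> N" by simp
  qed
  then have "inj_on (\<lambda>N. G \<inter> N) {N. osub N \<and> scale_set \<pi> L \<subseteq> N \<and> N \<subseteq> L}"
    by (intro inj_on_inverseI[of _ F]) simp
  moreover have "(\<lambda>N. G \<inter> N) ` {N. osub N \<and> scale_set \<pi> L \<subseteq> N \<and> N \<subseteq> L} \<subseteq> Pow G" by blast
  ultimately show ?thesis using \<open>finite G\<close> by (meson finite_Pow_iff finite_imageD finite_subset)
qed

end

section \<open>Dependence of lines along a chain of lattices\<close>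

lemma distinct_filter_partition:
  "distinct (filter P w) \<Longrightarrow> distinct (filter (\<lambda>x. \<not> P x) w) \<Longrightarrow> distinct w"
  by (induction w) (auto split: if_splits)

lemma set_remove_nth_distinct:
  assumes "distinct w" "i < length w" shows "set (remove_nth i w) = set w - {w ! i}"
proof -
  have w: "w = take i w @ w ! i # drop (Suc i) w" using assms(2) by (rule id_take_nth_drop)
  then have "distinct (take i w @ w ! i # drop (Suc i) w)" using assms(1) by simp
  moreover have "set w = set (take i w @ w ! i # drop (Suc i) w)" using w by simp
  ultimately show ?thesis unfolding remove_nth_def by auto
qed

text \<open>A count: the deletion has one place less than \<open>w\<close> and no repetition, while
  \<open>w\<close> has fewer distinct letters than places.\<close>

lemma set_remove_nth_repeated:
  assumes "\<not> distinct w" "distinct (remove_nth i w)" "i < length w"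
  shows "set (remove_nth i w) = set w"
proof (rule card_subset_eq)
  have "card (set w) < length w" using assms(1) card_distinct card_length le_neq_implies_less by blast
  moreover have "card (set (remove_nth i w)) = length w - 1"
    using distinct_card[OF assms(2)] assms(3) by (simp add: remove_nth_def)
  moreover have "card (set (remove_nth i w)) \<le> card (set w)"
    by (intro card_mono set_remove_nth_subset) simp
  ultimately show "card (set (remove_nth i w)) = card (set w)" by linarith
qed (simp_all add: set_remove_nth_subset)

locale lattice_lines = prime_local_field av \<pi> for av :: "'k::field \<Rightarrow> real" and \<pi> :: 'k +
  fixes L :: "('k ^ 'n::finite) set" and A :: "('k ^ 'n) set set" and \<rho> :: "('k ^ 'n) set \<Rightarrow> 'k ^ 'n"
  assumes L: "is_lattice av L"
    and \<rho>_in: "l \<in> A \<Longrightarrow> \<rho> l \<in> L"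
    and \<rho>_primitive: "l \<in> A \<Longrightarrow> \<rho> l \<notin> scale_set \<pi> L"
    and line_\<rho>: "l \<in> A \<Longrightarrow> line (\<rho> l) = l"
begin

section \<open>The matroid on the lines defined by a chain\<close>

definition between :: "('k ^ 'n) set \<Rightarrow> bool" where
  "between M \<longleftrightarrow> osub M \<and> scale_set \<pi> L \<subseteq> M \<and> M \<subseteq> L"

text \<open>Unit coefficients suffice: the remaining terms of a relation over \<open>\<O>\<close> lie in \<open>\<pi>L \<subseteq> M\<close>.\<close>

definition circ :: "('k ^ 'n) set \<Rightarrow> ('k ^ 'n) set set \<Rightarrow> bool" where
  "circ M T \<longleftrightarrow> finite T \<and> T \<noteq> {} \<and> (\<forall>l\<in>T. \<rho> l \<notin> M) \<and>
     (\<exists>c. (\<forall>l\<in>T. av (c l) = 1) \<and> (\<Sum>l\<in>T. c l *s \<rho> l) \<in> M)"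

definition dep :: "('k ^ 'n) set set \<Rightarrow> ('k ^ 'n) set set \<Rightarrow> bool" where
  "dep \<L> S \<longleftrightarrow> (\<exists>M\<in>\<L>. \<exists>T\<subseteq>S. circ M T)"

definition dep_words :: "('k ^ 'n) set set \<Rightarrow> ('k ^ 'n) set list set" where
  "dep_words \<L> = {w \<in> lists A. \<not> distinct w \<or> dep \<L> (set w)}"

lemma between_\<pi>L: "between (scale_set \<pi> L)"
  unfolding between_def using osub_lattice[OF L] osub_scale_subset[of L \<pi>] by (simp add: osub_scale)

lemma dep_mono: "dep \<L> S \<Longrightarrow> S \<subseteq> S' \<Longrightarrow> dep \<L> S'"
  unfolding dep_def by blast

text \<open>Terms with a nonunit coefficient lie in \<pi>L, and terms with generator in
  \<open>M\<close> lie in \<open>M\<close>; dropping them does not change the sum modulo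
  \<open>M\<close>. The line \<open>l0\<close> keeps the remaining set nonempty.\<close>

lemma circ_generalI:
  assumes M: "between M" and S: "finite S" "S \<subseteq> A" and c: "\<And>l. l \<in> S \<Longrightarrow> c l \<in> \<O>"
    and sum: "(\<Sum>l\<in>S. c l *s \<rho> l) \<in> M"
    and unit: "l0 \<in> S" "av (c l0) = 1" "\<rho> l0 \<notin> M"
  shows "circ M {l \<in> S. av (c l) = 1 \<and> \<rho> l \<notin> M}"
proof -
  let ?T = "{l \<in> S. av (c l) = 1 \<and> \<rho> l \<notin> M}"
  have M': "osub M" "scale_set \<pi> L \<subseteq> M" using M by (auto simp: between_def)
  have "c l *s \<rho> l \<in> M" if l: "l \<in> S - ?T" for l
  proof (cases "\<rho> l \<in> M")
    case True
    then show ?thesis using osub_smult[OF M'(1) c True] l by blast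
  next
    case False
    then have "av (c l) < 1" using l c[of l] int_cases by blast
    then have "c l *s \<rho> l \<in> scale_set \<pi> L"
      using l S \<rho>_in by (intro nonunit_smult osub_lattice[OF L]) auto
    then show ?thesis using M' by blast
  qed
  then have "(\<Sum>l\<in>S - ?T. c l *s \<rho> l) \<in> M" by (intro osub_sum[OF M'(1)])
  moreover have "(\<Sum>l\<in>S. c l *s \<rho> l) = (\<Sum>l\<in>S - ?T. c l *s \<rho> l) + (\<Sum>l\<in>?T. c l *s \<rho> l)"
    using S by (intro sum.subset_diff) auto
  ultimately have "(\<Sum>l\<in>?T. c l *s \<rho> l) \<in> M"
    using osub_diff[OF M'(1) sum, of "(\<Sum>l\<in>S - ?T. c l *s \<rho> l)"] by simp
  then show ?thesis unfolding circ_def using S unit by auto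
qed

text \<open>Modulo the larger \<open>N\<close> the lines with generator in \<open>N\<close> drop out
  of the relation. In this way a relation that mixes several steps of a chain is pushed up to a
  single step.\<close>

lemma circ_enlarge:
  assumes T: "circ M T" and "M \<subseteq> N" "osub N" and ne: "\<exists>l\<in>T. \<rho> l \<notin> N"
  shows "circ N {l \<in> T. \<rho> l \<notin> N}"
proof -
  obtain c where c: "\<forall>l\<in>T. av (c l) = 1" "(\<Sum>l\<in>T. c l *s \<rho> l) \<in> M" using T by (auto simp: circ_def)
  let ?T = "{l \<in> T. \<rho> l \<notin> N}"
  have fin: "finite T" using T by (simp add: circ_def)
  have "(\<Sum>l\<in>T - ?T. c l *s \<rho> l) \<in> N"
    using c(1) by (intro osub_sum[OF \<open>osub N\<close>] osub_smult[OF \<open>osub N\<close>]) (auto simp: \<O>_iff)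
  moreover have "(\<Sum>l\<in>T. c l *s \<rho> l) = (\<Sum>l\<in>T - ?T. c l *s \<rho> l) + (\<Sum>l\<in>?T. c l *s \<rho> l)"
    using fin by (intro sum.subset_diff) auto
  ultimately have "(\<Sum>l\<in>?T. c l *s \<rho> l) \<in> N"
    using osub_diff[OF \<open>osub N\<close>, of "\<Sum>l\<in>T. c l *s \<rho> l" "\<Sum>l\<in>T - ?T. c l *s \<rho> l"] c(2) \<open>M \<subseteq> N\<close>
    by auto
  then show ?thesis unfolding circ_def using fin ne c(1) by auto
qed

lemma not_circ_singleton: "osub M \<Longrightarrow> \<not> circ M {l}"
  unfolding circ_def by (auto simp: osub_unit_iff)

text \<open>At a maximal level carrying a relation, \<open>circ_enlarge\<close> rules out lines
  outside a larger member of the family. For a chain the relation therefore lives in one successive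
  quotient.\<close>

lemma dep_maximal:
  assumes "finite \<L>" "\<And>M. M \<in> \<L> \<Longrightarrow> between M" "dep \<L> S"
  obtains M T where "M \<in> \<L>" "T \<subseteq> S" "circ M T" "\<And>N l. N \<in> \<L> \<Longrightarrow> M \<subset> N \<Longrightarrow> l \<in> T \<Longrightarrow> \<rho> l \<in> N"
proof -
  define \<K> where "\<K> = {M \<in> \<L>. \<exists>T\<subseteq>S. circ M T}"
  have "finite \<K>" "\<K> \<noteq> {}" using assms by (auto simp: \<K>_def dep_def)
  from finite_has_maximal[OF this] obtain M
    where M: "M \<in> \<K>" "\<forall>N\<in>\<K>. M \<subseteq> N \<longrightarrow> M = N" by blast
  then obtain T where T: "T \<subseteq> S" "circ M T" unfolding \<K>_def by blast
  have "\<rho> l \<in> N" if "N \<in> \<L>" "M \<subset> N" "l \<in> T" for N l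
  proof (rule ccontr)
    assume "\<rho> l \<notin> N"
    then have "circ N {l \<in> T. \<rho> l \<notin> N}"
      using that assms(2)[OF that(1)] by (intro circ_enlarge[OF T(2)]) (auto simp: between_def)
    moreover have "{l \<in> T. \<rho> l \<notin> N} \<subseteq> S" using T(1) by blast
    ultimately have "N \<in> \<K>" using that(1) unfolding \<K>_def by (intro CollectI conjI exI)
    then show False using M(2) that(2) by (metis psubsetE order_refl)
  qed
  moreover have "M \<in> \<L>" using M(1) by (simp add: \<K>_def)
  ultimately show ?thesis using that T by metis
qed

text \<open>As V is dependent while V - {x} and V - {y} are independent, the latter two have the
  same closure. The proof is circuit elimination: T runs through x and T' through a; if x also lies
  in T', subtracting a multiple of the relation of T removes x and keeps a.\<close>

lemma dep_exchange:
  assumes \<L>: "finite \<L>" "\<And>M. M \<in> \<L> \<Longrightarrow> between M" "\<And>M N. M \<in> \<L> \<Longrightarrow> N \<in> \<L> \<Longrightarrow> M \<subseteq> N \<or> N \<subseteq> M"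
    and V: "finite V" "V \<subseteq> A" "dep \<L> V"
    and x: "x \<in> V" "\<not> dep \<L> (V - {x})" and y: "\<not> dep \<L> (V - {y})"
    and a: "a \<in> A" "a \<notin> V" "dep \<L> (insert a (V - {y}))"
  shows "dep \<L> (insert a (V - {x}))"
proof -
  obtain M T where M: "M \<in> \<L>" "T \<subseteq> V" "circ M T" "\<And>N l. N \<in> \<L> \<Longrightarrow> M \<subset> N \<Longrightarrow> l \<in> T \<Longrightarrow> \<rho> l \<in> N"
    using dep_maximal[OF \<L>(1,2) V(3)] by metis
  obtain M' T' where M': "M' \<in> \<L>" "T' \<subseteq> insert a (V - {y})" "circ M' T'"
    "\<And>N l. N \<in> \<L> \<Longrightarrow> M' \<subset> N \<Longrightarrow> l \<in> T' \<Longrightarrow> \<rho> l \<in> N"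
    using dep_maximal[OF \<L>(1,2) a(3)] by metis
  have xT: "x \<in> T"
  proof (rule ccontr)
    assume "x \<notin> T"
    then have "T \<subseteq> V - {x}" using M(2) by blast
    then show False using x(2) M(1,3) unfolding dep_def by blast
  qed
  have aT': "a \<in> T'"
  proof (rule ccontr)
    assume "a \<notin> T'"
    then have "T' \<subseteq> V - {y}" using M'(2) by blast
    then show False using y M'(1,3) unfolding dep_def by blast
  qed
  show ?thesis
  proof (cases "x \<in> T'")
    case False
    then have "T' \<subseteq> insert a (V - {x})" using M'(2) by blast
    then show ?thesis using M'(1,3) unfolding dep_def by blast
  next
    case True
    have "\<rho> x \<notin> M" "\<rho> x \<notin> M'" using xT True M(3) M'(3) by (auto simp: circ_def)
    \<comment> \<open>The lines of T lie in every member larger than the level of T, and likewise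
      for T'. So x can occur in both relations only if the levels agree.\<close>
    then have "\<not> M \<subset> M'" "\<not> M' \<subset> M" using M(4)[OF M'(1) _ xT] M'(4)[OF M(1) _ True] by blast+
    then have MM: "M' = M" using \<L>(3)[OF M(1) M'(1)] by blast
    have bM: "between M" using \<L>(2) M(1) by blast
    then have oM: "osub M" by (simp add: between_def)
    obtain c where c: "\<forall>l\<in>T. av (c l) = 1" "(\<Sum>l\<in>T. c l *s \<rho> l) \<in> M"
      using M(3) by (auto simp: circ_def)
    obtain d where d: "\<forall>l\<in>T'. av (d l) = 1" "(\<Sum>l\<in>T'. d l *s \<rho> l) \<in> M"
      using M'(3) MM by (auto simp: circ_def)
    \<comment> \<open>Chosen to cancel the coefficient of x. It is a unit, so all coefficients stay
      integral, and a, which lies outside T, keeps its unit coefficient.\<close>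
    let ?q = "d x / c x"
    define e where "e l = (if l \<in> T' then d l else 0) - ?q * (if l \<in> T then c l else 0)" for l
    define S where "S = insert a V"
    have fS: "finite S" "T \<subseteq> S" "T' \<subseteq> S" "S \<subseteq> A"
      using V M(2) M'(2) a(1) by (auto simp: S_def)
    have q: "av ?q = 1" using c(1) d(1) xT True by (simp add: av_divide)
    have "(\<Sum>l\<in>S. e l *s \<rho> l)
        = (\<Sum>l\<in>S. if l \<in> T' then d l *s \<rho> l else 0) - ?q *s (\<Sum>l\<in>S. if l \<in> T then c l *s \<rho> l else 0)"
      unfolding vec.scale_sum_right sum_subtractf[symmetric] e_def
      by (intro sum.cong) (auto simp: vec.scale_left_diff_distrib)
    also have "\<dots> = (\<Sum>l\<in>T'. d l *s \<rho> l) - ?q *s (\<Sum>l\<in>T. c l *s \<rho> l)"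
      using fS by (simp add: sum.inter_restrict[symmetric] Int_absorb1)
    also have "\<dots> \<in> M"
      using q c(2) d(2) by (intro osub_diff[OF oM] osub_smult[OF oM]) (auto simp: \<O>_iff)
    finally have eM: "(\<Sum>l\<in>S. e l *s \<rho> l) \<in> M" .
    have "c x \<noteq> 0" using c(1) xT by auto
    then have ex: "e x = 0" using xT True by (simp add: e_def)
    have "a \<noteq> x" using a(2) x(1) by blast
    have "a \<notin> T" using a(2) M(2) by blast
    then have ea: "av (e a) = 1" using d(1) aT' by (simp add: e_def)
    have "\<rho> a \<notin> M" using M'(3) MM aT' by (auto simp: circ_def)
    moreover have "(\<Sum>l\<in>S - {x}. e l *s \<rho> l) = (\<Sum>l\<in>S. e l *s \<rho> l)"
      using fS(1) ex by (intro sum.mono_neutral_left) auto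
    moreover have "e l \<in> \<O>" for l
      unfolding e_def using c(1) d(1) q by (intro \<O>_diff \<O>_mult) (auto simp: \<O>_iff)
    ultimately have "circ M {l \<in> S - {x}. av (e l) = 1 \<and> \<rho> l \<notin> M}"
      using fS ea eM \<open>a \<noteq> x\<close> by (intro circ_generalI[OF bM, of _ _ a]) (auto simp: S_def)
    moreover have "{l \<in> S - {x}. av (e l) = 1 \<and> \<rho> l \<notin> M} \<subseteq> insert a (V - {x})"
      using \<open>a \<noteq> x\<close> by (auto simp: S_def)
    ultimately show ?thesis using M(1) unfolding dep_def by blast
  qed
qed

lemma upclosed_dep_words: "upclosed A (dep_words \<L>)"
  unfolding upclosed_def dep_words_def by (auto intro: dep_mono)

text \<open>The dependence of \<open>v\<close> may come from a repeated letter; then both deletions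
  have all letters of \<open>v\<close>, and their closures agree trivially. Otherwise this is
  \<open>dep_exchange\<close>.\<close>

lemma dep_words_exchange:
  assumes \<L>: "finite \<L>" "\<And>M. M \<in> \<L> \<Longrightarrow> between M" "\<And>M N. M \<in> \<L> \<Longrightarrow> N \<in> \<L> \<Longrightarrow> M \<subseteq> N \<or> N \<subseteq> M"
    and v: "v \<in> dep_words \<L>" "i < length v" "j < length v"
      "remove_nth i v \<notin> dep_words \<L>" "remove_nth j v \<notin> dep_words \<L>"
    and a: "a \<in> A" "a # remove_nth j v \<in> dep_words \<L>"
  shows "a # remove_nth i v \<in> dep_words \<L>"
proof -
  have vA: "v \<in> lists A" using v(1) by (simp add: dep_words_def)
  have rA: "remove_nth i v \<in> lists A" "remove_nth j v \<in> lists A"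
    using remove_nth_in_lists[OF vA] by auto
  have d: "distinct (remove_nth i v)" "distinct (remove_nth j v)"
    and nd: "\<not> dep \<L> (set (remove_nth i v))" "\<not> dep \<L> (set (remove_nth j v))"
    using v rA by (auto simp: dep_words_def)
  show ?thesis
  proof (cases "distinct v")
    case False
    then have "set (remove_nth i v) = set (remove_nth j v)"
      using set_remove_nth_repeated[OF False] d v by simp
    then show ?thesis using a(2) rA d by (simp add: dep_words_def)
  next
    case True
    note set = set_remove_nth_distinct[OF True v(2)] set_remove_nth_distinct[OF True v(3)]
    have dv: "dep \<L> (set v)" using v(1) True by (simp add: dep_words_def)
    have vi: "v ! i \<in> set v" using v(2) by simp
    consider "a \<in> set (remove_nth i v)" | "a = v ! i" | "a \<notin> set v" "a \<noteq> v ! i" using set by blast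
    then have "a \<in> set (remove_nth i v) \<or> dep \<L> (insert a (set (remove_nth i v)))"
    proof cases
      case 2
      then have "insert a (set (remove_nth i v)) = set v" using set vi by auto
      then show ?thesis using dv by simp
    next
      case 3
      then have "dep \<L> (insert a (set (remove_nth j v)))"
        using a(2) d set by (auto simp: dep_words_def)
      then show ?thesis
        using dep_exchange[OF \<L>, of "set v" "v ! i" "v ! j" a] vA dv vi nd a(1) 3 set by auto
    qed simp
    then show ?thesis using rA a(1) by (auto simp: dep_words_def)
  qed
qed

text \<open>The chosen letter depends only on the predicate of lying in the closure. Equality of
  closures, which is \<open>dep_words_exchange\<close> in both directions, therefore gives equality
  of the choices.\<close>

lemma straightening_dep_words:
  assumes \<L>: "finite \<L>" "\<And>M. M \<in> \<L> \<Longrightarrow> between M" "\<And>M N. M \<in> \<L> \<Longrightarrow> N \<in> \<L> \<Longrightarrow> M \<subseteq> N \<or> N \<subseteq> M"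
  shows "straightening A B (dep_words \<L>) (\<lambda>v. SOME a. a \<in> A - B \<and> a # v \<in> dep_words \<L>)"
proof
  show "upclosed A (dep_words \<L>)" by (rule upclosed_dep_words)
  show "[] \<notin> dep_words \<L>" by (auto simp: dep_words_def dep_def circ_def)
  show "[a] \<notin> dep_words \<L>" if "a \<in> A - B" for a
  proof
    assume "[a] \<in> dep_words \<L>"
    then obtain M T where "M \<in> \<L>" "T \<subseteq> {a}" "circ M T" by (auto simp: dep_words_def dep_def)
    moreover from this have "T = {a}" by (auto simp: circ_def)
    ultimately show False using not_circ_singleton[of M a] \<L>(2)[of M] by (simp add: between_def)
  qed
  show "w \<in> dep_words \<L>" if "w \<in> lists A" "filter (\<lambda>a. a \<notin> B) w \<in> dep_words \<L>" for w
    using that by (auto simp: dep_words_def intro: dep_mono)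
next
  fix v assume v: "v \<in> lists (A - B)" "v \<noteq> []"
  \<comment> \<open>A repeated letter makes a word dependent, so the first letter already lies in
    the closure.\<close>
  then have "hd v \<in> A - B \<and> hd v # v \<in> dep_words \<L>" by (cases v) (auto simp: dep_words_def)
  then have "(SOME a. a \<in> A - B \<and> a # v \<in> dep_words \<L>) \<in> A - B \<and>
      (SOME a. a \<in> A - B \<and> a # v \<in> dep_words \<L>) # v \<in> dep_words \<L>"
    by (rule someI)
  then show "(SOME a. a \<in> A - B \<and> a # v \<in> dep_words \<L>) \<in> A - B"
    "(SOME a. a \<in> A - B \<and> a # v \<in> dep_words \<L>) # v \<in> dep_words \<L>" by blast+
next
  fix v i j
  assume "v \<in> dep_words \<L>" "i < length v" "j < length v"
    "remove_nth i v \<notin> dep_words \<L>" "remove_nth j v \<notin> dep_words \<L>"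
  then have "(a \<in> A - B \<and> a # remove_nth i v \<in> dep_words \<L>) = (a \<in> A - B \<and> a # remove_nth j v \<in> dep_words \<L>)" for a
    using dep_words_exchange[OF \<L>, of v i j a] dep_words_exchange[OF \<L>, of v j i a] by blast
  then show "(SOME a. a \<in> A - B \<and> a # remove_nth i v \<in> dep_words \<L>)
      = (SOME a. a \<in> A - B \<and> a # remove_nth j v \<in> dep_words \<L>)" by simp
qed

text \<open>\<open>\<B>\<close> represents the simplex \<open>\<eta>\<close>, the \<open>U \<in> \<M>\<close> represent the vertices of a stable set.\<close>

lemma glue_dep_words:
  fixes f :: "('k ^ 'n) set \<Rightarrow> (('k ^ 'n) set list \<Rightarrow>\<^sub>0 'r::{comm_ring, comm_monoid_mult})"
  assumes \<B>: "finite \<B>" "scale_set \<pi> L \<in> \<B>" "\<And>M. M \<in> \<B> \<Longrightarrow> between M"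
      "\<And>M N. M \<in> \<B> \<Longrightarrow> N \<in> \<B> \<Longrightarrow> M \<subseteq> N \<or> N \<subseteq> M"
    and \<M>: "finite \<M>" "\<And>U V. U \<in> \<M> \<Longrightarrow> V \<in> \<M> \<Longrightarrow> U \<inter> V \<in> \<M>" "\<And>U. U \<in> \<M> \<Longrightarrow> between U"
      "\<And>U M. U \<in> \<M> \<Longrightarrow> M \<in> \<B> \<Longrightarrow> M \<noteq> scale_set \<pi> L \<Longrightarrow> U \<subseteq> M"
    and f: "\<And>U. U \<in> \<M> \<Longrightarrow> f U \<in> polys A"
      "\<And>U V. U \<in> \<M> \<Longrightarrow> V \<in> \<M> \<Longrightarrow> V \<subset> U \<Longrightarrow>
        f U - f V \<in> dep_ideal (dep_words (insert U \<B>) \<union> dep_words (insert V \<B>))"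
  shows "\<exists>g\<in>polys A. \<forall>U\<in>\<M>. g - f U \<in> dep_ideal (dep_words (insert U \<B>))"
proof (rule glue[where B = "\<lambda>U. {l. \<rho> l \<in> U}" and f = f and D = "\<lambda>U. dep_words (insert U \<B>)"])
  have \<pi>_sub: "scale_set \<pi> L \<subseteq> U" if "U \<in> \<M>" for U using \<M>(3)[OF that] by (simp add: between_def)
  fix U assume U: "U \<in> \<M>"
  show "straightening A {l. \<rho> l \<in> U} (dep_words (insert U \<B>))
      (\<lambda>v. SOME a. a \<in> A - {l. \<rho> l \<in> U} \<and> a # v \<in> dep_words (insert U \<B>))"
  proof (rule straightening_dep_words)
    show "finite (insert U \<B>)" using \<B>(1) by simp
    show "between M" if "M \<in> insert U \<B>" for M using that \<B>(3) \<M>(3) U by blast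
    show "M \<subseteq> N \<or> N \<subseteq> M" if "M \<in> insert U \<B>" "N \<in> insert U \<B>" for M N
      using that \<B>(4) \<M>(4)[OF U] \<pi>_sub[OF U] by (metis insertE order_refl)
  qed
  fix W w assume W: "W \<in> \<M>" "W \<subset> U" and w: "w \<in> dep_words (insert U \<B>) \<union> dep_words (insert W \<B>)"
  let ?o = "filter (\<lambda>a. a \<notin> {l. \<rho> l \<in> U}) w" and ?i = "filter (\<lambda>a. a \<in> {l. \<rho> l \<in> U}) w"
  have wA: "w \<in> lists A" "?o \<in> lists A" "?i \<in> lists A" using w by (auto simp: dep_words_def)
  show "?o \<in> dep_words (insert U \<B>) \<or> ?i \<in> dep_words (insert W \<B>)"
  proof (cases "distinct w")
    case False
    then have "\<not> distinct ?i \<or> \<not> distinct ?o"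
      using distinct_filter_partition[of "\<lambda>a. a \<in> {l. \<rho> l \<in> U}" w] by blast
    then show ?thesis using wA by (auto simp: dep_words_def)
  next
    case True
    then obtain M T where M: "M \<in> insert U (insert W \<B>)" "T \<subseteq> set w" "circ M T"
      using w by (auto simp: dep_words_def dep_def)
    have outer: "?o \<in> dep_words (insert U \<B>)"
      if "N \<in> insert U \<B>" "S \<subseteq> set w" "circ N S" "\<forall>l\<in>S. \<rho> l \<notin> U" for N S
    proof -
      have "S \<subseteq> set ?o" using that by auto
      then have "dep (insert U \<B>) (set ?o)" using that unfolding dep_def by blast
      then show ?thesis using wA by (simp add: dep_words_def)
    qed
    \<comment> \<open>A relation at a level containing U involves only lines outside U. At a level
      below U, either all lines of T are in U, or those outside U form a relation modulo U.\<close>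
    show ?thesis
    proof (cases "U \<subseteq> M")
      case True
      then have "\<forall>l\<in>T. \<rho> l \<notin> U" using M(3) by (auto simp: circ_def)
      moreover have "M \<in> insert U \<B>" using M(1) True W by blast
      ultimately show ?thesis using outer M by blast
    next
      case False
      then have "M = W \<or> M = scale_set \<pi> L" using M(1) \<M>(4)[OF U] by blast
      then have M': "M \<in> insert W \<B>" "M \<subseteq> U" using \<B>(2) W \<pi>_sub[OF U] by auto
      show ?thesis
      proof (cases "\<forall>l\<in>T. \<rho> l \<in> U")
        case True
        then have "T \<subseteq> set ?i" using M(2) by auto
        then have "dep (insert W \<B>) (set ?i)" using M(3) M' unfolding dep_def by blast
        then show ?thesis using wA by (simp add: dep_words_def)
      next
        case False
        then have "circ U {l \<in> T. \<rho> l \<notin> U}"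
          using \<M>(3)[OF U] by (intro circ_enlarge[OF M(3) M'(2)]) (auto simp: between_def)
        then show ?thesis using outer[of U "{l \<in> T. \<rho> l \<notin> U}"] M(2) by blast
      qed
    qed
  qed
next
  fix U V v assume U: "U \<in> \<M>" and V: "V \<in> \<M>" and v: "v \<in> lists (A \<inter> {l. \<rho> l \<in> U})"
    "v \<in> dep_words (insert (V \<inter> U) \<B>)"
  show "v \<in> dep_words (insert V \<B>)"
  proof (cases "distinct v")
    case False
    then show ?thesis using v by (auto simp: dep_words_def)
  next
    case True
    then obtain M T where M: "M \<in> insert (V \<inter> U) \<B>" "T \<subseteq> set v" "circ M T"
      using v by (auto simp: dep_words_def dep_def)
    \<comment> \<open>For a line in U, lying outside the intersection of V and U means lying outside
      V; the same T is thus a relation at the level V.\<close>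
    have "\<exists>N\<in>insert V \<B>. circ N T"
    proof (cases "M \<in> \<B>")
      case False
      then have "M = V \<inter> U" using M(1) by blast
      moreover have "\<forall>l\<in>T. \<rho> l \<in> U" using M(2) v(1) by auto
      ultimately have "circ V T" using M(3) unfolding circ_def by blast
      then show ?thesis by blast
    qed (use M in blast)
    then have "dep (insert V \<B>) (set v)" using M(2) unfolding dep_def by blast
    then show ?thesis using v by (auto simp: dep_words_def)
  qed
qed (use \<M>(1,2) f in blast)+

end

section \<open>The ideal of a simplex\<close>

definition std_words ::
    "('k::field \<Rightarrow> real) \<Rightarrow> 'k \<Rightarrow> ('k ^ 'n) set set \<Rightarrow> ('k, 'n::finite) vertex \<Rightarrow> ('k ^ 'n) set list set" where
  "std_words av \<pi> A x = {map line as | as. \<exists>L. is_lattice av L \<and> hclass L = x \<and> as \<noteq> [] \<and>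
     set as \<subseteq> L - scale_set \<pi> L \<and> line ` set as \<subseteq> A \<and> dependent_mod av \<pi> L as}"

lemma std_gens_eq: "std_gens av \<pi> A x = (\<lambda>w. ext_delta A (wedge A w)) ` std_words av \<pi> A x"
  unfolding std_gens_def std_words_def by blast

context prime_local_field
begin

lemma primitive_ratio:
  assumes M: "osub M" and "x \<in> M" "x \<notin> scale_set \<pi> M" "y \<in> M" "y \<notin> scale_set \<pi> M" "x = u *s y"
  shows "av u = 1"
proof (rule ccontr)
  assume "av u \<noteq> 1"
  then consider "av u < 1" | "av u > 1" by linarith
  then show False
  proof cases
    case 1
    then show False using nonunit_smult[OF M 1] assms by blast
  next
    case 2
    then have "av (inverse u) < 1" by (simp add: av_inverse inverse_less_1_iff)
    moreover have "u \<noteq> 0" using 2 by auto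
    then have "y = inverse u *s x" using assms by simp
    ultimately show False using nonunit_smult[OF M _ \<open>x \<in> M\<close>] assms by blast
  qed
qed

lemma dependent_mod_scale:
  assumes "c \<noteq> 0"
  shows "dependent_mod av \<pi> (scale_set c M) (map (\<lambda>v. c *s v) as) \<longleftrightarrow> dependent_mod av \<pi> M as"
proof -
  have "(\<Sum>i<length as. b i *s map (\<lambda>v. c *s v) as ! i) \<in> scale_set \<pi> (scale_set c M)
      \<longleftrightarrow> (\<Sum>i<length as. b i *s as ! i) \<in> scale_set \<pi> M" for b
  proof -
    have "(\<Sum>i<length as. b i *s map (\<lambda>v. c *s v) as ! i) = c *s (\<Sum>i<length as. b i *s as ! i)"
      by (simp add: vec.scale_sum_right mult.commute)
    moreover have "scale_set \<pi> (scale_set c M) = scale_set c (scale_set \<pi> M)"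
      by (simp add: scale_set_scale_set mult.commute)
    ultimately show ?thesis using assms by (simp add: in_scale_set_iff)
  qed
  then show ?thesis by (simp add: dependent_mod_def)
qed

lemma nonunit_multiple_iff: "c \<in> (\<lambda>y. \<pi> * y) ` \<O> \<longleftrightarrow> av c < 1"
  by (auto simp: nonunit_iff)

text \<open>A homothety carries generators and relations from any representative of the class to the
  given one.\<close>

lemma std_words_lattice:
  assumes M: "is_lattice av M"
  shows "std_words av \<pi> A (hclass M) = {map line as | as. as \<noteq> [] \<and>
     set as \<subseteq> M - scale_set \<pi> M \<and> line ` set as \<subseteq> A \<and> dependent_mod av \<pi> M as}" (is "?l = ?r")
proof
  show "?r \<subseteq> ?l" unfolding std_words_def using M by blast
  show "?l \<subseteq> ?r"
  proof
    fix w assume "w \<in> ?l"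
    then obtain as M' where w: "w = map line as" "hclass M' = hclass M" "as \<noteq> []"
      "set as \<subseteq> M' - scale_set \<pi> M'" "line ` set as \<subseteq> A" "dependent_mod av \<pi> M' as"
      unfolding std_words_def by blast
    obtain c where c: "c \<noteq> 0" "M = scale_set c M'" using hclass_eqD[OF w(2)] by blast
    let ?bs = "map (\<lambda>v. c *s v) as"
    have "map line ?bs = w" using w(1) by (simp add: line_smult[OF c(1)])
    moreover have "line ` set ?bs \<subseteq> A" using w(5) by (auto simp: image_subset_iff line_smult[OF c(1)])
    moreover have "set ?bs \<subseteq> M - scale_set \<pi> M"
    proof -
      have "scale_set \<pi> M = scale_set c (scale_set \<pi> M')" by (simp add: c(2) scale_set_scale_set mult.commute)
      then show ?thesis using w(4) c by (auto simp: in_scale_set_iff)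
    qed
    moreover have "dependent_mod av \<pi> M ?bs" using w(6) dependent_mod_scale[OF c(1), of M' as] c(2) by simp
    ultimately show "w \<in> ?r" using w(3) by blast
  qed
qed

end

context lattice_lines
begin

text \<open>The primitive generator of the line in \<open>M\<close>. One factor \<pi> suffices
  because \<pi>L \<subseteq> M \<subseteq> L.\<close>

definition \<rho>_in_lattice :: "('k ^ 'n) set \<Rightarrow> ('k ^ 'n) set \<Rightarrow> 'k ^ 'n" where
  "\<rho>_in_lattice M l = (if \<rho> l \<in> M then 1 else \<pi>) *s \<rho> l"

lemma \<rho>_in_lattice:
  assumes M: "between M" and l: "l \<in> A"
  shows "\<rho>_in_lattice M l \<in> M" "\<rho>_in_lattice M l \<notin> scale_set \<pi> M" "line (\<rho>_in_lattice M l) = l"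
proof -
  have M': "scale_set \<pi> L \<subseteq> M" "scale_set \<pi> M \<subseteq> scale_set \<pi> L"
    using M scale_set_mono by (auto simp: between_def)
  have "\<pi> *s \<rho> l \<in> scale_set \<pi> L" using \<rho>_in[OF l] by (auto simp: scale_set_def)
  then show "\<rho>_in_lattice M l \<in> M" using M' by (auto simp: \<rho>_in_lattice_def)
  show "\<rho>_in_lattice M l \<notin> scale_set \<pi> M"
    using M'(2) \<rho>_primitive[OF l] by (auto simp: \<rho>_in_lattice_def in_scale_set_iff)
  show "line (\<rho>_in_lattice M l) = l"
    using line_\<rho>[OF l] line_smult[OF \<pi>_nonzero, of "\<rho> l"] by (simp add: \<rho>_in_lattice_def)
qed

text \<open>A unit coefficient at a line with generator in \<open>M\<close> yields a relation modulo \<open>\<pi>L\<close>; if there is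
  none, the relation can be divided by \<open>\<pi>\<close>.\<close>

lemma dep_of_relation:
  assumes M: "between M" and S: "finite S" "S \<subseteq> A" and k: "\<And>l. l \<in> S \<Longrightarrow> k l \<in> \<O>"
    and unit: "l0 \<in> S" "av (k l0) = 1"
    and sum: "(\<Sum>l\<in>S. k l *s \<rho>_in_lattice M l) \<in> scale_set \<pi> M"
  shows "dep {M, scale_set \<pi> L} S"
proof -
  have M': "osub M" "scale_set \<pi> L \<subseteq> M" "scale_set \<pi> M \<subseteq> scale_set \<pi> L"
    using M scale_set_mono by (auto simp: between_def)
  note o\<pi>L = osub_scale[OF osub_lattice[OF L], of \<pi>]
  define S1 where "S1 = {l \<in> S. \<rho> l \<in> M}"
  show ?thesis
  proof (cases "\<exists>l\<in>S1. av (k l) = 1")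
    case True
    have "k l *s \<rho>_in_lattice M l \<in> scale_set \<pi> L" if l: "l \<in> S - S1" for l
    proof -
      have "k l *s \<rho>_in_lattice M l = \<pi> *s (k l *s \<rho> l)"
        using l by (simp add: \<rho>_in_lattice_def S1_def mult.commute)
      moreover have "k l *s \<rho> l \<in> L" using l k \<rho>_in S(2) by (intro osub_smult osub_lattice[OF L]) auto
      ultimately show ?thesis unfolding scale_set_def by blast
    qed
    then have "(\<Sum>l\<in>S - S1. k l *s \<rho>_in_lattice M l) \<in> scale_set \<pi> L" by (intro osub_sum[OF o\<pi>L])
    moreover have "(\<Sum>l\<in>S. k l *s \<rho>_in_lattice M l)
        = (\<Sum>l\<in>S - S1. k l *s \<rho>_in_lattice M l) + (\<Sum>l\<in>S1. k l *s \<rho>_in_lattice M l)"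
      using S by (intro sum.subset_diff) (auto simp: S1_def)
    ultimately have "(\<Sum>l\<in>S1. k l *s \<rho>_in_lattice M l) \<in> scale_set \<pi> L"
      using osub_diff[OF o\<pi>L, of "\<Sum>l\<in>S. k l *s \<rho>_in_lattice M l"
          "\<Sum>l\<in>S - S1. k l *s \<rho>_in_lattice M l"] sum M'(3) by auto
    moreover have "(\<Sum>l\<in>S1. k l *s \<rho>_in_lattice M l) = (\<Sum>l\<in>S1. k l *s \<rho> l)"
      by (intro sum.cong) (auto simp: S1_def \<rho>_in_lattice_def)
    moreover obtain l1 where l1: "l1 \<in> S1" "av (k l1) = 1" using True by blast
    ultimately have "circ (scale_set \<pi> L) {l \<in> S1. av (k l) = 1 \<and> \<rho> l \<notin> scale_set \<pi> L}"
      using S k \<rho>_primitive by (intro circ_generalI[of _ S1 k l1] between_\<pi>L) (auto simp: S1_def)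
    then show ?thesis unfolding dep_def by (auto simp: S1_def)
  next
    case False
    define k' where "k' l = (if \<rho> l \<in> M then k l / \<pi> else k l)" for l
    have k': "k' l \<in> \<O>" if "l \<in> S" for l
    proof (cases "\<rho> l \<in> M")
      case True
      then have "av (k l) < 1" using False that k[OF that] int_cases[of "k l"] by (auto simp: S1_def)
      then show ?thesis using True by (auto simp: k'_def nonunit_iff)
    qed (use k that in \<open>simp add: k'_def\<close>)
    have "(\<Sum>l\<in>S. k l *s \<rho>_in_lattice M l) = \<pi> *s (\<Sum>l\<in>S. k' l *s \<rho> l)"
      unfolding vec.scale_sum_right by (intro sum.cong) (auto simp: k'_def \<rho>_in_lattice_def mult.commute)
    then have "(\<Sum>l\<in>S. k' l *s \<rho> l) \<in> M" using sum by (simp add: in_scale_set_iff)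
    moreover have "\<rho> l0 \<notin> M" using False unit by (auto simp: S1_def)
    ultimately have "circ M {l \<in> S. av (k' l) = 1 \<and> \<rho> l \<notin> M}"
      using S k' unit by (intro circ_generalI[of M S k' l0] M) (auto simp: k'_def)
    moreover have "{l \<in> S. av (k' l) = 1 \<and> \<rho> l \<notin> M} \<subseteq> S" by blast
    ultimately show ?thesis unfolding dep_def by (intro bexI[of _ M] exI conjI) simp_all
  qed
qed

lemma sum_nth_distinct:
  assumes "distinct w" shows "(\<Sum>i<length w. f (w ! i)) = (\<Sum>l\<in>set w. f l)"
  using sum.reindex_bij_betw[OF bij_betw_nth[OF assms refl refl], of f] by simp

text \<open>A relation modulo \<pi>M with a unit coefficient at a generator in \<open>M\<close>
  shows up modulo \<pi>L rather than modulo \<open>M\<close>. Since \<pi>L represents the vertex of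
  \<open>L\<close>, the extra level is harmless for a simplex containing that vertex.\<close>

lemma std_words_subset:
  assumes M: "between M"
  shows "std_words av \<pi> A (hclass M) \<subseteq> dep_words {M, scale_set \<pi> L}"
proof
  have lM: "is_lattice av M" using M intermediate_lattice[OF L] by (auto simp: between_def)
  fix w assume "w \<in> std_words av \<pi> A (hclass M)"
  then obtain as where as: "w = map line as" "as \<noteq> []" "set as \<subseteq> M - scale_set \<pi> M"
    "line ` set as \<subseteq> A" "dependent_mod av \<pi> M as"
    unfolding std_words_lattice[OF lM] by blast
  have wA: "set w \<subseteq> A" using as by auto
  show "w \<in> dep_words {M, scale_set \<pi> L}"
  proof (cases "distinct w")
    case False
    then show ?thesis using wA by (auto simp: dep_words_def)
  next
    case dist: True
    obtain c where c: "\<And>i. i < length as \<Longrightarrow> c i \<in> \<O>" "\<exists>i<length as. \<not> av (c i) < 1"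
      "(\<Sum>i<length as. c i *s as ! i) \<in> scale_set \<pi> M"
      using as(5) unfolding dependent_mod_def nonunit_multiple_iff by blast
    have len: "length w = length as" using as(1) by simp
    \<comment> \<open>Both vectors generate the same line and are primitive in \<open>M\<close>, so
      their ratio is a unit.\<close>
    have "\<exists>u. av u = 1 \<and> as ! i = u *s \<rho>_in_lattice M (w ! i)" if i: "i < length as" for i
    proof -
      have l: "w ! i \<in> A" using wA i len nth_mem[of i w] by auto
      have a: "as ! i \<in> M" "as ! i \<notin> scale_set \<pi> M" "line (as ! i) = w ! i"
        using as(3) nth_mem[OF i] i by (blast, blast, simp add: as(1))
      have "as ! i \<noteq> 0"
        using a(2) osub_0[OF osub_scale[of M \<pi>]] M by (auto simp: between_def)
      then obtain u where "as ! i = u *s \<rho>_in_lattice M (w ! i)"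
        using line_eqD[of "\<rho>_in_lattice M (w ! i)" "as ! i"] a(3) \<rho>_in_lattice(3)[OF M l] by auto
      then show ?thesis
        using primitive_ratio[OF _ a(1,2) \<rho>_in_lattice(1,2)[OF M l]] M by (auto simp: between_def)
    qed
    then obtain u where u: "\<And>i. i < length as \<Longrightarrow> av (u i) = 1 \<and> as ! i = u i *s \<rho>_in_lattice M (w ! i)"
      by metis
    \<comment> \<open>Standard generators index their coefficients by positions, \<open>circ\<close>
      by lines; as \<open>w\<close> is distinct, one can pass from the former to the latter.\<close>
    define idx where "idx = the_inv_into {..<length w} ((!) w)"
    have idx: "idx (w ! i) = i" if "i < length w" for i
      unfolding idx_def using dist that
      by (intro the_inv_into_f_f) (auto simp: inj_on_def nth_eq_iff_index_eq)
    define k where "k l = c (idx l) * u (idx l)" for l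
    have kw: "k (w ! i) = c i * u i" if "i < length as" for i
      using idx that len by (simp add: k_def)
    have "(\<Sum>l\<in>set w. k l *s \<rho>_in_lattice M l) = (\<Sum>i<length w. k (w ! i) *s \<rho>_in_lattice M (w ! i))"
      by (rule sum_nth_distinct[OF dist, symmetric])
    also have "\<dots> = (\<Sum>i<length as. c i *s as ! i)"
      unfolding len using u kw by (intro sum.cong) auto
    finally have sum: "(\<Sum>l\<in>set w. k l *s \<rho>_in_lattice M l) \<in> scale_set \<pi> M" using c(3) by simp
    have k: "k l \<in> \<O>" if l: "l \<in> set w" for l
    proof -
      obtain i where i: "i < length as" "l = w ! i" using l len by (auto simp: in_set_conv_nth)
      have "k l = c i * u i" using kw[OF i(1)] i(2) by simp
      then show ?thesis using u[OF i(1)] c(1)[OF i(1)] by (simp add: \<O>_iff av_mult)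
    qed
    obtain i where i: "i < length as" "\<not> av (c i) < 1" using c(2) by blast
    then have "av (c i) = 1" using c(1) int_cases by blast
    then have "av (k (w ! i)) = 1" using kw[OF i(1)] u[OF i(1)] by (simp add: av_mult)
    moreover have "w ! i \<in> set w" using i len by simp
    ultimately have "dep {M, scale_set \<pi> L} (set w)"
      using dep_of_relation[OF M _ wA k _ _ sum] by blast
    then show ?thesis using wA by (auto simp: dep_words_def)
  qed
qed

text \<open>The generators \<rho> in a relation modulo \<open>M\<close> lie outside
  \<open>M\<close>, so their primitive versions in \<open>M\<close> carry a factor \<pi>, and \<pi>
  times the relation is one modulo \<pi>M.\<close>

lemma dep_words_subset:
  assumes M: "between M"
  shows "dep_words {M} \<subseteq> std_words av \<pi> A (hclass M)"
proof
  have lM: "is_lattice av M" using M intermediate_lattice[OF L] by (auto simp: between_def)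
  have oM: "osub M" using M by (simp add: between_def)
  fix w assume w: "w \<in> dep_words {M}"
  then have wA: "set w \<subseteq> A" by (auto simp: dep_words_def)
  let ?as = "map (\<rho>_in_lattice M) w"
  have "w \<noteq> []" using w by (auto simp: dep_words_def dep_def circ_def)
  have m: "map line ?as = w" unfolding map_map by (rule map_idI) (use wA \<rho>_in_lattice(3)[OF M] in auto)
  have "dependent_mod av \<pi> M ?as"
  proof (cases "distinct w")
    case False
    then obtain i j where ij: "i < length w" "j < length w" "i \<noteq> j" "w ! i = w ! j"
      by (auto simp: distinct_conv_nth)
    \<comment> \<open>A repeated line has the same generator at both places, and the difference of
      the two terms vanishes.\<close>
    define c where "c t = (if t = i then 1 else 0) - (if t = j then 1 else (0 :: 'k))" for t
    have "(\<Sum>t<length w. c t *s ?as ! t) = (\<Sum>t<length w. if t = i then ?as ! t else 0)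
        - (\<Sum>t<length w. if t = j then ?as ! t else 0)"
      unfolding sum_subtractf[symmetric]
      by (intro sum.cong) (auto simp: c_def vec.scale_left_diff_distrib)
    also have "\<dots> = 0" using ij by simp
    finally have "(\<Sum>t<length ?as. c t *s ?as ! t) \<in> scale_set \<pi> M"
      using osub_0[OF osub_scale[OF oM]] by simp
    moreover have "\<not> av (c i) < 1" using ij by (simp add: c_def)
    moreover have "c t \<in> \<O>" for t by (simp add: c_def)
    ultimately show ?thesis unfolding dependent_mod_def nonunit_multiple_iff using ij(1)
      by (intro exI[of _ c]) auto
  next
    case dist: True
    then obtain T where T: "T \<subseteq> set w" "circ M T" using w by (auto simp: dep_words_def dep_def)
    then obtain c where c: "\<forall>l\<in>T. av (c l) = 1" "(\<Sum>l\<in>T. c l *s \<rho> l) \<in> M" and "T \<noteq> {}"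
      by (auto simp: circ_def)
    define k where "k l = (if l \<in> T then c l else 0)" for l
    have "(\<Sum>i<length ?as. k (w ! i) *s ?as ! i) = (\<Sum>i<length w. k (w ! i) *s \<rho>_in_lattice M (w ! i))"
      by (intro sum.cong) auto
    also have "\<dots> = (\<Sum>l\<in>set w. k l *s \<rho>_in_lattice M l)" by (rule sum_nth_distinct[OF dist])
    also have "\<dots> = (\<Sum>l\<in>T. k l *s \<rho>_in_lattice M l)"
      using T(1) by (intro sum.mono_neutral_right) (auto simp: k_def)
    also have "\<dots> = \<pi> *s (\<Sum>l\<in>T. c l *s \<rho> l)"
      unfolding vec.scale_sum_right
      using T(2) by (intro sum.cong) (auto simp: k_def \<rho>_in_lattice_def circ_def mult.commute)
    also have "\<dots> \<in> scale_set \<pi> M" using c(2) by (auto simp: scale_set_def)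
    finally have sum: "(\<Sum>i<length ?as. k (w ! i) *s ?as ! i) \<in> scale_set \<pi> M" .
    obtain l where "l \<in> T" using \<open>T \<noteq> {}\<close> by blast
    then obtain i where "i < length w" "w ! i \<in> T" using T(1) by (metis in_set_conv_nth subsetD)
    then have "\<exists>i<length ?as. \<not> av (k (w ! i)) < 1" using c(1) by (auto simp: k_def)
    moreover have "k l \<in> \<O>" for l using c(1) by (simp add: k_def \<O>_iff)
    ultimately show ?thesis unfolding dependent_mod_def nonunit_multiple_iff using sum
      by (intro exI[of _ "\<lambda>i. k (w ! i)"]) auto
  qed
  moreover have "set ?as \<subseteq> M - scale_set \<pi> M" using \<rho>_in_lattice(1,2)[OF M] wA by auto
  moreover have "line ` set ?as \<subseteq> A" using wA m by (metis set_map)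
  ultimately show "w \<in> std_words av \<pi> A (hclass M)"
    unfolding std_words_lattice[OF lM] using m \<open>w \<noteq> []\<close>
    by (intro CollectI exI[of _ ?as] conjI) simp_all
qed

text \<open>The bound in \<open>std_words_subset\<close> brings in the level \<pi>L, which is a
  member of the family; together with \<open>dep_words_subset\<close> the two inclusions close
  up.\<close>

lemma std_words_Union:
  assumes "\<And>M. M \<in> \<L> \<Longrightarrow> between M" "scale_set \<pi> L \<in> \<L>"
  shows "(\<Union>x\<in>hclass ` \<L>. std_words av \<pi> A x) = dep_words \<L>"
proof (intro equalityI subsetI)
  fix w assume "w \<in> (\<Union>x\<in>hclass ` \<L>. std_words av \<pi> A x)"
  then obtain M where "M \<in> \<L>" "w \<in> dep_words {M, scale_set \<pi> L}"
    using std_words_subset assms by blast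
  then show "w \<in> dep_words \<L>" using assms(2) by (auto simp: dep_words_def dep_def)
next
  fix w assume "w \<in> dep_words \<L>"
  then have "\<exists>M\<in>\<L>. w \<in> dep_words {M}" using assms(2) by (auto simp: dep_words_def dep_def)
  then show "w \<in> (\<Union>x\<in>hclass ` \<L>. std_words av \<pi> A x)"
    using dep_words_subset assms(1) by blast
qed

end

text \<open>Transfers membership from the exterior to the free algebra. One direction generates
  \<open>dep_ideal D\<close> from boundaries. For the other, the image of \<open>dep_ideal D\<close>
  is an ideal containing all standard generators, and membership pulls back because
  \<open>dep_ideal D\<close> contains the exterior relations.\<close>

lemma simplex_ideal_iff:
  fixes f :: "('k::field ^ 'n::finite) set list \<Rightarrow>\<^sub>0 'r::{comm_ring, comm_monoid_mult}"
  assumes up: "upclosed A D" and D: "(\<Union>x\<in>\<sigma>. std_words av \<pi> A x) = D"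
    and nd: "\<And>w. w \<in> lists A \<Longrightarrow> \<not> distinct w \<Longrightarrow> w \<in> D"
    and f: "f \<in> polys A"
  shows "ext_rel A +>\<^bsub>free_alg A\<^esub> f \<in> simplex_ideal av \<pi> A \<sigma> \<longleftrightarrow> f \<in> dep_ideal D"
proof -
  let ?T = "free_alg A :: (('k ^ 'n) set list \<Rightarrow>\<^sub>0 'r) ring"
  let ?E = "ext_alg A :: (('k ^ 'n) set list \<Rightarrow>\<^sub>0 'r) set ring"
  define q where "q = (\<lambda>f. ext_rel A +>\<^bsub>?T\<^esub> f)"
  define J where "J = (dep_ideal D :: (('k ^ 'n) set list \<Rightarrow>\<^sub>0 'r) set)"
  interpret R: ideal "ext_rel A" ?T by (rule ideal_ext_rel)
  interpret E: ring ?E by (rule ring_ext_alg)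
  interpret S: ideal "simplex_ideal av \<pi> A \<sigma>" ?E by (rule ideal_simplex_ideal)
  have hom: "q \<in> ring_hom ?T ?E" unfolding q_def ext_alg_def by (rule R.rcos_ring_hom)
  have J: "ideal J ?T" unfolding J_def by (rule ideal_dep_ideal[OF up])
  have JT: "J \<subseteq> carrier ?T" using ideal.axioms(1)[OF J] additive_subgroup.a_subset by blast
  have relJ: "ext_rel A \<subseteq> J" unfolding J_def by (rule ext_rel_subset_dep_ideal[OF up nd])
  have DA: "D \<subseteq> lists A" using up by (simp add: upclosed_def)
  have gen: "ext_delta A (wedge A w) = q (fd_word w 1)" if "w \<in> D" for w
  proof -
    have w: "set w \<subseteq> A" using that DA by auto
    then have "word w (1::'r) \<in> carrier ?T" by auto
    from ext_delta_coset[OF this] show ?thesis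
      unfolding q_def wedge_eq_coset[OF w] free_delta_single .
  qed
  have Nil: "[] \<notin> D" using D by (auto simp: std_words_def)
  have delta_in: "q (fd_word w 1) \<in> simplex_ideal av \<pi> A \<sigma>" if "w \<in> D" for w
  proof -
    obtain x where x: "x \<in> \<sigma>" "w \<in> std_words av \<pi> A x" using \<open>w \<in> D\<close> D by blast
    have std: "(std_gens av \<pi> A x :: (('k ^ 'n) set list \<Rightarrow>\<^sub>0 'r) set set) \<subseteq> carrier ?E"
      by (auto simp: std_gens_def intro!: ext_delta_closed wedge_closed)
    have "q (fd_word w 1) \<in> std_gens av \<pi> A x"
      unfolding std_gens_eq gen[OF \<open>w \<in> D\<close>, symmetric] using x(2) by blast
    then have v: "q (fd_word w 1) \<in> vertex_ideal av \<pi> A x"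
      unfolding vertex_ideal_def using E.genideal_self[OF std] by blast
    have "(\<Union>x\<in>\<sigma>. vertex_ideal av \<pi> A x) \<subseteq> carrier ?E"
      using additive_subgroup.a_subset[OF ideal.axioms(1)[OF ideal_vertex_ideal]] by blast
    then show ?thesis
      unfolding simplex_ideal_def using E.genideal_self v x(1) by blast
  qed
  have scale: "q (word u r * g) \<in> simplex_ideal av \<pi> A \<sigma>"
    if "q g \<in> simplex_ideal av \<pi> A \<sigma>" "g \<in> polys A" "u \<in> lists A" for u r g
  proof -
    have u: "word u r \<in> carrier ?T" using that(3) by simp
    have "q (word u r * g) = q (word u r) \<otimes>\<^bsub>?E\<^esub> q g"
      using ring_hom_mult[OF hom u, of g] that(2) by simp
    then show ?thesis using S.I_l_closed[OF that(1) ring_hom_closed[OF hom u]] by simp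
  qed
  have add_in: "q (g + h) \<in> simplex_ideal av \<pi> A \<sigma>"
    if "q g \<in> simplex_ideal av \<pi> A \<sigma>" "q h \<in> simplex_ideal av \<pi> A \<sigma>" "g \<in> polys A" "h \<in> polys A" for g h
  proof -
    have "q (g + h) = q g \<oplus>\<^bsub>?E\<^esub> q h" using ring_hom_add[OF hom, of g h] that by simp
    then show ?thesis using S.a_closed[OF that(1,2)] by simp
  qed
  have "q f \<in> simplex_ideal av \<pi> A \<sigma>" if "f \<in> J" for f
    using that unfolding J_def
  proof (induction rule: dep_ideal.induct)
    case zero
    have "q 0 = \<zero>\<^bsub>?E\<^esub>"
      using ring_hom_zero[OF hom R.ring_axioms E.ring_axioms] by simp
    then show ?case using S.zero_closed by simp
  next
    case (add f g)
    then show ?case using add dep_ideal_in_polys[OF DA] by (intro add_in)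
  next
    case (word w r)
    then obtain a v where w: "w = a # v" using Nil by (cases w) auto
    have aA: "a \<in> A" using word w DA by auto
    have aw: "a # w \<in> D" using upclosed_ConsD[OF up aA word] .
    have *: "fd_word w 1 \<in> polys A" "fd_word (a # w) 1 \<in> polys A"
      using word aw DA by (auto intro!: fd_word_in_polys[simplified])
    \<comment> \<open>The sum equals \<open>word w 1\<close>: a dependent word is recovered from the
      boundaries of \<open>w\<close> and of \<open>a # w\<close>, where \<open>a\<close> is its
      first letter.\<close>
    have "q (fd_word (a # w) 1 + word [a] 1 * fd_word w 1) \<in> simplex_ideal av \<pi> A \<sigma>"
    proof (rule add_in[OF delta_in[OF aw] scale[OF delta_in[OF word] *(1)] *(2)])
      show "word [a] 1 * fd_word w (1::'r) \<in> polys A"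
        by (intro CollectI keys_mult_lists) (use * aA in auto)
    qed (use aA in simp)
    then have "q (word w 1) \<in> simplex_ideal av \<pi> A \<sigma>" by (simp add: fd_word_Cons)
    then have "q (word [] r * word w 1) \<in> simplex_ideal av \<pi> A \<sigma>"
      by (rule scale) (use word DA in auto)
    then show ?case by (simp add: word_mult)
  next
    case (delta w r)
    have "q (word [] r * fd_word w 1) \<in> simplex_ideal av \<pi> A \<sigma>"
      by (rule scale[OF delta_in fd_word_in_polys]) (use delta DA in auto)
    then show ?case by (simp flip: fd_word_scale)
  qed
  moreover have "f \<in> J" if qf: "q f \<in> simplex_ideal av \<pi> A \<sigma>"
  proof -
    have K: "ideal (q ` J) ?E"
    proof (rule idealI[OF ring_ext_alg])
      show "subgroup (q ` J) (add_monoid ?E)"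
      proof -
        have "group_hom (add_monoid ?T) (add_monoid ?E) q"
          using hom R.a_group E.a_group
          by (auto simp: group_hom_def group_hom_axioms_def ring_hom_def hom_def)
        from group_hom.subgroup_img_is_subgroup[OF this]
        show ?thesis using ideal.axioms(1)[OF J] by (simp add: additive_subgroup_def)
      qed
      fix x y assume "x \<in> q ` J" and y: "y \<in> carrier ?E"
      then obtain g where g: "g \<in> J" "x = q g" by blast
      obtain h where h: "h \<in> carrier ?T" "y = q h" using carrier_ext_algE[OF y] unfolding q_def by blast
      have gT: "g \<in> carrier ?T" using g JT by blast
      show "y \<otimes>\<^bsub>?E\<^esub> x \<in> q ` J"
        unfolding g h ring_hom_mult[OF hom h(1) gT, symmetric]
        using ideal.I_l_closed[OF J g(1) h(1)] by blast
      show "x \<otimes>\<^bsub>?E\<^esub> y \<in> q ` J"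
        unfolding g h ring_hom_mult[OF hom gT h(1), symmetric]
        using ideal.I_r_closed[OF J g(1) h(1)] by blast
    qed
    have "std_gens av \<pi> A x \<subseteq> q ` J" if "x \<in> \<sigma>" for x
    proof
      fix g :: "(('k ^ 'n) set list \<Rightarrow>\<^sub>0 'r) set" assume "g \<in> std_gens av \<pi> A x"
      then obtain w where w: "w \<in> std_words av \<pi> A x" "g = ext_delta A (wedge A w)"
        unfolding std_gens_eq by blast
      then have "w \<in> D" using D that by blast
      then show "g \<in> q ` J" using gen w(2) unfolding J_def by (auto intro: dep_ideal.delta)
    qed
    then have "(\<Union>x\<in>\<sigma>. vertex_ideal av \<pi> A x) \<subseteq> q ` J"
      unfolding vertex_ideal_def using E.genideal_minimal[OF K] by blast
    then have "simplex_ideal av \<pi> A \<sigma> \<subseteq> q ` J"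
      unfolding simplex_ideal_def by (rule E.genideal_minimal[OF K])
    then obtain g where g: "g \<in> J" "q f = q g" using qf by blast
    have "f \<in> q f" unfolding q_def using R.a_rcos_self f by simp
    then obtain h where "h \<in> ext_rel A" "f = h + g"
      unfolding g(2) unfolding q_def by (auto simp: a_r_coset_def')
    then show ?thesis using relJ g(1) unfolding J_def by auto
  qed
  ultimately show ?thesis unfolding q_def J_def by blast
qed

section \<open>Exactness in terms of representatives\<close>

definition signed :: "int \<Rightarrow> 'g::ab_group_add \<Rightarrow> 'g" where
  "signed s g = (if s = 1 then g else - g)"

lemma incidence_sign: "incidence lab \<tau> \<tau>' \<in> {1, -1}"
  by (simp add: incidence_def minus_one_power_iff)

text \<open>Exactly one of the two new vertices has the smaller label, and only its insertion shifts
  the other one by a place.\<close>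

lemma incidence_anticommute:
  assumes "finite \<eta>" "z \<notin> \<eta>" "z' \<notin> \<eta>" "z \<noteq> z'" "lab z \<noteq> lab z'"
  shows "incidence lab (insert z (insert z' \<eta>)) (insert z' \<eta>) * incidence lab (insert z' \<eta>) \<eta> =
    - (incidence lab (insert z (insert z' \<eta>)) (insert z \<eta>) * incidence lab (insert z \<eta>) \<eta>)"
proof -
  let ?n = "\<lambda>x. card {w \<in> \<eta>. lab w < lab x}"
  have 1: "incidence lab (insert x \<eta>) \<eta> = (-1) ^ ?n x" if "x \<notin> \<eta>" for x
  proof -
    have "{w \<in> insert x \<eta>. \<exists>v\<in>insert x \<eta> - \<eta>. lab w < lab v} = {w \<in> \<eta>. lab w < lab x}"
      using that by auto
    then show ?thesis by (simp add: incidence_def)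
  qed
  have 2: "incidence lab (insert x (insert y \<eta>)) (insert y \<eta>) = (-1) ^ ((if lab y < lab x then 1 else 0) + ?n x)"
    if "x \<notin> \<eta>" "y \<notin> \<eta>" "x \<noteq> y" for x y
  proof -
    have "{w \<in> insert x (insert y \<eta>). \<exists>v\<in>insert x (insert y \<eta>) - insert y \<eta>. lab w < lab v}
        = (if lab y < lab x then {y} else {}) \<union> {w \<in> \<eta>. lab w < lab x}"
      using that by auto
    then show ?thesis using that assms(1) by (simp add: incidence_def)
  qed
  have "incidence lab (insert z (insert z' \<eta>)) (insert z \<eta>) = (-1) ^ ((if lab z < lab z' then 1 else 0) + ?n z')"
    using 2[of z' z] assms by (simp add: insert_commute)
  then show ?thesis using 1 2[of z z'] assms by (auto simp: power_add)
qed

lemma (in abelian_group) add_pow_sign: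
  "s \<in> {1, -1 :: int} \<Longrightarrow> x \<in> carrier G \<Longrightarrow> [s] \<cdot>\<^bsub>G\<^esub> x = (if s = 1 then x else \<ominus> x)"
  using add.int_pow_1[of x] add.int_pow_neg[of x 1] by auto

lemma (in abelian_monoid) finsum_restrict:
  assumes "finite S" "T \<subseteq> S" "\<And>x. x \<in> S - T \<Longrightarrow> f x = \<zero>" "\<And>x. x \<in> T \<Longrightarrow> f x \<in> carrier G"
  shows "(\<Oplus>x\<in>S. f x) = (\<Oplus>x\<in>T. f x)"
proof -
  have "(\<Oplus>x\<in>T \<union> (S - T). f x) = (\<Oplus>x\<in>T. f x) \<oplus> (\<Oplus>x\<in>S - T. f x)"
    using assms finite_subset by (intro finsum_Un_disjoint) auto
  moreover have "(\<Oplus>x\<in>S - T. f x) = (\<Oplus>x\<in>S - T. \<zero>)"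
    using assms(3) by (intro finsum_cong') auto
  moreover have "T \<union> (S - T) = S" using assms(2) by blast
  moreover have "(\<Oplus>x\<in>T. f x) \<in> carrier G" using assms(4) by (intro finsum_closed) auto
  ultimately show ?thesis by simp
qed

text \<open>Both coefficient systems have the form G/(G \<inter> J(\<sigma>)) for a fixed group
  \<open>G\<close> of representatives, with the canonical projections. Exactness then becomes a
  statement about elements of \<open>G\<close> instead of cosets.\<close>

locale quotients =
  fixes G :: "'g::ab_group_add set" and J :: "('k::field, 'n::finite) vertex set \<Rightarrow> 'g set"
    and F :: "('k, 'n) vertex set \<Rightarrow> ('m, 'b) ring_scheme"
    and r :: "('k, 'n) vertex set \<Rightarrow> ('k, 'n) vertex set \<Rightarrow> 'm \<Rightarrow> 'm"
    and q :: "('k, 'n) vertex set \<Rightarrow> 'g \<Rightarrow> 'm"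
  assumes G0: "0 \<in> G" and G_add: "g \<in> G \<Longrightarrow> h \<in> G \<Longrightarrow> g + h \<in> G" and G_minus: "g \<in> G \<Longrightarrow> - g \<in> G"
    and F: "abelian_group (F \<sigma>)"
    and q_closed: "g \<in> G \<Longrightarrow> q \<sigma> g \<in> carrier (F \<sigma>)"
    and q_add: "g \<in> G \<Longrightarrow> h \<in> G \<Longrightarrow> q \<sigma> (g + h) = q \<sigma> g \<oplus>\<^bsub>F \<sigma>\<^esub> q \<sigma> h"
    and q_surj: "x \<in> carrier (F \<sigma>) \<Longrightarrow> \<exists>g\<in>G. x = q \<sigma> g"
    and q_kernel: "g \<in> G \<Longrightarrow> q \<sigma> g = \<zero>\<^bsub>F \<sigma>\<^esub> \<longleftrightarrow> g \<in> J \<sigma>"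
    and res: "g \<in> G \<Longrightarrow> \<tau> \<subseteq> \<sigma> \<Longrightarrow> r \<tau> \<sigma> (q \<tau> g) = q \<sigma> g"
begin

lemma q_0: "q \<sigma> 0 = \<zero>\<^bsub>F \<sigma>\<^esub>"
proof -
  interpret abelian_group "F \<sigma>" by (rule F)
  have "q \<sigma> 0 \<oplus>\<^bsub>F \<sigma>\<^esub> q \<sigma> 0 = q \<sigma> 0 \<oplus>\<^bsub>F \<sigma>\<^esub> \<zero>\<^bsub>F \<sigma>\<^esub>"
    using q_add[OF G0 G0, of \<sigma>] q_closed[OF G0, of \<sigma>] by simp
  then show ?thesis using q_closed[OF G0, of \<sigma>] by simp
qed

lemma G_signed: "g \<in> G \<Longrightarrow> signed s g \<in> G"
  by (simp add: signed_def G_minus)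

lemma q_signed:
  assumes "s \<in> {1, -1}" "g \<in> G" shows "[s] \<cdot>\<^bsub>F \<sigma>\<^esub> q \<sigma> g = q \<sigma> (signed s g)"
proof -
  interpret abelian_group "F \<sigma>" by (rule F)
  have "q \<sigma> (- g) \<oplus>\<^bsub>F \<sigma>\<^esub> q \<sigma> g = \<zero>\<^bsub>F \<sigma>\<^esub>"
    using q_add[of "- g" g \<sigma>] assms(2) G_minus q_0 by simp
  then have "\<ominus>\<^bsub>F \<sigma>\<^esub> q \<sigma> g = q \<sigma> (- g)"
    using assms(2) G_minus by (intro minus_equality q_closed)
  then show ?thesis
    using add_pow_sign[OF assms(1) q_closed[OF assms(2)]] by (simp add: signed_def)
qed

lemma q_cong:
  assumes "g \<in> G" "h \<in> G" "g - h \<in> J \<sigma>" shows "q \<sigma> g = q \<sigma> h"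
proof -
  interpret abelian_group "F \<sigma>" by (rule F)
  have "g - h \<in> G" using G_add[OF assms(1) G_minus[OF assms(2)]] by simp
  then have "q \<sigma> (g - h + h) = \<zero>\<^bsub>F \<sigma>\<^esub> \<oplus>\<^bsub>F \<sigma>\<^esub> q \<sigma> h"
    using assms q_kernel q_add by metis
  then show ?thesis using q_closed[OF assms(2)] by simp
qed

lemma J_minus:
  assumes "g \<in> G" "- g \<in> J \<sigma>" shows "g \<in> J \<sigma>"
  using q_cong[of 0 g \<sigma>] q_kernel[OF assms(1), of \<sigma>] q_0[of \<sigma>] assms G0 by simp

lemma restriction_of_zero:
  assumes "\<tau> \<subseteq> \<sigma>" "s \<in> {1, -1 :: int}"
  shows "[s] \<cdot>\<^bsub>F \<sigma>\<^esub> r \<tau> \<sigma> \<zero>\<^bsub>F \<tau>\<^esub> = \<zero>\<^bsub>F \<sigma>\<^esub>"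
  unfolding q_0[symmetric] res[OF G0 assms(1)] q_signed[OF assms(2) G0] by (simp add: signed_def)

text \<open>By the convention of extension by zero the cochain vanishes on all faces other than
  \<eta>.\<close>

lemma coboundary_from_one_face:
  assumes \<eta>: "\<eta> \<in> simplices av \<pi> (k - 1)" "finite \<eta>" "z \<notin> \<eta>"
    and b: "b \<in> cochains F {\<eta>}" "b \<eta> = q \<eta> g" "g \<in> G"
  shows "coboundary av \<pi> lab F r k b (insert z \<eta>)
    = q (insert z \<eta>) (signed (incidence lab (insert z \<eta>) \<eta>) g)"
proof -
  let ?\<tau> = "insert z \<eta>"
  let ?S = "{\<tau>' \<in> simplices av \<pi> (k - 1). \<tau>' \<subset> ?\<tau>}"
  let ?t = "\<lambda>\<tau>'. [incidence lab ?\<tau> \<tau>'] \<cdot>\<^bsub>F ?\<tau>\<^esub> r \<tau>' ?\<tau> (b \<tau>')"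
  interpret abelian_group "F ?\<tau>" by (rule F)
  have t: "?t \<eta> = q ?\<tau> (signed (incidence lab ?\<tau> \<eta>) g)"
    unfolding b(2) using res[OF b(3), of \<eta> ?\<tau>] q_signed[OF incidence_sign b(3)] by (simp add: subset_insertI)
  then have c: "?t \<eta> \<in> carrier (F ?\<tau>)" using q_closed G_signed b(3) by simp
  have "(\<Oplus>\<^bsub>F ?\<tau>\<^esub>\<tau>'\<in>?S. ?t \<tau>') = (\<Oplus>\<^bsub>F ?\<tau>\<^esub>\<tau>'\<in>{\<eta>}. ?t \<tau>')"
  proof (rule finsum_restrict)
    show "finite ?S" by (rule finite_subset[of _ "Pow ?\<tau>"]) (use \<eta>(2) in auto)
    show "{\<eta>} \<subseteq> ?S" using \<eta> by auto
    show "?t x \<in> carrier (F ?\<tau>)" if "x \<in> {\<eta>}" for x using that c by simp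
    fix x assume x: "x \<in> ?S - {\<eta>}"
    then have "b x = \<zero>\<^bsub>F x\<^esub>" using b(1) by (simp add: cochains_def)
    then show "?t x = \<zero>\<^bsub>F ?\<tau>\<^esub>" using x restriction_of_zero[OF _ incidence_sign, of x ?\<tau>] by auto
  qed
  also have "\<dots> = ?t \<eta>" using c by simp
  finally show ?thesis unfolding coboundary_def t .
qed

text \<open>Among the proper faces of \<tau>, only those obtained by deleting z or z' have the form
  {y} \<union> \<eta> with y in \<open>M0\<close>.\<close>

lemma coboundary_from_two_faces:
  assumes \<eta>: "finite \<eta>" "\<And>z. z \<in> M0 \<Longrightarrow> z \<notin> \<eta>" "\<And>z. z \<in> M0 \<Longrightarrow> insert z \<eta> \<in> simplices av \<pi> k"
    and z: "z \<in> M0" "z' \<in> M0" "z \<noteq> z'"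
    and c: "c \<in> cochains F {{z} \<union> \<eta> | z. z \<in> M0}"
      "c (insert z \<eta>) = q (insert z \<eta>) g" "c (insert z' \<eta>) = q (insert z' \<eta>) g'" "g \<in> G" "g' \<in> G"
  defines "\<tau> \<equiv> insert z (insert z' \<eta>)"
  shows "coboundary av \<pi> lab F r (k + 1) c \<tau>
    = q \<tau> (signed (incidence lab \<tau> (insert z \<eta>)) g + signed (incidence lab \<tau> (insert z' \<eta>)) g')"
proof -
  let ?S = "{\<tau>' \<in> simplices av \<pi> k. \<tau>' \<subset> \<tau>}"
  let ?t = "\<lambda>\<tau>'. [incidence lab \<tau> \<tau>'] \<cdot>\<^bsub>F \<tau>\<^esub> r \<tau>' \<tau> (c \<tau>')"
  interpret abelian_group "F \<tau>" by (rule F)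
  have ne: "insert z \<eta> \<noteq> insert z' \<eta>" using z \<eta>(2) by blast
  have sub: "insert z \<eta> \<subset> \<tau>" "insert z' \<eta> \<subset> \<tau>" using z \<eta>(2) by (auto simp: \<tau>_def)
  have t: "?t (insert z \<eta>) = q \<tau> (signed (incidence lab \<tau> (insert z \<eta>)) g)"
    "?t (insert z' \<eta>) = q \<tau> (signed (incidence lab \<tau> (insert z' \<eta>)) g')"
    unfolding c(2,3) res[OF c(4) psubset_imp_subset[OF sub(1)]] res[OF c(5) psubset_imp_subset[OF sub(2)]]
    by (rule q_signed[OF incidence_sign c(4)] q_signed[OF incidence_sign c(5)])+
  then have cl: "?t (insert z \<eta>) \<in> carrier (F \<tau>)" "?t (insert z' \<eta>) \<in> carrier (F \<tau>)"
    using q_closed G_signed c(4,5) by simp_all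
  have "(\<Oplus>\<^bsub>F \<tau>\<^esub>\<tau>'\<in>?S. ?t \<tau>') = (\<Oplus>\<^bsub>F \<tau>\<^esub>\<tau>'\<in>{insert z \<eta>, insert z' \<eta>}. ?t \<tau>')"
  proof (rule finsum_restrict)
    show "finite ?S" by (rule finite_subset[of _ "Pow \<tau>"]) (use \<eta>(1) in \<open>auto simp: \<tau>_def\<close>)
    show "{insert z \<eta>, insert z' \<eta>} \<subseteq> ?S" using \<eta>(3) z sub by auto
    show "?t x \<in> carrier (F \<tau>)" if "x \<in> {insert z \<eta>, insert z' \<eta>}" for x using that cl by blast
    fix x assume x: "x \<in> ?S - {insert z \<eta>, insert z' \<eta>}"
    have "x \<notin> {{z} \<union> \<eta> | z. z \<in> M0}"
    proof
      assume "x \<in> {{z} \<union> \<eta> | z. z \<in> M0}"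
      then obtain y where y: "x = insert y \<eta>" "y \<in> M0" by auto
      then have "y \<in> \<tau>" "y \<notin> \<eta>" using x \<eta>(2) by auto
      then show False using x y(1) by (auto simp: \<tau>_def)
    qed
    then have "c x = \<zero>\<^bsub>F x\<^esub>" using c(1) by (simp add: cochains_def)
    then show "?t x = \<zero>\<^bsub>F \<tau>\<^esub>" using x restriction_of_zero[OF _ incidence_sign, of x \<tau>] by auto
  qed
  also have "\<dots> = ?t (insert z \<eta>) \<oplus>\<^bsub>F \<tau>\<^esub> ?t (insert z' \<eta>)"
    using cl ne by simp
  finally show ?thesis unfolding coboundary_def t using q_add G_signed c(4,5) by simp
qed

text \<open>Multiplying the representative at z by the incidence sign of \<eta> in {z} \<union>
  \<eta> turns the cocycle condition into a congruence between two elements and a preimage into one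
  common element, which is what \<open>glue\<close> provides.\<close>

lemma exact_at_middleI:
  assumes \<eta>: "finite \<eta>" "\<eta> \<in> simplices av \<pi> (k - 1)"
    and M0: "\<And>z. z \<in> M0 \<Longrightarrow> z \<notin> \<eta>" "\<And>z. z \<in> M0 \<Longrightarrow> insert z \<eta> \<in> simplices av \<pi> k"
    and lab: "\<And>z z'. z \<in> M0 \<Longrightarrow> z' \<in> M0 \<Longrightarrow> {z, z'} \<in> simplices av \<pi> 1 \<Longrightarrow> z \<noteq> z' \<and> lab z \<noteq> lab z'"
    and glue: "\<And>f. (\<And>z. z \<in> M0 \<Longrightarrow> f z \<in> G) \<Longrightarrow>
      (\<And>z z'. z \<in> M0 \<Longrightarrow> z' \<in> M0 \<Longrightarrow> {z, z'} \<in> simplices av \<pi> 1 \<Longrightarrow>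
        f z - f z' \<in> J (insert z (insert z' \<eta>))) \<Longrightarrow>
      \<exists>g\<in>G. \<forall>z\<in>M0. g - f z \<in> J (insert z \<eta>)"
  shows "exact_at_middle av \<pi> lab F r k {\<eta>} {{z} \<union> \<eta> | z. z \<in> M0}
    {{z, z'} \<union> \<eta> | z z'. z \<in> M0 \<and> z' \<in> M0 \<and> {z, z'} \<in> simplices av \<pi> 1}"
  unfolding exact_at_middle_def
proof (intro ballI)
  fix c assume c: "c \<in> cochains F {{z} \<union> \<eta> | z. z \<in> M0}"
  define s where "s z = incidence lab (insert z \<eta>) \<eta>" for z
  define e where "e z z' = incidence lab (insert z (insert z' \<eta>)) (insert z \<eta>)" for z z'
  have s: "s z \<in> {1, -1}" and e: "e z z' \<in> {1, -1}" for z z'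
    unfolding s_def e_def by (rule incidence_sign)+
  have anti: "e z' z * s z' = - (e z z' * s z)"
    if "z \<in> M0" "z' \<in> M0" "{z, z'} \<in> simplices av \<pi> 1" for z z'
    using incidence_anticommute[of \<eta> z z' lab] lab[OF that] M0(1) that \<eta>(1)
    by (simp add: s_def e_def insert_commute)
  have cob: "coboundary av \<pi> lab F r (k + 1) c (insert z (insert z' \<eta>))
      = q (insert z (insert z' \<eta>)) (signed (e z z') g + signed (e z' z) g')"
    if "z \<in> M0" "z' \<in> M0" "{z, z'} \<in> simplices av \<pi> 1" "c (insert z \<eta>) = q (insert z \<eta>) g"
      "c (insert z' \<eta>) = q (insert z' \<eta>) g'" "g \<in> G" "g' \<in> G" for z z' g g'
    using coboundary_from_two_faces[OF \<eta>(1) M0(1,2) that(1,2) _ c that(4-7), of lab] lab[OF that(1-3)]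
    by (simp add: e_def insert_commute)
  show "(\<forall>\<tau>\<in>{{z, z'} \<union> \<eta> | z z'. z \<in> M0 \<and> z' \<in> M0 \<and> {z, z'} \<in> simplices av \<pi> 1}.
        coboundary av \<pi> lab F r (k + 1) c \<tau> = \<zero>\<^bsub>F \<tau>\<^esub>) \<longleftrightarrow>
      (\<exists>b\<in>cochains F {\<eta>}. \<forall>\<tau>\<in>{{z} \<union> \<eta> | z. z \<in> M0}. coboundary av \<pi> lab F r k b \<tau> = c \<tau>)"
    (is "?l \<longleftrightarrow> ?r")
  proof
    assume ?r
    then obtain b where b: "b \<in> cochains F {\<eta>}"
      and bc: "\<And>z. z \<in> M0 \<Longrightarrow> coboundary av \<pi> lab F r k b (insert z \<eta>) = c (insert z \<eta>)"
      by auto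
    obtain g where g: "g \<in> G" "b \<eta> = q \<eta> g"
      using q_surj[of "b \<eta>" \<eta>] b by (auto simp: cochains_def)
    have cz: "c (insert z \<eta>) = q (insert z \<eta>) (signed (s z) g)" if "z \<in> M0" for z
      using coboundary_from_one_face[OF \<eta>(2,1) M0(1)[OF that] b g(2,1), of lab] bc[OF that]
      by (simp add: s_def)
    show ?l
    proof
      fix \<tau> assume "\<tau> \<in> {{z, z'} \<union> \<eta> | z z'. z \<in> M0 \<and> z' \<in> M0 \<and> {z, z'} \<in> simplices av \<pi> 1}"
      then obtain z z' where z: "\<tau> = insert z (insert z' \<eta>)" "z \<in> M0" "z' \<in> M0" "{z, z'} \<in> simplices av \<pi> 1"
        by auto
      \<comment> \<open>The vanishing of the double coboundary, already at the level of
        representatives.\<close>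
      have "signed (e z z') (signed (s z) g) + signed (e z' z) (signed (s z') g) = 0"
        using anti[OF z(2-4)] s[of z] s[of z'] e[of z z'] e[of z' z] by (auto simp: signed_def)
      then show "coboundary av \<pi> lab F r (k + 1) c \<tau> = \<zero>\<^bsub>F \<tau>\<^esub>"
        unfolding z(1) cob[OF z(2-4) cz[OF z(2)] cz[OF z(3)] G_signed[OF g(1)] G_signed[OF g(1)]]
        by (simp add: q_0)
    qed
  next
    assume l: ?l
    have "\<exists>g\<in>G. c (insert z \<eta>) = q (insert z \<eta>) g" if "z \<in> M0" for z
      using q_surj[of "c (insert z \<eta>)"] c that by (auto simp: cochains_def)
    then obtain f where f: "\<And>z. z \<in> M0 \<Longrightarrow> f z \<in> G" "\<And>z. z \<in> M0 \<Longrightarrow> c (insert z \<eta>) = q (insert z \<eta>) (f z)"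
      by metis
    have "\<exists>g\<in>G. \<forall>z\<in>M0. g - signed (s z) (f z) \<in> J (insert z \<eta>)"
    proof (rule glue)
      show "signed (s z) (f z) \<in> G" if "z \<in> M0" for z using G_signed f(1) that by blast
      fix z z' assume z: "z \<in> M0" "z' \<in> M0" "{z, z'} \<in> simplices av \<pi> 1"
      let ?\<tau> = "insert z (insert z' \<eta>)"
      let ?h = "signed (s z) (f z) - signed (s z') (f z')"
      have hG: "?h \<in> G" using G_add[OF G_signed G_minus[OF G_signed]] f(1) z by simp
      have "coboundary av \<pi> lab F r (k + 1) c ?\<tau> = \<zero>\<^bsub>F ?\<tau>\<^esub>"
        using l z by auto
      then have "q ?\<tau> (signed (e z z') (f z) + signed (e z' z) (f z')) = \<zero>\<^bsub>F ?\<tau>\<^esub>"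
        using cob[OF z f(2)[OF z(1)] f(2)[OF z(2)] f(1)[OF z(1)] f(1)[OF z(2)]] by simp
      moreover have "signed (e z z') (f z) + signed (e z' z) (f z') = signed (e z z' * s z) ?h"
        using anti[OF z] s[of z] s[of z'] e[of z z'] e[of z' z] by (auto simp: signed_def)
      ultimately have "signed (e z z' * s z) ?h \<in> J ?\<tau>"
        using q_kernel[OF G_signed[OF hG]] by simp
      then show "?h \<in> J ?\<tau>"
        using J_minus[OF hG, of ?\<tau>] by (simp add: signed_def split: if_splits)
    qed
    then obtain g where g: "g \<in> G" "\<And>z. z \<in> M0 \<Longrightarrow> g - signed (s z) (f z) \<in> J (insert z \<eta>)" by blast
    define b where "b = (\<lambda>\<sigma>. if \<sigma> = \<eta> then q \<eta> g else \<zero>\<^bsub>F \<sigma>\<^esub>)"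
    have b: "b \<in> cochains F {\<eta>}" "b \<eta> = q \<eta> g" using q_closed[OF g(1)] by (auto simp: b_def cochains_def)
    have "coboundary av \<pi> lab F r k b (insert z \<eta>) = c (insert z \<eta>)" if z: "z \<in> M0" for z
    proof -
      have "coboundary av \<pi> lab F r k b (insert z \<eta>) = q (insert z \<eta>) (signed (s z) g)"
        using coboundary_from_one_face[OF \<eta>(2,1) M0(1)[OF z] b g(1), of lab] by (simp add: s_def)
      also have "\<dots> = [s z] \<cdot>\<^bsub>F (insert z \<eta>)\<^esub> q (insert z \<eta>) g" by (rule q_signed[OF s g(1), symmetric])
      also have "q (insert z \<eta>) g = q (insert z \<eta>) (signed (s z) (f z))"
        using q_cong g G_signed f(1) z by blast
      also have "[s z] \<cdot>\<^bsub>F (insert z \<eta>)\<^esub> \<dots> = q (insert z \<eta>) (signed (s z) (signed (s z) (f z)))"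
        by (rule q_signed[OF s G_signed[OF f(1)[OF z]]])
      also have "signed (s z) (signed (s z) (f z)) = f z" by (simp add: signed_def)
      finally show ?thesis using f(2)[OF z] by simp
    qed
    then show ?r using b(1) by auto
  qed
qed

end

section \<open>The systems as quotients of the free algebra\<close>

lemma quotient_by_subgroup:
  fixes H :: "'g ring"
  assumes H: "abelian_group H" and I: "additive_subgroup I H"
  shows "abelian_group (H Quot I)"
    and "g \<in> carrier H \<Longrightarrow> I +>\<^bsub>H\<^esub> g \<in> carrier (H Quot I)"
    and "g \<in> carrier H \<Longrightarrow> h \<in> carrier H \<Longrightarrow>
      (I +>\<^bsub>H\<^esub> g) \<oplus>\<^bsub>H Quot I\<^esub> (I +>\<^bsub>H\<^esub> h) = I +>\<^bsub>H\<^esub> (g \<oplus>\<^bsub>H\<^esub> h)"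
    and "c \<in> carrier (H Quot I) \<Longrightarrow> \<exists>g\<in>carrier H. c = I +>\<^bsub>H\<^esub> g"
    and "g \<in> carrier H \<Longrightarrow> I +>\<^bsub>H\<^esub> g = \<zero>\<^bsub>H Quot I\<^esub> \<longleftrightarrow> g \<in> I"
proof -
  interpret H: abelian_group H by (rule H)
  interpret I: additive_subgroup I H by (rule I)
  have S: "abelian_subgroup I H" by (intro abelian_subgroupI3 I H)
  show "abelian_group (H Quot I)"
    using ccs.grp[OF quot_system_ccs[OF H, of "\<lambda>_. I" UNIV]] I by simp
  show "g \<in> carrier H \<Longrightarrow> I +>\<^bsub>H\<^esub> g \<in> carrier (H Quot I)"
    "c \<in> carrier (H Quot I) \<Longrightarrow> \<exists>g\<in>carrier H. c = I +>\<^bsub>H\<^esub> g"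
    by (auto simp: FactRing_def A_RCOSETS_def')
  show "g \<in> carrier H \<Longrightarrow> h \<in> carrier H \<Longrightarrow>
      (I +>\<^bsub>H\<^esub> g) \<oplus>\<^bsub>H Quot I\<^esub> (I +>\<^bsub>H\<^esub> h) = I +>\<^bsub>H\<^esub> (g \<oplus>\<^bsub>H\<^esub> h)"
    using abelian_subgroup.a_rcos_sum[OF S] by (simp add: FactRing_def)
  show "I +>\<^bsub>H\<^esub> g = \<zero>\<^bsub>H Quot I\<^esub> \<longleftrightarrow> g \<in> I" if g: "g \<in> carrier H"
  proof -
    have "\<zero>\<^bsub>H Quot I\<^esub> = I" by (simp add: FactRing_def)
    moreover have "g \<in> I +>\<^bsub>H\<^esub> g" using abelian_subgroup.a_rcos_self[OF S g] .
    moreover have "I +>\<^bsub>H\<^esub> g = I" if "g \<in> I"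
      using abelian_subgroup.a_rcos_const[OF S that] .
    ultimately show ?thesis by auto
  qed
qed

lemma coset_add_subgroup:
  fixes H :: "'g ring"
  assumes H: "abelian_group H" and I: "additive_subgroup I H" "additive_subgroup I' H" "I \<subseteq> I'"
    and g: "g \<in> carrier H"
  shows "(I +>\<^bsub>H\<^esub> g) <+>\<^bsub>H\<^esub> I' = I' +>\<^bsub>H\<^esub> g"
proof -
  interpret H: abelian_group H by (rule H)
  interpret I: additive_subgroup I H by (rule I)
  interpret I': additive_subgroup I' H by (rule I)
  have l: "x \<in> (I +>\<^bsub>H\<^esub> g) <+>\<^bsub>H\<^esub> I' \<longleftrightarrow> (\<exists>a\<in>I. \<exists>b\<in>I'. x = (a \<oplus>\<^bsub>H\<^esub> g) \<oplus>\<^bsub>H\<^esub> b)" for x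
    by (auto simp: a_r_coset_def' set_add_def set_mult_def)
  have r: "x \<in> I' +>\<^bsub>H\<^esub> g \<longleftrightarrow> (\<exists>b\<in>I'. x = b \<oplus>\<^bsub>H\<^esub> g)" for x
    by (auto simp: a_r_coset_def')
  have swap: "(a \<oplus>\<^bsub>H\<^esub> g) \<oplus>\<^bsub>H\<^esub> b = (a \<oplus>\<^bsub>H\<^esub> b) \<oplus>\<^bsub>H\<^esub> g" if "a \<in> I" "b \<in> I'" for a b
    using that g I.a_subset I'.a_subset by (simp add: H.a_ac subset_iff)
  have zero: "\<zero>\<^bsub>H\<^esub> \<oplus>\<^bsub>H\<^esub> b = b" if "b \<in> I'" for b
    using that I'.a_subset by (simp add: subset_iff)
  show ?thesis
  proof (intro equalityI subsetI)
    fix x assume "x \<in> (I +>\<^bsub>H\<^esub> g) <+>\<^bsub>H\<^esub> I'"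
    then obtain a b where "a \<in> I" "b \<in> I'" "x = (a \<oplus>\<^bsub>H\<^esub> b) \<oplus>\<^bsub>H\<^esub> g" unfolding l using swap by blast
    then show "x \<in> I' +>\<^bsub>H\<^esub> g" unfolding r using I'.a_closed I(3) by blast
  next
    fix x assume "x \<in> I' +>\<^bsub>H\<^esub> g"
    then obtain b where b: "b \<in> I'" "x = b \<oplus>\<^bsub>H\<^esub> g" unfolding r by blast
    then have "x = (\<zero>\<^bsub>H\<^esub> \<oplus>\<^bsub>H\<^esub> g) \<oplus>\<^bsub>H\<^esub> b" using swap[OF I.zero_closed b(1)] zero by simp
    then show "x \<in> (I +>\<^bsub>H\<^esub> g) <+>\<^bsub>H\<^esub> I'" unfolding l using I.zero_closed b(1) by blast
  qed
qed

lemma abelian_group_ext_im: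
  "abelian_group (ext_im A :: ('a list \<Rightarrow>\<^sub>0 'r::{comm_ring, comm_monoid_mult}) set ring)"
proof -
  let ?E = "ext_alg A :: ('a list \<Rightarrow>\<^sub>0 'r) set ring"
  let ?D = "ext_im A :: ('a list \<Rightarrow>\<^sub>0 'r) set ring"
  interpret E: ring ?E by (rule ring_ext_alg)
  have eq: "add_monoid ?D = (add_monoid ?E)\<lparr>carrier := carrier ?D\<rparr>" by (simp add: ext_im_def)
  have "Group.group (add_monoid ?D)"
    unfolding eq by (rule subgroup.subgroup_is_group[OF subgroup_ext_im E.a_group])
  moreover have "x \<oplus>\<^bsub>?D\<^esub> y = y \<oplus>\<^bsub>?D\<^esub> x" if "x \<in> carrier ?D" "y \<in> carrier ?D" for x y
  proof -
    have "x \<in> carrier ?E" "y \<in> carrier ?E" using that subgroup.subset[OF subgroup_ext_im, of A] by auto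
    moreover have "add ?D = add ?E" by (simp add: ext_im_def)
    ultimately show ?thesis using E.a_comm by metis
  qed
  ultimately have "comm_group (add_monoid ?D)" by (intro group.group_comm_groupI) simp_all
  then show ?thesis by (intro comm_group_abelian_groupI)
qed

lemma additive_subgroup_ext_im:
  assumes "ideal I (ext_alg A :: ('a list \<Rightarrow>\<^sub>0 'r::{comm_ring, comm_monoid_mult}) set ring)"
  shows "additive_subgroup (carrier (ext_im A) \<inter> I) (ext_im A)"
proof (rule additive_subgroupI)
  let ?E = "ext_alg A :: ('a list \<Rightarrow>\<^sub>0 'r) set ring"
  interpret E: ring ?E by (rule ring_ext_alg)
  have eq: "add_monoid (ext_im A) = (add_monoid ?E)\<lparr>carrier := carrier (ext_im A)\<rparr>"
    by (simp add: ext_im_def)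
  have "subgroup I (add_monoid ?E)"
    using ideal.axioms(1)[OF assms] by (rule additive_subgroup.a_subgroup)
  from group.subgroups_Inter_pair[OF E.a_group subgroup_ext_im this]
  show "subgroup (carrier (ext_im A) \<inter> I) (add_monoid (ext_im A))"
    unfolding eq by (rule group.subgroup_incl[OF E.a_group _ subgroup_ext_im]) simp
qed

lemma coset_ext_rel_hom:
  fixes A :: "'a set"
  shows "f \<in> polys A \<Longrightarrow> g \<in> polys A \<Longrightarrow>
    (ext_rel A +>\<^bsub>free_alg A\<^esub> f) \<oplus>\<^bsub>ext_alg A\<^esub> (ext_rel A +>\<^bsub>free_alg A\<^esub> g) =
    (ext_rel A +>\<^bsub>free_alg A\<^esub> (f + g) :: ('a list \<Rightarrow>\<^sub>0 'r::{comm_ring, comm_monoid_mult}) set)"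
proof -
  interpret R: ideal "ext_rel A" "free_alg A :: ('a list \<Rightarrow>\<^sub>0 'r) ring" by (rule ideal_ext_rel)
  assume "f \<in> polys A" "g \<in> polys A"
  then show ?thesis using R.a_rcos_sum[of f g] by (simp add: ext_alg_def FactRing_def)
qed

definition dep_simplex ::
    "('k::field \<Rightarrow> real) \<Rightarrow> 'k \<Rightarrow> ('k ^ 'n) set set \<Rightarrow> ('k, 'n::finite) vertex set \<Rightarrow>
     (('k ^ 'n) set list \<Rightarrow>\<^sub>0 'r::{comm_ring, comm_monoid_mult}) set" where
  "dep_simplex av \<pi> A \<sigma> = {f \<in> polys A. ext_rel A +>\<^bsub>free_alg A\<^esub> f \<in> simplex_ideal av \<pi> A \<sigma>}"

lemma quotients_At:
  fixes av :: "'k::field \<Rightarrow> real" and A :: "('k ^ 'n::finite) set set"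
  shows "quotients (polys A) (dep_simplex av \<pi> A)
    (At_sys av \<pi> A :: _ \<Rightarrow> (('k ^ 'n) set list \<Rightarrow>\<^sub>0 'r::{comm_ring, comm_monoid_mult}) set set ring)
    (At_res av \<pi> A)
    (\<lambda>\<sigma> f. simplex_ideal av \<pi> A \<sigma> +>\<^bsub>ext_alg A\<^esub> (ext_rel A +>\<^bsub>free_alg A\<^esub> f))"
proof -
  let ?E = "ext_alg A :: (('k ^ 'n) set list \<Rightarrow>\<^sub>0 'r) set ring"
  let ?p = "\<lambda>f :: ('k ^ 'n) set list \<Rightarrow>\<^sub>0 'r. ext_rel A +>\<^bsub>free_alg A\<^esub> f"
  have E: "abelian_group ?E" by (rule ring.is_abelian_group[OF ring_ext_alg])
  note I = ideal.axioms(1)[OF ideal_simplex_ideal]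
  note Q = quotient_by_subgroup[OF E I]
  have p: "?p f \<in> carrier ?E" if "f \<in> polys A" for f using that by (intro ext_rel_coset_closed) simp
  show ?thesis
  proof (rule quotients.intro, unfold At_sys_def)
    fix f g :: "('k ^ 'n) set list \<Rightarrow>\<^sub>0 'r" and \<sigma> \<tau> :: "('k, 'n) vertex set"
    show "abelian_group (?E Quot simplex_ideal av \<pi> A \<sigma>)" by (rule Q)
    show "(0 :: ('k ^ 'n) set list \<Rightarrow>\<^sub>0 'r) \<in> polys A" by simp
    assume f: "f \<in> polys A"
    show "- f \<in> polys A" using f by simp
    show "simplex_ideal av \<pi> A \<sigma> +>\<^bsub>?E\<^esub> ?p f \<in> carrier (?E Quot simplex_ideal av \<pi> A \<sigma>)"
      by (rule Q(2)[OF p[OF f]])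
    show "simplex_ideal av \<pi> A \<sigma> +>\<^bsub>?E\<^esub> ?p f = \<zero>\<^bsub>?E Quot simplex_ideal av \<pi> A \<sigma>\<^esub>
        \<longleftrightarrow> f \<in> dep_simplex av \<pi> A \<sigma>"
      unfolding Q(5)[OF p[OF f]] dep_simplex_def using f by simp
    show "At_res av \<pi> A \<tau> \<sigma> (simplex_ideal av \<pi> A \<tau> +>\<^bsub>?E\<^esub> ?p f) = simplex_ideal av \<pi> A \<sigma> +>\<^bsub>?E\<^esub> ?p f"
      if "\<tau> \<subseteq> \<sigma>"
      unfolding At_res_def by (rule coset_add_subgroup[OF E I I simplex_ideal_mono[OF that] p[OF f]])
    assume g: "g \<in> polys A"
    show "f + g \<in> polys A" using f g by (simp add: keys_add_lists)
    show "simplex_ideal av \<pi> A \<sigma> +>\<^bsub>?E\<^esub> ?p (f + g) =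
        (simplex_ideal av \<pi> A \<sigma> +>\<^bsub>?E\<^esub> ?p f) \<oplus>\<^bsub>?E Quot simplex_ideal av \<pi> A \<sigma>\<^esub>
        (simplex_ideal av \<pi> A \<sigma> +>\<^bsub>?E\<^esub> ?p g)"
      unfolding Q(3)[OF p[OF f] p[OF g]] coset_ext_rel_hom[OF f g] ..
  next
    fix x \<sigma> assume "x \<in> carrier (?E Quot simplex_ideal av \<pi> A \<sigma>)"
    then obtain y where y: "y \<in> carrier ?E" "x = simplex_ideal av \<pi> A \<sigma> +>\<^bsub>?E\<^esub> y" using Q(4) by blast
    obtain f where "f \<in> carrier (free_alg A)" "y = ?p f" using carrier_ext_algE[OF y(1)] by blast
    then show "\<exists>f\<in>polys A. x = simplex_ideal av \<pi> A \<sigma> +>\<^bsub>?E\<^esub> ?p f"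
      using y(2) by (intro bexI[of _ f]) simp_all
  qed
qed

definition im_polys :: "'a set \<Rightarrow> ('a list \<Rightarrow>\<^sub>0 'r::{comm_ring, comm_monoid_mult}) set" where
  "im_polys A = {f \<in> polys A. ext_rel A +>\<^bsub>free_alg A\<^esub> f \<in> carrier (ext_im A)}"

lemma quotients_A:
  fixes av :: "'k::field \<Rightarrow> real" and A :: "('k ^ 'n::finite) set set"
  shows "quotients (im_polys A) (dep_simplex av \<pi> A)
    (A_sys av \<pi> A :: _ \<Rightarrow> (('k ^ 'n) set list \<Rightarrow>\<^sub>0 'r::{comm_ring, comm_monoid_mult}) set set ring)
    (A_res av \<pi> A)
    (\<lambda>\<sigma> f. (carrier (ext_im A) \<inter> simplex_ideal av \<pi> A \<sigma>) +>\<^bsub>ext_im A\<^esub> (ext_rel A +>\<^bsub>free_alg A\<^esub> f))"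
proof -
  let ?E = "ext_alg A :: (('k ^ 'n) set list \<Rightarrow>\<^sub>0 'r) set ring"
  let ?D = "ext_im A :: (('k ^ 'n) set list \<Rightarrow>\<^sub>0 'r) set ring"
  let ?p = "\<lambda>f :: ('k ^ 'n) set list \<Rightarrow>\<^sub>0 'r. ext_rel A +>\<^bsub>free_alg A\<^esub> f"
  let ?I = "\<lambda>\<sigma>. carrier ?D \<inter> simplex_ideal av \<pi> A \<sigma>"
  interpret R: ideal "ext_rel A" "free_alg A :: (('k ^ 'n) set list \<Rightarrow>\<^sub>0 'r) ring" by (rule ideal_ext_rel)
  interpret D: abelian_group ?D by (rule abelian_group_ext_im)
  note I = additive_subgroup_ext_im[OF ideal_simplex_ideal]
  note Q = quotient_by_subgroup[OF abelian_group_ext_im I]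
  have addD: "add ?D = add ?E" "zero ?D = zero ?E" by (simp_all add: ext_im_def)
  have p: "?p f \<in> carrier ?D" if "f \<in> im_polys A" for f using that by (simp add: im_polys_def)
  have P: "f \<in> polys A" if "f \<in> im_polys A" for f :: "('k ^ 'n) set list \<Rightarrow>\<^sub>0 'r"
    using that by (simp add: im_polys_def)
  have hom: "?p (f + g) = ?p f \<oplus>\<^bsub>?D\<^esub> ?p g" if "f \<in> polys A" "g \<in> polys A" for f g
    unfolding addD using coset_ext_rel_hom[OF that] ..
  have z: "?p 0 = \<zero>\<^bsub>?D\<^esub>"
    unfolding addD using ring_hom_zero[OF R.rcos_ring_hom R.ring_axioms R.quotient_is_ring]
    by (simp add: ext_alg_def)
  have zero_in: "(0 :: ('k ^ 'n) set list \<Rightarrow>\<^sub>0 'r) \<in> im_polys A"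
    unfolding im_polys_def using D.zero_closed z by simp
  show ?thesis
  proof (rule quotients.intro, unfold A_sys_def)
    fix f g :: "('k ^ 'n) set list \<Rightarrow>\<^sub>0 'r" and \<sigma> \<tau> :: "('k, 'n) vertex set"
    show "abelian_group (?D Quot ?I \<sigma>)" by (rule Q)
    show "(0 :: ('k ^ 'n) set list \<Rightarrow>\<^sub>0 'r) \<in> im_polys A" by (rule zero_in)
    assume f: "f \<in> im_polys A"
    show "- f \<in> im_polys A"
    proof -
      have mf: "- f \<in> polys A" using P[OF f] by simp
      have "?p (- f) \<oplus>\<^bsub>?E\<^esub> ?p f = \<zero>\<^bsub>?E\<^esub>"
        using hom[OF mf P[OF f]] z by (simp add: addD)
      moreover obtain y where y: "y \<in> carrier ?D" "y \<oplus>\<^bsub>?E\<^esub> ?p f = \<zero>\<^bsub>?E\<^esub>"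
        using D.l_neg[OF p[OF f]] D.a_inv_closed[OF p[OF f]] by (auto simp: addD)
      moreover have "?p (- f) \<in> carrier ?E" "?p f \<in> carrier ?E" using P[OF f] by (simp_all add: ext_rel_coset_closed)
      moreover have "y \<in> carrier ?E" using y(1) subgroup.subset[OF subgroup_ext_im, of A] by auto
      ultimately have "?p (- f) = y"
        using abelian_group.minus_equality[OF ring.is_abelian_group[OF ring_ext_alg]] by metis
      then show ?thesis using y(1) mf by (simp add: im_polys_def)
    qed
    show "?I \<sigma> +>\<^bsub>?D\<^esub> ?p f \<in> carrier (?D Quot ?I \<sigma>)"
      by (rule Q(2)[OF p[OF f]])
    show "?I \<sigma> +>\<^bsub>?D\<^esub> ?p f = \<zero>\<^bsub>?D Quot ?I \<sigma>\<^esub> \<longleftrightarrow> f \<in> dep_simplex av \<pi> A \<sigma>"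
      unfolding Q(5)[OF p[OF f]] dep_simplex_def using p[OF f] P[OF f] by simp
    show "A_res av \<pi> A \<tau> \<sigma> (?I \<tau> +>\<^bsub>?D\<^esub> ?p f) = ?I \<sigma> +>\<^bsub>?D\<^esub> ?p f"
      if "\<tau> \<subseteq> \<sigma>"
      unfolding A_res_def
      by (rule coset_add_subgroup[OF abelian_group_ext_im I I _ p[OF f]])
         (intro Int_mono order_refl simplex_ideal_mono[OF that])
    assume g: "g \<in> im_polys A"
    show "f + g \<in> im_polys A"
      using f g D.a_closed[OF p[OF f] p[OF g]] by (simp add: im_polys_def keys_add_lists hom)
    show "?I \<sigma> +>\<^bsub>?D\<^esub> ?p (f + g) = (?I \<sigma> +>\<^bsub>?D\<^esub> ?p f) \<oplus>\<^bsub>?D Quot ?I \<sigma>\<^esub> (?I \<sigma> +>\<^bsub>?D\<^esub> ?p g)"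
      unfolding Q(3)[OF p[OF f] p[OF g]] hom[OF P[OF f] P[OF g]] ..
  next
    fix x \<sigma> assume "x \<in> carrier (?D Quot ?I \<sigma>)"
    then obtain y where y: "y \<in> carrier ?D" "x = ?I \<sigma> +>\<^bsub>?D\<^esub> y" using Q(4) by blast
    have "y \<in> carrier ?E" using y(1) subgroup.subset[OF subgroup_ext_im, of A] by auto
    then obtain f where "f \<in> carrier (free_alg A)" "y = ?p f" using carrier_ext_algE by blast
    then show "\<exists>f\<in>im_polys A. x = ?I \<sigma> +>\<^bsub>?D\<^esub> ?p f"
      using y by (intro bexI[of _ f]) (simp_all add: im_polys_def)
  qed
qed

text \<open>If \<open>g\<close> lifts a compatible family of elements \<open>f z\<close> of \<open>E = ker \<delta>\<close>, then so does
  \<open>\<delta>(e\<^sub>a \<and> g)\<close>, since \<open>f z = \<delta>(e\<^sub>a \<and> f z)\<close>.\<close>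

lemma lift_to_image:
  fixes f :: "'z \<Rightarrow> ('a list \<Rightarrow>\<^sub>0 'r::{comm_ring, comm_monoid_mult})"
  assumes a: "a \<in> A" and D: "\<And>z. z \<in> Z \<Longrightarrow> upclosed A (D z)"
      "\<And>z w. z \<in> Z \<Longrightarrow> w \<in> lists A \<Longrightarrow> \<not> distinct w \<Longrightarrow> w \<in> D z"
    and f: "\<And>z. z \<in> Z \<Longrightarrow> f z \<in> im_polys A"
    and g: "g \<in> polys A" "\<And>z. z \<in> Z \<Longrightarrow> g - f z \<in> dep_ideal (D z)"
  shows "\<exists>g\<in>im_polys A. \<forall>z\<in>Z. g - f z \<in> dep_ideal (D z)"
proof (intro bexI ballI)
  interpret R: ideal "ext_rel A" "free_alg A :: ('a list \<Rightarrow>\<^sub>0 'r) ring" by (rule ideal_ext_rel)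
  let ?h = "free_delta (word [a] 1 * g)"
  have ag: "word [a] 1 * g \<in> polys A"
    using a g(1) by (intro CollectI keys_mult_lists) auto
  then have "ext_rel A +>\<^bsub>free_alg A\<^esub> ?h = ext_delta A (ext_rel A +>\<^bsub>free_alg A\<^esub> (word [a] 1 * g))"
    by (intro ext_delta_coset[symmetric]) simp
  moreover have "ext_rel A +>\<^bsub>free_alg A\<^esub> (word [a] 1 * g) \<in> carrier (ext_alg A)"
    using ag by (intro ext_rel_coset_closed) simp
  ultimately show "?h \<in> im_polys A"
    using ag by (simp add: im_polys_def ext_im_def keys_free_delta)
  fix z assume z: "z \<in> Z"
  note up = D(1)[OF z]
  have rel: "ext_rel A \<subseteq> (dep_ideal (D z) :: ('a list \<Rightarrow>\<^sub>0 'r) set)"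
    by (rule ext_rel_subset_dep_ideal[OF up D(2)[OF z]])
  have "ext_rel A +>\<^bsub>free_alg A\<^esub> f z \<in> ext_delta A ` carrier (ext_alg A)" and fA: "f z \<in> polys A"
    using f[OF z] by (simp_all add: im_polys_def ext_im_def)
  then obtain y where y: "y \<in> carrier (ext_alg A)" "ext_rel A +>\<^bsub>free_alg A\<^esub> f z = ext_delta A y"
    by blast
  obtain u where u: "u \<in> carrier (free_alg A)" "y = ext_rel A +>\<^bsub>free_alg A\<^esub> u"
    using carrier_ext_algE[OF y(1)] by blast
  have "f z \<in> ext_rel A +>\<^bsub>free_alg A\<^esub> f z" using R.a_rcos_self fA by simp
  then obtain v where v: "v \<in> ext_rel A" "f z = v + free_delta u"
    unfolding y(2) u(2) ext_delta_coset[OF u(1)] by (auto simp: a_r_coset_def')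
  then have "free_delta (f z) \<in> dep_ideal (D z)"
    using dep_ideal_delta rel by (auto simp: free_delta_add)
  then have "word [a] 1 * free_delta (f z) \<in> dep_ideal (D z)"
    using a by (intro dep_ideal_mult_left_word[OF up]) auto
  moreover have "free_delta (word [a] 1 * (g - f z)) \<in> dep_ideal (D z)"
    using a g(2)[OF z] by (intro dep_ideal_delta dep_ideal_mult_left_word[OF up]) auto
  moreover have "?h - f z = free_delta (word [a] 1 * (g - f z)) - word [a] 1 * free_delta (f z)"
    by (simp add: right_diff_distrib free_delta_diff free_delta_letter_mult algebra_simps)
  ultimately show "?h - f z \<in> dep_ideal (D z)" using dep_ideal_diff by metis
qed

section \<open>Pointed simplices and stable sets\<close>

lemma sorted_wrt_psubset_bounds:
  assumes "sorted_wrt (\<subset>) Ls" "M \<in> set Ls"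
  shows "hd Ls \<subseteq> M" "M \<subseteq> last Ls"
proof -
  show "hd Ls \<subseteq> M" using assms by (cases Ls) auto
  have "Ls = butlast Ls @ [last Ls]" using assms(2) by (cases Ls) auto
  then have "sorted_wrt (\<subset>) (butlast Ls @ [last Ls])" "M \<in> set (butlast Ls @ [last Ls])"
    using assms by simp_all
  then show "M \<subseteq> last Ls" unfolding sorted_wrt_append by auto
qed

lemma sorted_wrt_psubset_comparable:
  assumes "sorted_wrt (\<subset>) Ls" "M \<in> set Ls" "N \<in> set Ls"
  shows "M \<subseteq> N \<or> N \<subseteq> M"
proof -
  obtain i j where ij: "i < length Ls" "j < length Ls" "M = Ls ! i" "N = Ls ! j"
    using assms(2,3) by (auto simp: in_set_conv_nth)
  then show ?thesis
    using sorted_wrt_nth_less[OF assms(1), of i j] sorted_wrt_nth_less[OF assms(1), of j i]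
    by (cases i j rule: linorder_cases) auto
qed

context prime_local_field
begin

text \<open>A scaling factor of absolute value less than 1 would carry a submodule of L into \<pi>L;
  one greater than 1 is excluded by exchanging the roles of M and M'.\<close>

lemma class_representative_unique:
  assumes "osub M" "osub M'" "scale_set \<pi> L \<subset> M" "M \<subseteq> L" "scale_set \<pi> L \<subset> M'" "M' \<subseteq> L"
    and "hclass M = hclass M'"
  shows "M = M'"
proof -
  obtain d where d: "d \<noteq> 0" "M' = scale_set d M" using hclass_eqD[OF assms(7)] by blast
  have small: False
    if "av e < 1" "osub N" "N \<subseteq> L" "scale_set \<pi> L \<subset> scale_set e N" for e N
  proof -
    have "scale_set e N \<subseteq> scale_set \<pi> N"
      using nonunit_smult[OF that(2,1)] by (auto simp: scale_set_def)
    then show False using scale_set_mono[OF that(3), of \<pi>] that(4) by blast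
  qed
  consider "av d < 1" | "av d = 1" | "av d > 1" by linarith
  then show ?thesis
  proof cases
    case 1
    then show ?thesis using small[of d M] assms d by blast
  next
    case 2
    then show ?thesis using scale_unit[OF assms(1)] d(2) by simp
  next
    case 3
    then have "av (inverse d) < 1" by (simp add: av_inverse inverse_less_1_iff)
    moreover have "M = scale_set (inverse d) M'" using d by (simp add: scale_set_scale_set)
    ultimately show ?thesis using small[of "inverse d" M'] assms by metis
  qed
qed

text \<open>Fixing the largest lattice makes the representation of a pointed simplex by lattices
  unique, so that its neighbours become submodules between \<pi>L and L.\<close>

definition normal_chain :: "('k ^ 'n::finite) set \<Rightarrow> ('k ^ 'n) set list \<Rightarrow> bool" where
  "normal_chain L Ls \<longleftrightarrow> Ls \<noteq> [] \<and> (\<forall>M\<in>set Ls. is_lattice av M) \<and> scale_set \<pi> L \<subset> hd Ls \<and>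
     sorted_wrt (\<subset>) Ls \<and> last Ls = L"

lemma normal_chain_bounds:
  assumes "normal_chain L Ls" "M \<in> set Ls"
  shows "is_lattice av M" "osub M" "scale_set \<pi> L \<subset> M" "M \<subseteq> L"
  using assms sorted_wrt_psubset_bounds[of Ls M] osub_lattice by (auto simp: normal_chain_def)

lemma normal_chain_Cons:
  assumes "Ls \<noteq> []"
  shows "normal_chain L (N # Ls) \<longleftrightarrow>
    is_lattice av N \<and> scale_set \<pi> L \<subset> N \<and> N \<subset> hd Ls \<and> normal_chain L Ls"
proof -
  have hd: "hd Ls \<in> set Ls" using assms by simp
  have le: "hd Ls \<subseteq> M" if "sorted_wrt (\<subset>) Ls" "M \<in> set Ls" for M
    using sorted_wrt_psubset_bounds(1) that .
  show ?thesis
  proof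
    assume n: "normal_chain L (N # Ls)"
    then have N: "scale_set \<pi> L \<subset> N" "N \<subset> hd Ls" using hd by (auto simp: normal_chain_def)
    then have "scale_set \<pi> L \<subset> hd Ls" by (rule psubset_trans)
    then show "is_lattice av N \<and> scale_set \<pi> L \<subset> N \<and> N \<subset> hd Ls \<and> normal_chain L Ls"
      using n N assms by (simp add: normal_chain_def)
  next
    assume n: "is_lattice av N \<and> scale_set \<pi> L \<subset> N \<and> N \<subset> hd Ls \<and> normal_chain L Ls"
    then have "N \<subset> M" if "M \<in> set Ls" for M
      using le[OF _ that] by (auto simp: normal_chain_def)
    then show "normal_chain L (N # Ls)" using n by (simp add: normal_chain_def)
  qed
qed

lemma hclass_inj_on_normal:
  assumes "normal_chain L Ls" "normal_chain L Ls'"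
  shows "inj_on hclass (set Ls \<union> set Ls')"
proof (rule inj_onI)
  fix M M' assume "M \<in> set Ls \<union> set Ls'" "M' \<in> set Ls \<union> set Ls'" and eq: "hclass M = hclass M'"
  moreover have "osub N \<and> scale_set \<pi> L \<subset> N \<and> N \<subseteq> L" if "N \<in> set Ls \<union> set Ls'" for N
    using that normal_chain_bounds[OF assms(1), of N] normal_chain_bounds[OF assms(2), of N] by auto
  ultimately show "M = M'" using class_representative_unique[of M M' L] by simp
qed

lemma pointed_of_normal_chain: "normal_chain L Ls \<Longrightarrow> length Ls = k + 1 \<Longrightarrow> pointed av \<pi> k (map hclass Ls)"
  unfolding pointed_def normal_chain_def by blast

lemma normal_chain_of_pointed:
  assumes xs: "pointed av \<pi> k xs" and L: "last xs = hclass L"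
  obtains Ls where "normal_chain L Ls" "length Ls = k + 1" "xs = map hclass Ls"
proof -
  obtain Ls where Ls: "length Ls = k + 1" "\<forall>M\<in>set Ls. is_lattice av M" "scale_set \<pi> (last Ls) \<subset> hd Ls"
    "sorted_wrt (\<subset>) Ls" "xs = map hclass Ls" using xs unfolding pointed_def by blast
  then have ne: "Ls \<noteq> []" by auto
  then have "hclass (last Ls) = hclass L" using L Ls(5) by (simp add: last_map)
  then obtain c where c: "c \<noteq> 0" "L = scale_set c (last Ls)" using hclass_eqD by blast
  let ?Ls = "map (scale_set c) Ls"
  have "scale_set \<pi> L = scale_set c (scale_set \<pi> (last Ls))"
    by (simp add: c(2) scale_set_scale_set mult.commute)
  then have "scale_set \<pi> L \<subset> hd ?Ls"
    using scale_set_strict_mono[OF c(1) Ls(3)] ne by (simp add: hd_map)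
  moreover have "sorted_wrt (\<subset>) ?Ls"
    unfolding sorted_wrt_map
    by (rule sorted_wrt_mono_rel[OF _ Ls(4)]) (rule scale_set_strict_mono[OF c(1)])
  moreover have "last ?Ls = L" using ne c(2) by (simp add: last_map)
  moreover have "\<forall>M\<in>set ?Ls. is_lattice av M" using Ls(2) is_lattice_scale[OF _ c(1)] by auto
  ultimately have nc: "normal_chain L ?Ls" using ne by (simp add: normal_chain_def)
  have "xs = map hclass ?Ls" using Ls(5) by (simp add: hclass_scale[OF c(1)])
  from that[OF nc _ this] Ls(1) show ?thesis by simp
qed

lemma normal_chain_unique:
  assumes "normal_chain L Ls" "normal_chain L Ls'" "map hclass Ls = map hclass Ls'"
  shows "Ls = Ls'"
  using assms inj_on_map_eq_map[OF hclass_inj_on_normal[OF assms(1,2)]] by blast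

text \<open>The dimension of M/\<pi>L grows strictly along the chain. This bound gives a meaning to
  the maximum in \<open>ell\<close>.\<close>

lemma length_normal_chain:
  assumes "normal_chain (L :: ('k ^ 'n::finite) set) Ls" "is_lattice av L"
  shows "length Ls \<le> CARD('n) + 1"
proof -
  have "sorted_wrt (\<lambda>M N. lrank L M < lrank L N) Ls"
  proof (rule sorted_wrt_mono_rel)
    show "sorted_wrt (\<subset>) Ls" using assms(1) by (simp add: normal_chain_def)
    fix M N assume "M \<in> set Ls" "N \<in> set Ls" "M \<subset> N"
    then show "lrank L M < lrank L N"
      using normal_chain_bounds[OF assms(1)] by (intro lrank_strict_mono[OF assms(2)]) blast+
  qed
  then have "sorted_wrt (<) (map (lrank L) Ls)" by (simp add: sorted_wrt_map)
  then have "distinct (map (lrank L) Ls)" by (simp add: strict_sorted_iff)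
  then have "length Ls = card (set (map (lrank L) Ls))" using distinct_card by fastforce
  also have "\<dots> \<le> card {..CARD('n)}"
    using lrank_le[OF assms(2)] by (intro card_mono) auto
  finally show ?thesis by simp
qed

section \<open>Neighbours and brackets in terms of lattices\<close>

lemma nbrs_iff:
  assumes Ls: "normal_chain L Ls"
  shows "z \<in> nbrs av \<pi> (map hclass Ls) \<longleftrightarrow> (\<exists>N. z = hclass N \<and> normal_chain L (N # Ls))"
proof
  have ne: "Ls \<noteq> []" "last Ls = L" using Ls by (simp_all add: normal_chain_def)
  assume "z \<in> nbrs av \<pi> (map hclass Ls)"
  then have p: "pointed av \<pi> (length Ls) (z # map hclass Ls)" by (simp add: nbrs_def)
  moreover have "last (z # map hclass Ls) = hclass L" using ne by (simp add: last_map)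
  ultimately obtain Ms where Ms: "normal_chain L Ms" "z # map hclass Ls = map hclass Ms"
    using normal_chain_of_pointed by metis
  then obtain N Ls' where N: "Ms = N # Ls'" "z = hclass N" "map hclass Ls = map hclass Ls'"
    by (cases Ms) auto
  then have "Ls' \<noteq> []" using ne by auto
  then have "normal_chain L Ls'" using Ms(1) N(1) normal_chain_Cons by blast
  then have "Ls' = Ls" using normal_chain_unique[OF Ls _ N(3)] by simp
  then show "\<exists>N. z = hclass N \<and> normal_chain L (N # Ls)" using N Ms(1) by blast
next
  assume "\<exists>N. z = hclass N \<and> normal_chain L (N # Ls)"
  then obtain N where "z = hclass N" "normal_chain L (N # Ls)" by blast
  then show "z \<in> nbrs av \<pi> (map hclass Ls)"
    using pointed_of_normal_chain[of L "N # Ls" "length Ls"] by (simp add: nbrs_def)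
qed

lemma nbr_le_iff:
  assumes N: "normal_chain L (N # Ls)" and U: "normal_chain L (U # Ls)" and ne: "Ls \<noteq> []"
  shows "nbr_le av \<pi> (map hclass Ls) (hclass N) (hclass U) \<longleftrightarrow> N \<subseteq> U"
proof
  have NU: "hclass N = hclass U \<Longrightarrow> N = U"
    using hclass_inj_on_normal[OF N U] by (auto dest: inj_onD)
  assume "nbr_le av \<pi> (map hclass Ls) (hclass N) (hclass U)"
  then consider "N = U" | "pointed av \<pi> (length Ls + 1) (map hclass (N # U # Ls))"
    using NU by (auto simp: nbr_le_def)
  then show "N \<subseteq> U"
  proof cases
    case 2
    moreover have "last (map hclass (N # U # Ls)) = hclass L"
      using U ne by (simp add: last_map normal_chain_def)
    ultimately obtain Ms where Ms: "normal_chain L Ms" "map hclass (N # U # Ls) = map hclass Ms"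
      using normal_chain_of_pointed by metis
    then obtain N' U' Ls' where M: "Ms = N' # U' # Ls'" "hclass N = hclass N'" "hclass U = hclass U'"
      by (auto simp: Cons_eq_map_conv)
    have "N' = N" "U' = U"
      using hclass_inj_on_normal[OF Ms(1) N] hclass_inj_on_normal[OF Ms(1) U] M
      by (auto dest!: inj_onD)
    then show ?thesis using Ms(1) M(1) by (auto simp: normal_chain_def)
  qed simp
next
  assume "N \<subseteq> U"
  show "nbr_le av \<pi> (map hclass Ls) (hclass N) (hclass U)"
  proof (cases "N = U")
    case False
    then have "normal_chain L (N # U # Ls)"
      using \<open>N \<subseteq> U\<close> N U ne normal_chain_Cons[of "U # Ls" L N] normal_chain_Cons[of Ls L N] by auto
    then show ?thesis using pointed_of_normal_chain[of L "N # U # Ls" "length Ls + 1"]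
      by (simp add: nbr_le_def)
  qed (simp add: nbr_le_def)
qed

text \<open>A longest chain starting at V can be lengthened by putting U in front of it.\<close>

lemma ell_strict_antimono:
  fixes L :: "('k ^ 'n::finite) set"
  assumes L: "is_lattice av L" and U: "normal_chain L (U # Ls)" and V: "normal_chain L (V # Ls)"
    and ne: "Ls \<noteq> []" and UV: "U \<subset> V"
  shows "ell av \<pi> (hclass V # map hclass Ls) < ell av \<pi> (hclass U # map hclass Ls)"
proof -
  define R where "R N r \<longleftrightarrow> (\<exists>ys. pointed av \<pi> r ys \<and> hd ys = hclass N \<and> last ys = hclass L)" for N r
  have ell: "ell av \<pi> (hclass N # map hclass Ls) = (GREATEST r. R N r)" if "normal_chain L (N # Ls)" for N
  proof -
    have "last (hclass N # map hclass Ls) = hclass L" using that ne by (simp add: last_map normal_chain_def)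
    then show ?thesis by (simp add: ell_def R_def)
  qed
  have R: "R N r \<longleftrightarrow> (\<exists>Ms. normal_chain L Ms \<and> length Ms = r + 1 \<and> hd Ms = N)"
    if N: "normal_chain L (N # Ls)" for N r
  proof
    assume "R N r"
    then obtain ys where ys: "pointed av \<pi> r ys" "hd ys = hclass N" "last ys = hclass L" by (auto simp: R_def)
    obtain Ms where Ms: "normal_chain L Ms" "length Ms = r + 1" "ys = map hclass Ms"
      using normal_chain_of_pointed[OF ys(1,3)] by blast
    have "hd Ms \<in> set Ms" using Ms(1) by (simp add: normal_chain_def)
    moreover have "hclass (hd Ms) = hclass N" using ys(2) Ms by (simp add: hd_map normal_chain_def)
    ultimately have "hd Ms = N"
      using hclass_inj_on_normal[OF Ms(1) N] by (auto dest: inj_onD)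
    then show "\<exists>Ms. normal_chain L Ms \<and> length Ms = r + 1 \<and> hd Ms = N" using Ms by blast
  next
    assume "\<exists>Ms. normal_chain L Ms \<and> length Ms = r + 1 \<and> hd Ms = N"
    then obtain Ms where Ms: "normal_chain L Ms" "length Ms = r + 1" "hd Ms = N" by blast
    then show "R N r" using pointed_of_normal_chain[OF Ms(1,2)]
      unfolding R_def by (intro exI[of _ "map hclass Ms"]) (simp add: hd_map last_map normal_chain_def)
  qed
  have bound: "r \<le> CARD('n)" if "R N r" "normal_chain L (N # Ls)" for N r
    using that R[OF that(2)] length_normal_chain[OF _ L] by fastforce
  have "R V (length Ls)" unfolding R[OF V] using V by (intro exI[of _ "V # Ls"]) simp
  then have "R V (GREATEST r. R V r)" using bound V by (rule_tac GreatestI_nat) blast+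
  then obtain Ms where Ms: "normal_chain L Ms" "length Ms = (GREATEST r. R V r) + 1" "hd Ms = V"
    unfolding R[OF V] by blast
  have "Ms \<noteq> []" using Ms(1) by (simp add: normal_chain_def)
  then have "normal_chain L (U # Ms)"
    using Ms U UV ne normal_chain_Cons[of Ms L U] normal_chain_Cons[of Ls L U] by auto
  then have "R U ((GREATEST r. R V r) + 1)"
    unfolding R[OF U] using Ms(2) by (intro exI[of _ "U # Ms"]) simp
  then have "(GREATEST r. R V r) + 1 \<le> (GREATEST r. R U r)"
    using bound U by (rule_tac Greatest_le_nat) blast+
  then show ?thesis using ell[OF U] ell[OF V] by simp
qed

text \<open>The intersection of U and V is itself a common lower bound and contains the bracket W.
  If W were smaller, its value of \<open>ell\<close> would be larger, against minimality.\<close>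

lemma bracket_eq_Int:
  assumes L: "is_lattice av L" and ne: "Ls \<noteq> []"
    and U: "normal_chain L (U # Ls)" and V: "normal_chain L (V # Ls)" and W: "normal_chain L (W # Ls)"
    and br: "is_bracket av \<pi> (map hclass Ls) (hclass U) (hclass V) (hclass W)"
  shows "W = U \<inter> V"
proof (rule ccontr)
  assume neq: "W \<noteq> U \<inter> V"
  have Ls: "normal_chain L Ls" using U ne normal_chain_Cons by blast
  have WUV: "W \<subseteq> U" "W \<subseteq> V"
    using br nbr_le_iff[OF W U ne] nbr_le_iff[OF W V ne] by (auto simp: is_bracket_def Let_def)
  have o: "osub U" "osub V" "scale_set \<pi> L \<subset> W" "U \<subseteq> L"
    using normal_chain_bounds[OF U] normal_chain_bounds[OF V] normal_chain_bounds[OF W] by auto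
  have "is_lattice av (U \<inter> V)"
    using o WUV by (intro intermediate_lattice[OF L] osub_Int) auto
  \<comment> \<open>That the intersection strictly contains \<pi>L is inherited from W; here it
    matters that the bracket is defined.\<close>
  then have I: "normal_chain L ((U \<inter> V) # Ls)"
    using U WUV o(3) unfolding normal_chain_Cons[OF ne] by auto
  have "ell av \<pi> (hclass W # map hclass Ls) < ell av \<pi> (hclass (U \<inter> V) # map hclass Ls)"
  proof -
    have "hclass (U \<inter> V) \<noteq> hclass W"
      using hclass_inj_on_normal[OF I W] neq by (auto dest: inj_onD)
    moreover have "hclass (U \<inter> V) \<in> nbrs av \<pi> (map hclass Ls)" using nbrs_iff[OF Ls] I by blast
    moreover have "nbr_le av \<pi> (map hclass Ls) (hclass (U \<inter> V)) (hclass U)"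
      "nbr_le av \<pi> (map hclass Ls) (hclass (U \<inter> V)) (hclass V)"
      using nbr_le_iff[OF I U ne] nbr_le_iff[OF I V ne] by auto
    ultimately show ?thesis using br by (auto simp: is_bracket_def Let_def)
  qed
  moreover have "W \<subset> U \<inter> V" using WUV neq by blast
  ultimately show False using ell_strict_antimono[OF L W I ne] by simp
qed

lemma adjacent_distinct:
  assumes "{z, z'} \<in> simplices av \<pi> 1" shows "z \<noteq> z'"
proof -
  obtain xs where xs: "pointed av \<pi> 1 xs" "{z, z'} = set xs" using assms by (auto simp: simplices_def)
  obtain Ls where Ls: "length Ls = 1 + 1" "\<forall>M\<in>set Ls. is_lattice av M" "scale_set \<pi> (last Ls) \<subset> hd Ls"
    "sorted_wrt (\<subset>) Ls" "xs = map hclass Ls" using xs(1) unfolding pointed_def by blast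
  then have n: "normal_chain (last Ls) Ls" by (auto simp: normal_chain_def)
  obtain M N where MN: "Ls = [M, N]" using Ls(1) by (auto simp: length_Suc_conv)
  then have "M \<noteq> N" using Ls(4) by auto
  then have "hclass M \<noteq> hclass N"
    using hclass_inj_on_normal[OF n n] MN by (auto dest: inj_onD)
  moreover have "{z, z'} = {hclass M, hclass N}" using xs(2) Ls(5) MN by simp
  ultimately show ?thesis by (auto simp: doubleton_eq_iff)
qed

lemma adjacent_of_psubset:
  assumes "normal_chain L (V # Ls)" "normal_chain L (U # Ls)" "V \<subset> U"
  shows "{hclass V, hclass U} \<in> simplices av \<pi> 1"
proof -
  have "scale_set \<pi> U \<subseteq> scale_set \<pi> L" "scale_set \<pi> L \<subset> V" "is_lattice av U" "is_lattice av V"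
    using normal_chain_bounds[OF assms(1)] normal_chain_bounds[OF assms(2)] scale_set_mono[of U L \<pi>] by auto
  \<comment> \<open>The edge is normalised at its own larger lattice U, which is possible because
    \<pi>U \<subseteq> \<pi>L.\<close>
  then have "normal_chain U [V, U]" using assms(3) by (auto simp: normal_chain_def)
  from pointed_of_normal_chain[OF this, of 1] have "pointed av \<pi> 1 [hclass V, hclass U]" by simp
  then show ?thesis
    unfolding simplices_def by (intro CollectI exI[of _ "[hclass V, hclass U]"]) simp
qed

text \<open>Translates a stable set into lattices: brackets become intersections, properly nested
  lattices are adjacent vertices, and there are finitely many lattices, so
  \<open>glue_dep_words\<close> applies. The second part passes to E by
  \<open>lift_to_image\<close>.\<close>

lemma glue_stable:
  fixes A :: "('k ^ 'n::finite) set set" and h :: "('k, 'n) vertex list"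
    and f :: "('k, 'n) vertex \<Rightarrow> (('k ^ 'n) set list \<Rightarrow>\<^sub>0 'r::{comm_ring, comm_monoid_mult})"
  assumes A: "A \<subseteq> projective_space" "A \<noteq> {}"
    and h: "pointed av \<pi> (k - 1) h" and st: "stable av \<pi> h M0"
    and f: "\<And>z. z \<in> M0 \<Longrightarrow> f z \<in> polys A"
      "\<And>z z'. z \<in> M0 \<Longrightarrow> z' \<in> M0 \<Longrightarrow> {z, z'} \<in> simplices av \<pi> 1 \<Longrightarrow>
        f z - f z' \<in> dep_simplex av \<pi> A (insert z (insert z' (set h)))"
  shows "\<exists>g\<in>polys A. \<forall>z\<in>M0. g - f z \<in> dep_simplex av \<pi> A (insert z (set h))"
    and "(\<And>z. z \<in> M0 \<Longrightarrow> f z \<in> im_polys A) \<Longrightarrow>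
      \<exists>g\<in>im_polys A. \<forall>z\<in>M0. g - f z \<in> dep_simplex av \<pi> A (insert z (set h))"
proof -
  obtain Ls where Ls: "\<forall>M\<in>set Ls. is_lattice av M" "scale_set \<pi> (last Ls) \<subset> hd Ls"
    "sorted_wrt (\<subset>) Ls" "h = map hclass Ls" "length Ls = k - 1 + 1" using h unfolding pointed_def by blast
  define L where "L = last Ls"
  have ne: "Ls \<noteq> []" using Ls(5) by auto
  have nL: "normal_chain L Ls" using Ls ne by (simp add: normal_chain_def L_def)
  have L: "is_lattice av L" using Ls(1) ne by (simp add: L_def)
  have "\<exists>v. v \<in> L \<and> v \<notin> scale_set \<pi> L \<and> line v = l" if l: "l \<in> A" for l
  proof -
    obtain a where a: "l = line a" "a \<noteq> 0" using l A(1) by (auto simp: projective_space_def)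
    obtain c where "c \<noteq> 0" "c *s a \<in> L" "c *s a \<notin> scale_set \<pi> L" using primitive_multiple[OF L a(2)] by blast
    then show ?thesis using a(1) line_smult by blast
  qed
  then obtain \<rho> where \<rho>: "\<And>l. l \<in> A \<Longrightarrow> \<rho> l \<in> L \<and> \<rho> l \<notin> scale_set \<pi> L \<and> line (\<rho> l) = l" by metis
  interpret lattice_lines av \<pi> L A \<rho> by unfold_locales (use L \<rho> in blast)+
  \<comment> \<open>The vertex of L appears both as \<pi>L and as L. Its relations are those at the
    level \<pi>L, since all generators lie in L.\<close>
  define \<B> where "\<B> = insert (scale_set \<pi> L) (set Ls)"
  define \<M> where "\<M> = {N. normal_chain L (N # Ls) \<and> hclass N \<in> M0}"
  define D where "D U = dep_words (insert U \<B>)" for U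
  have betw: "between M" if "M \<in> \<B>" for M
    using that between_\<pi>L normal_chain_bounds[OF nL, of M] by (auto simp: \<B>_def between_def)
  have \<M>_norm: "normal_chain L (U # Ls)" if "U \<in> \<M>" for U using that by (simp add: \<M>_def)
  have \<M>_betw: "between U" if "U \<in> \<M>" for U
    using normal_chain_bounds[OF \<M>_norm[OF that], of U] by (auto simp: between_def)
  have M0: "M0 = hclass ` \<M>"
  proof
    show "M0 \<subseteq> hclass ` \<M>"
    proof
      fix z assume z: "z \<in> M0"
      then have "z \<in> nbrs av \<pi> (map hclass Ls)" using st unfolding stable_def Ls(4) by blast
      then obtain N where "z = hclass N" "normal_chain L (N # Ls)" using nbrs_iff[OF nL] by blast
      then show "z \<in> hclass ` \<M>" using z unfolding \<M>_def by blast
    qed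
  qed (auto simp: \<M>_def)
  have inj: "U = V" if "U \<in> \<M>" "V \<in> \<M>" "hclass U = hclass V" for U V
    by (rule inj_onD[OF hclass_inj_on_normal[OF \<M>_norm[OF that(1)] \<M>_norm[OF that(2)]] that(3)]) simp_all
  have Int: "U \<inter> V \<in> \<M>" if UV: "U \<in> \<M>" "V \<in> \<M>" for U V
  proof -
    have "hclass U \<in> M0" "hclass V \<in> M0" using UV M0 by auto
    then obtain w where w: "w \<in> M0" "is_bracket av \<pi> h (hclass U) (hclass V) w"
      using st unfolding stable_def by blast
    then obtain W where W: "W \<in> \<M>" "w = hclass W" using M0 by blast
    have "W = U \<inter> V"
      using bracket_eq_Int[OF L ne \<M>_norm[OF UV(1)] \<M>_norm[OF UV(2)] \<M>_norm[OF W(1)]] w(2) W(2) Ls(4) by simp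
    then show ?thesis using W(1) by simp
  qed
  have fin: "finite \<M>"
    using finite_intermediate[OF L] by (rule finite_subset[rotated]) (use \<M>_betw in \<open>auto simp: between_def\<close>)
  have hclass_\<B>: "hclass ` \<B> = set h"
    using hclass_scale[OF \<pi>_nonzero, of L] ne by (auto simp: \<B>_def Ls(4) L_def)
  have nd: "w \<in> dep_words \<L>" if "w \<in> lists A" "\<not> distinct w" for w \<L> using that by (simp add: dep_words_def)
  have D_simplex: "g \<in> dep_simplex av \<pi> A (hclass ` \<K> \<union> set h) \<longleftrightarrow> g \<in> dep_ideal (dep_words (\<K> \<union> \<B>))"
    if "g \<in> polys A" "\<K> \<subseteq> \<M>" for g :: "('k ^ 'n) set list \<Rightarrow>\<^sub>0 'r" and \<K>
  proof -
    have "(\<Union>x\<in>hclass ` (\<K> \<union> \<B>). std_words av \<pi> A x) = dep_words (\<K> \<union> \<B>)"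
      by (rule std_words_Union) (use betw \<M>_betw that(2) in \<open>auto simp: \<B>_def\<close>)
    from simplex_ideal_iff[OF upclosed_dep_words this nd that(1)] that(1)
    show ?thesis unfolding dep_simplex_def image_Un hclass_\<B> by simp
  qed
  have diff_polys: "g - g' \<in> polys A" if "g \<in> polys A" "g' \<in> polys A" for g g' :: "('k ^ 'n) set list \<Rightarrow>\<^sub>0 'r"
    using that keys_add_lists[of g A "- g'"] by simp
  have D1: "g \<in> dep_simplex av \<pi> A (insert (hclass U) (set h)) \<longleftrightarrow> g \<in> dep_ideal (D U)"
    if "g \<in> polys A" "U \<in> \<M>" for g :: "('k ^ 'n) set list \<Rightarrow>\<^sub>0 'r" and U
    using D_simplex[OF that(1), of "{U}"] that(2) by (simp add: D_def)
  have "\<exists>g\<in>polys A. \<forall>U\<in>\<M>. g - f (hclass U) \<in> dep_ideal (dep_words (insert U \<B>))"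
  proof (rule glue_dep_words[where f = "\<lambda>U. f (hclass U)"])
    show "finite \<B>" "scale_set \<pi> L \<in> \<B>" by (auto simp: \<B>_def)
    show "between M" if "M \<in> \<B>" for M using betw that .
    show "M \<subseteq> N \<or> N \<subseteq> M" if "M \<in> \<B>" "N \<in> \<B>" for M N
      using that betw[OF that(1)] betw[OF that(2)] sorted_wrt_psubset_comparable[OF Ls(3), of M N]
      unfolding \<B>_def between_def by blast
    show "finite \<M>" by (rule fin)
    show "U \<inter> V \<in> \<M>" if "U \<in> \<M>" "V \<in> \<M>" for U V using Int that .
    show "between U" if "U \<in> \<M>" for U using \<M>_betw that .
    show "U \<subseteq> M" if "U \<in> \<M>" "M \<in> \<B>" "M \<noteq> scale_set \<pi> L" for U M
    proof -
      have "M \<in> set Ls" using that by (simp add: \<B>_def)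
      then show ?thesis using \<M>_norm[OF that(1)] by (auto simp: normal_chain_def)
    qed
    show "f (hclass U) \<in> polys A" if "U \<in> \<M>" for U using f(1) that M0 by blast
    fix U V assume UV: "U \<in> \<M>" "V \<in> \<M>" "V \<subset> U"
    have z: "hclass U \<in> M0" "hclass V \<in> M0" using UV M0 by auto
    have "{hclass U, hclass V} \<in> simplices av \<pi> 1"
      using adjacent_of_psubset[OF \<M>_norm[OF UV(2)] \<M>_norm[OF UV(1)] UV(3)] by (simp add: insert_commute)
    then have "f (hclass U) - f (hclass V) \<in> dep_simplex av \<pi> A (hclass ` {U, V} \<union> set h)"
      using f(2)[OF z] by simp
    then have "f (hclass U) - f (hclass V) \<in> dep_ideal (dep_words ({U, V} \<union> \<B>))"
      using D_simplex[OF diff_polys[OF f(1)[OF z(1)] f(1)[OF z(2)]], of "{U, V}"] UV by blast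
    \<comment> \<open>A dependence is witnessed at a single level, so a word dependent for U and V
      together is dependent for one of the two chains.\<close>
    then show "f (hclass U) - f (hclass V) \<in> dep_ideal (dep_words (insert U \<B>) \<union> dep_words (insert V \<B>))"
      by (rule dep_ideal_mono) (auto simp: dep_words_def dep_def)
  qed
  then obtain g where g: "g \<in> polys A" "\<And>U. U \<in> \<M> \<Longrightarrow> g - f (hclass U) \<in> dep_ideal (D U)"
    unfolding D_def by blast
  show "\<exists>g\<in>polys A. \<forall>z\<in>M0. g - f z \<in> dep_simplex av \<pi> A (insert z (set h))"
  proof (intro bexI[OF _ g(1)] ballI)
    fix z assume "z \<in> M0"
    then obtain U where "U \<in> \<M>" "z = hclass U" using M0 by blast
    then show "g - f z \<in> dep_simplex av \<pi> A (insert z (set h))"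
      using D1[OF diff_polys[OF g(1) f(1)[OF \<open>z \<in> M0\<close>]]] g(2) by blast
  qed
  assume im: "\<And>z. z \<in> M0 \<Longrightarrow> f z \<in> im_polys A"
  obtain a where "a \<in> A" using A(2) by blast
  have "\<exists>g\<in>im_polys A. \<forall>U\<in>\<M>. g - f (hclass U) \<in> dep_ideal (D U)"
  proof (rule lift_to_image[OF \<open>a \<in> A\<close> _ _ _ g(1)])
    show "upclosed A (D U)" for U unfolding D_def by (rule upclosed_dep_words)
    show "w \<in> D U" if "w \<in> lists A" "\<not> distinct w" for U w using nd that by (simp add: D_def)
  qed (use im g(2) M0 in blast)+
  then obtain g' where g': "g' \<in> im_polys A" "\<And>U. U \<in> \<M> \<Longrightarrow> g' - f (hclass U) \<in> dep_ideal (D U)" by blast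
  then have g'A: "g' \<in> polys A" by (simp add: im_polys_def)
  show "\<exists>g\<in>im_polys A. \<forall>z\<in>M0. g - f z \<in> dep_simplex av \<pi> A (insert z (set h))"
  proof (intro bexI[OF _ g'(1)] ballI)
    fix z assume "z \<in> M0"
    then obtain U where "U \<in> \<M>" "z = hclass U" using M0 by blast
    then show "g' - f z \<in> dep_simplex av \<pi> A (insert z (set h))"
      using D1[OF diff_polys[OF g'A f(1)[OF \<open>z \<in> M0\<close>]]] g'(2) by blast
  qed
qed

lemma pointed_neighbourhood:
  assumes "1 \<le> k" and h: "pointed av \<pi> (k - 1) h" and z: "z \<in> nbrs av \<pi> h"
  shows "z \<notin> set h" "insert z (set h) \<in> simplices av \<pi> k"
proof -
  obtain Ls where Ls: "length Ls = k - 1 + 1" "\<forall>M\<in>set Ls. is_lattice av M" "scale_set \<pi> (last Ls) \<subset> hd Ls"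
    "sorted_wrt (\<subset>) Ls" "h = map hclass Ls" using h unfolding pointed_def by blast
  have nL: "normal_chain (last Ls) Ls" using Ls by (auto simp: normal_chain_def)
  then obtain N where N: "z = hclass N" "normal_chain (last Ls) (N # Ls)"
    using z nbrs_iff Ls(5) by blast
  show "z \<notin> set h"
  proof
    assume "z \<in> set h"
    then obtain M where M: "M \<in> set Ls" "hclass N = hclass M" using N(1) Ls(5) by auto
    then have "N = M" using hclass_inj_on_normal[OF N(2) N(2)] by (auto dest: inj_onD)
    then show False using N(2) M(1) by (auto simp: normal_chain_def)
  qed
  \<comment> \<open>\<open>h\<close> has k - 1 + 1 vertices, which is k because k is
    positive.\<close>
  have "pointed av \<pi> k (z # h)" using z Ls assms(1) by (simp add: nbrs_def)
  then show "insert z (set h) \<in> simplices av \<pi> k"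
    unfolding simplices_def by (intro CollectI exI[of _ "z # h"]) simp
qed

end

theorem theorem2p6:
  fixes av :: "'k::field \<Rightarrow> real" and \<pi> :: 'k
    and lab :: "('k, 'n::finite) vertex \<Rightarrow> nat"
    and A :: "('k ^ 'n) set set"
    and d k :: nat
  assumes "nonarch_local_field av" and "prime_element av \<pi>"
    and "d \<ge> 1" and "CARD('n) = d + 1"
    and "labelling av \<pi> lab"
    and "A \<subseteq> projective_space" and "A \<noteq> {}"
    and "1 \<le> k" and "k \<le> d"
  shows "condition_S av \<pi> lab
           (At_sys av \<pi> A :: _ \<Rightarrow> (('k ^ 'n) set list \<Rightarrow>\<^sub>0 'r::{comm_ring, comm_monoid_mult}) set set ring)
           (At_res av \<pi> A) k \<and>
         condition_S av \<pi> lab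
           (A_sys av \<pi> A :: _ \<Rightarrow> (('k ^ 'n) set list \<Rightarrow>\<^sub>0 'r) set set ring)
           (A_res av \<pi> A) k"
proof -
  interpret prime_local_field av \<pi>
    using assms(1,2) by (simp add: prime_local_field_def prime_local_field_axioms_def)
  have simplex: "set h \<in> simplices av \<pi> (k - 1)" if "pointed av \<pi> (k - 1) h" for h :: "('k, 'n) vertex list"
    using that by (auto simp: simplices_def)
  have nbr: "z \<notin> set h" "insert z (set h) \<in> simplices av \<pi> k"
    if "pointed av \<pi> (k - 1) h" "stable av \<pi> h M0" "z \<in> M0" for h M0 and z :: "('k, 'n) vertex"
    using pointed_neighbourhood[OF assms(8) that(1)] that(2,3) by (auto simp: stable_def)
  have lab: "z \<noteq> z' \<and> lab z \<noteq> lab z'" if "{z, z'} \<in> simplices av \<pi> 1" for z z' :: "('k, 'n) vertex"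
  proof -
    have "{z, z'} \<in> all_simplices av \<pi>" using that unfolding all_simplices_def by blast
    then have "inj_on lab {z, z'}" using assms(5) unfolding labelling_def by blast
    then have "lab z = lab z' \<Longrightarrow> z = z'" by (rule inj_onD) simp_all
    then show ?thesis using adjacent_distinct[OF that] by blast
  qed
  \<comment> \<open>Representatives of elements of E are first glued in the whole free algebra, so
    they have to be seen there.\<close>
  have im: "im_polys A \<subseteq> (polys A :: (('k ^ 'n) set list \<Rightarrow>\<^sub>0 'r) set)" by (auto simp: im_polys_def)
  show ?thesis
    unfolding condition_S_def
  proof (intro conjI allI impI)
    fix h :: "('k, 'n) vertex list" and M0 assume h: "pointed av \<pi> (k - 1) h" "stable av \<pi> h M0"
    show "exact_at_middle av \<pi> lab
        (At_sys av \<pi> A :: _ \<Rightarrow> (('k ^ 'n) set list \<Rightarrow>\<^sub>0 'r) set set ring) (At_res av \<pi> A) k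
        {set h} {{z} \<union> set h | z. z \<in> M0}
        {{z, z'} \<union> set h | z z'. z \<in> M0 \<and> z' \<in> M0 \<and> {z, z'} \<in> simplices av \<pi> 1}"
      by (rule quotients.exact_at_middleI[OF quotients_At _ simplex[OF h(1)] nbr[OF h] lab
            glue_stable(1)[OF assms(6,7) h]]) simp_all
    show "exact_at_middle av \<pi> lab
        (A_sys av \<pi> A :: _ \<Rightarrow> (('k ^ 'n) set list \<Rightarrow>\<^sub>0 'r) set set ring) (A_res av \<pi> A) k
        {set h} {{z} \<union> set h | z. z \<in> M0}
        {{z, z'} \<union> set h | z z'. z \<in> M0 \<and> z' \<in> M0 \<and> {z, z'} \<in> simplices av \<pi> 1}"
    proof (rule quotients.exact_at_middleI[OF quotients_A _ simplex[OF h(1)] nbr[OF h] lab])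
      fix f :: "('k, 'n) vertex \<Rightarrow> (('k ^ 'n) set list \<Rightarrow>\<^sub>0 'r)"
      assume f: "\<And>z. z \<in> M0 \<Longrightarrow> f z \<in> im_polys A"
        "\<And>z z'. z \<in> M0 \<Longrightarrow> z' \<in> M0 \<Longrightarrow> {z, z'} \<in> simplices av \<pi> 1 \<Longrightarrow>
          f z - f z' \<in> dep_simplex av \<pi> A (insert z (insert z' (set h)))"
      show "\<exists>g\<in>im_polys A. \<forall>z\<in>M0. g - f z \<in> dep_simplex av \<pi> A (insert z (set h))"
        by (rule glue_stable(2)[OF assms(6,7) h subsetD[OF im f(1)] f(2) f(1)])
    qed simp_all
  qed
qed

end
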